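(* The functions $a_1,\dots,a_9$ form a minimal generating set of the coordinate ring $\mathbb{C}[\mathcal{C}_3]$ of the Calogero-Moser space $\mathcal{C}_3$, with defining relations $$\begin{aligned} a_3a_9-2a_4a_8+a_5a_7&=0,\\ a_5a_6-2a_4a_7+a_3a_8&=0,\\ 9a_3-a_3a_4^2+a_3^2a_5+6a_6a_8-6a_7^2&=0,\\ 9a_4-a_4^3+a_3a_4a_5+3a_6a_9-3a_7a_8&=0,\\ 9a_5-a_4^2a_5+a_3a_5^2+6a_7a_9-6a_8^2&=0. \end{aligned}$$ Explicitly, $$\mathbb{C}[\mathcal{C}_3]\cong\mathbb{C}[a_1,a_2]\otimes\mathbb{C}[a_3,a_4,a_5,a_6,a_7,a_8,a_9]/I,$$ where $I$ is the ideal generated by the left-hand sides of the five relations above.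
   Context: $\mathcal{M}_3$ is the algebra of complex $3\times3$ matrices; $\mathrm{GL}_3=\mathrm{GL}_3(\mathbb{C})$ acts on $\mathcal{M}_3\times\mathcal{M}_3$ by simultaneous conjugation. Let $\bar{\mathcal{C}}_3=\{(X,Y)\in\mathcal{M}_3\times\mathcal{M}_3 : \mathrm{rank}([X,Y]+I_3)=1\}$. The Calogero-Moser space is the quotient variety $\mathcal{C}_3=\bar{\mathcal{C}}_3/\!/\mathrm{GL}_3$; it is a smooth irreducible affine variety of dimension 6 (Wilson), embedded in $(\mathcal{M}_3\times\mathcal{M}_3)/\!/\mathrm{GL}_3$, so $\mathbb{C}[\mathcal{C}_3]$ is a quotient of $\mathbb{C}[\mathcal{M}_3\times\mathcal{M}_3]^{\mathrm{GL}_3}$. For $(X,Y)\in\bar{\mathcal{C}}_3$ put $A=X-\frac13\mathrm{Tr}(X)I_3$, $B=Y-\frac13\mathrm{Tr}(Y)I_3$, and let $a_1=\mathrm{Tr}(X)$, $a_2=\mathrm{Tr}(Y)$, $a_3=\mathrm{Tr}(A^2)$, $a_4=\mathrm{Tr}(AB)$, $a_5=\mathrm{Tr}(B^2)$, $a_6=\mathrm{Tr}(A^3)$, $a_7=\mathrm{Tr}(A^2B)$, $a_8=\mathrm{Tr}(AB^2)$, $a_9=\mathrm{Tr}(B^3)$. In the presentation the same symbols denote polynomial variables mapped to these functions. *)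

theory Defs
  imports
    "HOL-Analysis.Analysis"
    "HOL-Library.Poly_Mapping"
    "HOL-Algebra.Module"
    "HOL-Algebra.QuotRing"
    "HOL-Algebra.Generated_Rings"
begin

section \<open>Commutative algebras over the complex numbers\<close>

text \<open>
  A \<open>\<complex>\<close>-algebra is a record of type \<^typ>\<open>(complex, 'a) module\<close>: a ring together with
  a multiplication by complex scalars.
\<close>

text \<open>\<^term>\<open>U\<close> ranges over cosets, so that \<open>c \<odot> (I + x) = I + c \<odot> x\<close>.\<close>

definition alg_quot :: "(complex, 'a) module \<Rightarrow> 'a set \<Rightarrow> (complex, 'a set) module" where
  "alg_quot A I =
     \<lparr>carrier = carrier (A Quot I), mult = mult (A Quot I), one = one (A Quot I),
      zero = zero (A Quot I), add = add (A Quot I),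
      smult = (\<lambda>c U. \<Union>x\<in>U. I +>\<^bsub>A\<^esub> (c \<odot>\<^bsub>A\<^esub> x))\<rparr>"

definition alg_iso :: "(complex, 'a) module \<Rightarrow> (complex, 'b) module \<Rightarrow> ('a \<Rightarrow> 'b) set" where
  "alg_iso A B =
     {h \<in> ring_iso A B. \<forall>c. \<forall>x\<in>carrier A. h (c \<odot>\<^bsub>A\<^esub> x) = c \<odot>\<^bsub>B\<^esub> h x}"

definition alg_generate :: "(complex, 'a) module \<Rightarrow> 'a set \<Rightarrow> 'a set" where
  "alg_generate A S = generate_ring A (range (\<lambda>c. c \<odot>\<^bsub>A\<^esub> \<one>\<^bsub>A\<^esub>) \<union> S)"

text \<open>
  Minimality is with respect to inclusion, and for the indexed family: no proper
  subfamily generates. In particular the members of the family are pairwise distinct.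
\<close>

definition minimal_generating_family ::
    "(complex, 'a) module \<Rightarrow> 'i set \<Rightarrow> ('i \<Rightarrow> 'a) \<Rightarrow> bool" where
  "minimal_generating_family A J a \<longleftrightarrow>
     a ` J \<subseteq> carrier A \<and>
     alg_generate A (a ` J) = carrier A \<and>
     (\<forall>K. K \<subset> J \<longrightarrow> alg_generate A (a ` K) \<noteq> carrier A)"


section \<open>Tensor products of algebras\<close>

text \<open>
  The tensor product \<open>A \<otimes> B\<close> over \<open>\<complex>\<close> is the free vector space on
  \<^term>\<open>carrier A \<times> carrier B\<close> modulo the bilinearity relations. The free vector space
  is the monoid algebra of the multiplicative monoid of \<open>A \<times> B\<close>, so its elements
  are the finitely supported functions and its product extends
  \<open>(x, y) (x', y') = (x x', y y')\<close> bilinearly. The linear span of the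
  bilinearity relations is stable under multiplication by the basis elements, hence it is
  the ideal they generate.
\<close>

definition free_pair_basis :: "'a \<times> 'b \<Rightarrow> 'a \<times> 'b \<Rightarrow> complex" where
  "free_pair_basis u = (\<lambda>z. if z = u then 1 else 0)"

definition free_pair_alg ::
    "(complex, 'a) module \<Rightarrow> (complex, 'b) module \<Rightarrow> (complex, 'a \<times> 'b \<Rightarrow> complex) module" where
  "free_pair_alg A B =
     \<lparr>carrier = {f. finite {z. f z \<noteq> 0} \<and> {z. f z \<noteq> 0} \<subseteq> carrier A \<times> carrier B},
      mult = (\<lambda>f g z. \<Sum>u | f u \<noteq> 0. \<Sum>v | g v \<noteq> 0.
                f u * g v * free_pair_basis (fst u \<otimes>\<^bsub>A\<^esub> fst v, snd u \<otimes>\<^bsub>B\<^esub> snd v) z),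
      one = free_pair_basis (\<one>\<^bsub>A\<^esub>, \<one>\<^bsub>B\<^esub>),
      zero = (\<lambda>z. 0),
      add = (\<lambda>f g z. f z + g z),
      smult = (\<lambda>c f z. c * f z)\<rparr>"

definition bilinear_relations ::
    "(complex, 'a) module \<Rightarrow> (complex, 'b) module \<Rightarrow> ('a \<times> 'b \<Rightarrow> complex) set" where
  "bilinear_relations A B =
     {(\<lambda>z. free_pair_basis (x \<oplus>\<^bsub>A\<^esub> x', y) z - free_pair_basis (x, y) z
            - free_pair_basis (x', y) z)
        | x x' y. x \<in> carrier A \<and> x' \<in> carrier A \<and> y \<in> carrier B} \<union>
     {(\<lambda>z. free_pair_basis (x, y \<oplus>\<^bsub>B\<^esub> y') z - free_pair_basis (x, y) z
            - free_pair_basis (x, y') z)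
        | x y y'. x \<in> carrier A \<and> y \<in> carrier B \<and> y' \<in> carrier B} \<union>
     {(\<lambda>z. free_pair_basis (c \<odot>\<^bsub>A\<^esub> x, y) z - c * free_pair_basis (x, y) z)
        | c x y. x \<in> carrier A \<and> y \<in> carrier B} \<union>
     {(\<lambda>z. free_pair_basis (x, c \<odot>\<^bsub>B\<^esub> y) z - c * free_pair_basis (x, y) z)
        | c x y. x \<in> carrier A \<and> y \<in> carrier B}"

definition tensor_ideal ::
    "(complex, 'a) module \<Rightarrow> (complex, 'b) module \<Rightarrow> ('a \<times> 'b \<Rightarrow> complex) set" where
  "tensor_ideal A B = Idl\<^bsub>free_pair_alg A B\<^esub> (bilinear_relations A B)"

definition tensor_alg ::
    "(complex, 'a) module \<Rightarrow> (complex, 'b) module \<Rightarrow> (complex, ('a \<times> 'b \<Rightarrow> complex) set) module" where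
  "tensor_alg A B = alg_quot (free_pair_alg A B) (tensor_ideal A B)"

definition pure_tensor ::
    "(complex, 'a) module \<Rightarrow> (complex, 'b) module \<Rightarrow> 'a \<Rightarrow> 'b \<Rightarrow> ('a \<times> 'b \<Rightarrow> complex) set" where
  "pure_tensor A B x y = tensor_ideal A B +>\<^bsub>free_pair_alg A B\<^esub> free_pair_basis (x, y)"


section \<open>Polynomials in several variables\<close>

text \<open>
  A monomial is a finitely supported map from variables to exponents, and a polynomial is a
  finitely supported map from monomials to coefficients. The ring operations are those
  of \<^theory>\<open>HOL-Library.Poly_Mapping\<close>.
\<close>

type_synonym 'v cpoly = "('v \<Rightarrow>\<^sub>0 nat) \<Rightarrow>\<^sub>0 complex"

definition cvar :: "'v \<Rightarrow> 'v cpoly" where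
  "cvar i = Poly_Mapping.single (Poly_Mapping.single i 1) 1"

definition cpoly_vars :: "'v cpoly \<Rightarrow> 'v set" where
  "cpoly_vars p = (\<Union>m\<in>Poly_Mapping.keys p. Poly_Mapping.keys m)"

definition cpoly_eval :: "('v \<Rightarrow> complex) \<Rightarrow> 'v cpoly \<Rightarrow> complex" where
  "cpoly_eval x p =
     (\<Sum>m\<in>Poly_Mapping.keys p. Poly_Mapping.lookup p m *
        (\<Prod>i\<in>Poly_Mapping.keys m. x i ^ Poly_Mapping.lookup m i))"

definition poly_alg :: "'v set \<Rightarrow> (complex, 'v cpoly) module" where
  "poly_alg V =
     \<lparr>carrier = {p. cpoly_vars p \<subseteq> V}, mult = (*), one = 1, zero = 0, add = (+),
      smult = (\<lambda>c p. Poly_Mapping.single 0 c * p)\<rparr>"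


section \<open>The Calogero-Moser space\<close>

type_synonym matrix_pair = "(complex^3^3) \<times> (complex^3^3)"

definition CM_bar :: "matrix_pair set" where
  "CM_bar = {(X, Y). rank (X ** Y - Y ** X + mat 1) = 1}"

definition conj_pair :: "complex^3^3 \<Rightarrow> matrix_pair \<Rightarrow> matrix_pair" where
  "conj_pair g = (\<lambda>(X, Y). (g ** X ** matrix_inv g, g ** Y ** matrix_inv g))"

definition entry :: "matrix_pair \<Rightarrow> (3 \<times> 3) + (3 \<times> 3) \<Rightarrow> complex" where
  "entry z = case_sum (\<lambda>(i, j). fst z $ i $ j) (\<lambda>(i, j). snd z $ i $ j)"

text \<open>
  The set \<^const>\<open>CM_bar\<close> is closed (a matrix of trace 3 cannot have rank 0), so its coordinate
  ring consists of the restrictions of polynomial functions of the matrix entries. The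
  coordinate ring of the quotient \<open>\<C>\<^sub>3 = CM_bar // GL\<^sub>3\<close> is by definition the
  algebra of the invariants in it. Functions are undefined off \<^const>\<open>CM_bar\<close>.
\<close>

definition CM_coord :: "(complex, matrix_pair \<Rightarrow> complex) module" where
  "CM_coord =
     \<lparr>carrier = {f \<in> extensional CM_bar.
        (\<exists>p. \<forall>z\<in>CM_bar. f z = cpoly_eval (entry z) p) \<and>
        (\<forall>g. invertible g \<longrightarrow> (\<forall>z\<in>CM_bar. f (conj_pair g z) = f z))},
      mult = (\<lambda>f h. \<lambda>z\<in>CM_bar. f z * h z),
      one = (\<lambda>z\<in>CM_bar. 1),
      zero = (\<lambda>z\<in>CM_bar. 0),
      add = (\<lambda>f h. \<lambda>z\<in>CM_bar. f z + h z),
      smult = (\<lambda>c f. \<lambda>z\<in>CM_bar. c * f z)\<rparr>"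

text \<open>\<^term>\<open>CM_gen i\<close> is the function \<open>a\<^sub>i\<close>, for \<open>i = 1, \<dots>, 9\<close>.\<close>

definition CM_gen :: "nat \<Rightarrow> matrix_pair \<Rightarrow> complex" where
  "CM_gen i = restrict (\<lambda>(X, Y).
     let A = X - mat (trace X / 3); B = Y - mat (trace Y / 3)
     in [trace X, trace Y,
         trace (A ** A), trace (A ** B), trace (B ** B),
         trace (A ** A ** A), trace (A ** A ** B), trace (A ** B ** B), trace (B ** B ** B)]
        ! (i - 1)) CM_bar"

definition CM_eval :: "nat cpoly \<Rightarrow> matrix_pair \<Rightarrow> complex" where
  "CM_eval p = (\<lambda>z\<in>CM_bar. cpoly_eval (\<lambda>i. CM_gen i z) p)"

definition CM_relations :: "nat cpoly set" where
  "CM_relations =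
     (let a3 = cvar 3; a4 = cvar 4; a5 = cvar 5;
          a6 = cvar 6; a7 = cvar 7; a8 = cvar 8; a9 = cvar 9
      in {a3 * a9 - 2 * a4 * a8 + a5 * a7,
          a5 * a6 - 2 * a4 * a7 + a3 * a8,
          9 * a3 - a3 * a4^2 + a3^2 * a5 + 6 * a6 * a8 - 6 * a7^2,
          9 * a4 - a4^3 + a3 * a4 * a5 + 3 * a6 * a9 - 3 * a7 * a8,
          9 * a5 - a4^2 * a5 + a3 * a5^2 + 6 * a7 * a9 - 6 * a8^2})"

definition CM_ideal :: "nat cpoly set" where
  "CM_ideal = Idl\<^bsub>poly_alg {3..9}\<^esub> CM_relations"

end

theory Submission
  imports Defs
begin

text \<open>
  Write \<open>[A, B] + 1 = v w\<close> with a column \<open>v\<close> and a row \<open>w\<close>. The identity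
  \<open>E M E = Tr(E M) E\<close> for \<open>E = v w\<close> and the Cayley-Hamilton theorem give the five relations.
  Where \<open>D = a\<^sub>3 a\<^sub>5 - a\<^sub>4\<^sup>2 + 9\<close> does not vanish, \<open>(v, Av, Bv)\<close> is a basis, and where the
  discriminant of \<open>A\<close> does not vanish, \<open>(v, Av, A\<^sup>2 v)\<close> is one. The matrices of \<open>X\<close> and \<open>Y\<close> in
  these bases are explicit rational functions of the \<open>a\<^sub>i\<close>, so that every invariant function
  becomes a polynomial in the \<open>a\<^sub>i\<close> after multiplication by a power of \<open>D\<close>, or of the
  discriminant; neither averaging over \<open>GL\<^sub>3\<close> nor the first fundamental theorem is needed. Since
  both charts are parametrised by open subsets of affine spaces, a polynomial vanishing on
  \<^const>\<open>CM_bar\<close> is likewise carried into the ideal of relations. The same holds for the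
  discriminants of all \<open>A + t B\<close>. Modulo the relations, \<open>D\<close> and these discriminants generate the
  unit ideal, so the powers can be removed. Minimality holds because for every \<open>i\<close> there are
  two points that differ in the value of \<open>a\<^sub>i\<close> only.
\<close>

section \<open>Evaluation and substitution of polynomials\<close>

text \<open>Neither kind of chart suffices alone. The point where all \<open>a\<^sub>i\<close>
  vanish has \<open>D = 9\<close>, but there the discriminants of all \<open>A + t B\<close> are
  zero; the point with \<open>a\<^sub>4 = 3\<close>, \<open>a\<^sub>6 = 1\<close> and all other
  values 0 has \<open>D = 0\<close> and a nonzero discriminant. That the charts cover comes from
  \<open>9 - D = a\<^sub>4\<^sup>2 - a\<^sub>3 a\<^sub>5\<close>, the discriminant of the quadratic
  form \<open>Tr (A + t B)\<^sup>2\<close> up to a factor: where all the sextic's coefficients and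
  \<open>D\<close> vanish, its cube would have to be 0, yet it is \<open>9\<^sup>3\<close>. The 9
  goes back to \<open>Tr E = 3\<close>. The obstacle is that the ideal of relations is not known in
  advance to be radical, so nothing about it may be checked at points alone. Hence the identities
  carry the relations along with explicit cofactors. Powers are removed through the ideal of all
  multipliers \<open>r\<close> for which \<open>r p\<close> lies in the ideal of relations, or
  \<open>r f\<close> is a polynomial in the traces. Its radical contains \<open>D\<close> and the
  discriminants, hence 1, so exponents from different charts are never compared.\<close>

abbreviation cconst :: "complex \<Rightarrow> 'v cpoly" where
  "cconst \<equiv> Poly_Mapping.single 0"

definition mono_eval :: "('v \<Rightarrow> 'r::comm_semiring_1) \<Rightarrow> ('v \<Rightarrow>\<^sub>0 nat) \<Rightarrow> 'r" where
  "mono_eval s m = (\<Prod>i\<in>Poly_Mapping.keys m. s i ^ Poly_Mapping.lookup m i)"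

text \<open>Parametric in the target ring and in the map on coefficients, so that numerical
  evaluation and substitution of polynomials are two instances and the homomorphism laws are proved
  once.\<close>

definition peval :: "(complex \<Rightarrow> 'r::comm_ring_1) \<Rightarrow> ('v \<Rightarrow> 'r) \<Rightarrow> 'v cpoly \<Rightarrow> 'r" where
  "peval \<kappa> s p = (\<Sum>m\<in>Poly_Mapping.keys p. \<kappa> (Poly_Mapping.lookup p m) * mono_eval s m)"

definition coeff_hom :: "(complex \<Rightarrow> 'r::comm_ring_1) \<Rightarrow> bool" where
  "coeff_hom \<kappa> \<longleftrightarrow> \<kappa> 0 = 0 \<and> \<kappa> 1 = 1 \<and> (\<forall>a b. \<kappa> (a + b) = \<kappa> a + \<kappa> b) \<and> (\<forall>a b. \<kappa> (a * b) = \<kappa> a * \<kappa> b)"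

definition psubst :: "('v \<Rightarrow> 'w cpoly) \<Rightarrow> 'v cpoly \<Rightarrow> 'w cpoly" where
  "psubst = peval cconst"

lemma cpoly_eval_eq_peval: "cpoly_eval = peval (\<lambda>c. c)"
  by (intro ext) (simp add: cpoly_eval_def peval_def mono_eval_def)

lemma coeff_hom_id: "coeff_hom (\<lambda>c. c)"
  by (simp add: coeff_hom_def)

lemma coeff_hom_cconst: "coeff_hom (cconst :: complex \<Rightarrow> 'w cpoly)"
  by (simp add: coeff_hom_def single_add mult_single)

lemma mono_eval_superset:
  assumes "finite S" "Poly_Mapping.keys m \<subseteq> S"
  shows "mono_eval s m = (\<Prod>i\<in>S. s i ^ Poly_Mapping.lookup m i)"
  unfolding mono_eval_def by (rule prod.mono_neutral_left) (use assms in \<open>auto simp: in_keys_iff\<close>)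

lemma mono_eval_add: "mono_eval s (m + n) = mono_eval s m * mono_eval s n"
proof -
  let ?S = "Poly_Mapping.keys m \<union> Poly_Mapping.keys n"
  have "mono_eval s (m + n) = (\<Prod>i\<in>?S. s i ^ Poly_Mapping.lookup (m + n) i)"
    by (rule mono_eval_superset) (use keys_add[of m n] in auto)
  also have "\<dots> = mono_eval s m * mono_eval s n"
    by (simp add: mono_eval_superset[of ?S] lookup_add power_add prod.distrib)
  finally show ?thesis .
qed

lemma mono_eval_0 [simp]: "mono_eval s 0 = 1"
  by (simp add: mono_eval_def)

lemma mono_eval_single: "mono_eval s (Poly_Mapping.single i k) = s i ^ k"
  by (cases "k = 0") (simp_all add: mono_eval_def)

lemma poly_mapping_sum_single:
  "p = (\<Sum>m\<in>Poly_Mapping.keys p. Poly_Mapping.single m (Poly_Mapping.lookup p m))"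
proof (rule poly_mapping_eqI)
  fix k
  have "Poly_Mapping.lookup (\<Sum>m\<in>Poly_Mapping.keys p. Poly_Mapping.single m (Poly_Mapping.lookup p m)) k
      = (\<Sum>m\<in>Poly_Mapping.keys p. if m = k then Poly_Mapping.lookup p m else 0)"
    unfolding lookup_sum by (rule sum.cong) (auto simp: lookup_single when_def)
  also have "\<dots> = Poly_Mapping.lookup p k"
    by (simp add: sum.delta in_keys_iff)
  finally show "Poly_Mapping.lookup p k
      = Poly_Mapping.lookup (\<Sum>m\<in>Poly_Mapping.keys p. Poly_Mapping.single m (Poly_Mapping.lookup p m)) k"
    by simp
qed

lemma poly_mapping_single_induct [case_names zero single add]:
  fixes p :: "'a \<Rightarrow>\<^sub>0 'b::comm_monoid_add"
  assumes "Pr 0" "\<And>m c. m \<in> Poly_Mapping.keys p \<Longrightarrow> Pr (Poly_Mapping.single m c)" "\<And>p q. Pr p \<Longrightarrow> Pr q \<Longrightarrow> Pr (p + q)"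
  shows "Pr p"
proof -
  have "Pr (\<Sum>m\<in>S. Poly_Mapping.single m (Poly_Mapping.lookup p m))"
    if "finite S" "S \<subseteq> Poly_Mapping.keys p" for S
    using that by (induction S) (auto intro: assms)
  from this[of "Poly_Mapping.keys p"] poly_mapping_sum_single[of p] show ?thesis by simp
qed

lemma mono_eval_cvar:
  "mono_eval cvar m = (Poly_Mapping.single m 1 :: 'v cpoly)"
proof -
  have pw: "cvar i ^ k = (Poly_Mapping.single (Poly_Mapping.single i k) 1 :: 'v cpoly)" for i k
    by (induction k) (simp_all add: cvar_def mult_single flip: single_add)
  have *: "(\<Prod>i\<in>S. cvar i ^ Poly_Mapping.lookup m i)
      = (Poly_Mapping.single (\<Sum>i\<in>S. Poly_Mapping.single i (Poly_Mapping.lookup m i)) 1 :: 'v cpoly)"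
    if "finite S" for S
    using that by (induction S) (simp_all add: pw mult_single)
  show ?thesis
    unfolding mono_eval_def by (subst *) (simp_all flip: poly_mapping_sum_single)
qed

lemma single_eq_const_mult_mono: "Poly_Mapping.single m c = cconst c * mono_eval cvar m"
  by (simp add: mono_eval_cvar mult_single)

text \<open>Every monomial of \<open>p\<close> is a product of powers of variables from
  \<open>V\<close>. Since \<open>V\<close> enters only through the variable case, the sum and
  product cases carry no side condition.\<close>

lemma cpoly_induct [consumes 1, case_names const var add mult]:
  assumes "cpoly_vars p \<subseteq> V" "\<And>c. Pr (cconst c)" "\<And>i. i \<in> V \<Longrightarrow> Pr (cvar i)"
    "\<And>p q. Pr p \<Longrightarrow> Pr q \<Longrightarrow> Pr (p + q)" "\<And>p q. Pr p \<Longrightarrow> Pr q \<Longrightarrow> Pr (p * q)"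
  shows "Pr p"
proof (induction p rule: poly_mapping_single_induct)
  case zero
  then show ?case using assms(2)[of 0] by simp
next
  case (single m c)
  have one: "Pr 1" using assms(2)[of 1] by simp
  have pw: "Pr (cvar i ^ k)" if "i \<in> V" for i k
    by (induction k) (auto intro!: assms(3,5) one that)
  have "Pr (\<Prod>i\<in>S. cvar i ^ Poly_Mapping.lookup m i)" if "finite S" "S \<subseteq> V" for S
    using that by (induction S) (auto intro!: assms(5) one pw)
  moreover have "Poly_Mapping.keys m \<subseteq> V" using assms(1) single by (auto simp: cpoly_vars_def)
  ultimately have "Pr (mono_eval cvar m)" by (simp add: mono_eval_def)
  then show ?case
    by (subst single_eq_const_mult_mono) (rule assms(5)[OF assms(2)])
qed (auto intro: assms)

context
  fixes \<kappa> :: "complex \<Rightarrow> 'r::comm_ring_1"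
  assumes \<kappa>: "coeff_hom \<kappa>"
begin

lemma peval_add: "peval \<kappa> s (p + q) = peval \<kappa> s p + peval \<kappa> s q"
  unfolding peval_def
  by (rule setsum_keys_plus_distrib[where f = "\<lambda>m c. \<kappa> c * mono_eval s m"])
     (use \<kappa> in \<open>auto simp: coeff_hom_def algebra_simps\<close>)

lemma peval_single: "peval \<kappa> s (Poly_Mapping.single m c) = \<kappa> c * mono_eval s m"
  using \<kappa> by (cases "c = 0") (simp_all add: peval_def coeff_hom_def)

lemma peval_mult: "peval \<kappa> s (p * q) = peval \<kappa> s p * peval \<kappa> s q"
proof (induction p rule: poly_mapping_single_induct)
  case (single m c)
  show ?case
  proof (induction q rule: poly_mapping_single_induct)
    case (single n d)
    show ?case
      using \<kappa> by (simp add: peval_single mult_single mono_eval_add coeff_hom_def)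
  qed (simp_all add: peval_add distrib_left peval_def[of _ _ 0])
qed (simp_all add: peval_add distrib_right peval_def[of _ _ 0])

lemma peval_cvar: "peval \<kappa> s (cvar i) = s i"
  using \<kappa> by (simp add: cvar_def peval_single mono_eval_single coeff_hom_def)

lemma peval_0: "peval \<kappa> s 0 = 0"
  by (simp add: peval_def)

lemma peval_1: "peval \<kappa> s 1 = 1"
  using peval_single[of s 0 1] \<kappa> by (simp add: coeff_hom_def)

lemma peval_uminus: "peval \<kappa> s (- p) = - peval \<kappa> s p"
  using peval_add[of s p "- p"] by (simp add: peval_0 eq_neg_iff_add_eq_0 add.commute)

lemma peval_diff: "peval \<kappa> s (p - q) = peval \<kappa> s p - peval \<kappa> s q"
  using peval_add[of s p "- q"] by (simp add: peval_uminus)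

lemma peval_power: "peval \<kappa> s (p ^ k) = peval \<kappa> s p ^ k"
  by (induction k) (simp_all add: peval_1 peval_mult)

lemma peval_of_nat: "peval \<kappa> s (of_nat k) = of_nat k"
  by (induction k) (simp_all add: peval_0 peval_1 peval_add)

lemma peval_numeral: "peval \<kappa> s (numeral k) = numeral k"
  using peval_of_nat[of s "numeral k"] by simp

end

lemmas cpoly_eval_simps [simp] =
  peval_add[OF coeff_hom_id, folded cpoly_eval_eq_peval]
  peval_mult[OF coeff_hom_id, folded cpoly_eval_eq_peval]
  peval_cvar[OF coeff_hom_id, folded cpoly_eval_eq_peval]
  peval_0[OF coeff_hom_id, folded cpoly_eval_eq_peval]
  peval_1[OF coeff_hom_id, folded cpoly_eval_eq_peval]
  peval_uminus[OF coeff_hom_id, folded cpoly_eval_eq_peval]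
  peval_diff[OF coeff_hom_id, folded cpoly_eval_eq_peval]
  peval_power[OF coeff_hom_id, folded cpoly_eval_eq_peval]
  peval_numeral[OF coeff_hom_id, folded cpoly_eval_eq_peval]

lemma cpoly_eval_cconst [simp]: "cpoly_eval s (cconst c) = c"
  by (simp add: cpoly_eval_eq_peval peval_single[OF coeff_hom_id])

lemmas psubst_simps [simp] =
  peval_add[OF coeff_hom_cconst, folded psubst_def]
  peval_mult[OF coeff_hom_cconst, folded psubst_def]
  peval_cvar[OF coeff_hom_cconst, folded psubst_def]
  peval_0[OF coeff_hom_cconst, folded psubst_def]
  peval_1[OF coeff_hom_cconst, folded psubst_def]
  peval_uminus[OF coeff_hom_cconst, folded psubst_def]
  peval_diff[OF coeff_hom_cconst, folded psubst_def]
  peval_power[OF coeff_hom_cconst, folded psubst_def]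
  peval_numeral[OF coeff_hom_cconst, folded psubst_def]

lemma psubst_cconst [simp]: "psubst s (cconst c) = cconst c"
  by (simp add: psubst_def peval_single[OF coeff_hom_cconst])

lemma cpoly_eval_psubst:
  "cpoly_eval x (psubst s p) = cpoly_eval (\<lambda>i. cpoly_eval x (s i)) p"
  by (induction p rule: cpoly_induct[OF subset_UNIV]) simp_all

lemma psubst_psubst:
  "psubst t (psubst s p) = psubst (\<lambda>i. psubst t (s i)) p"
  by (induction p rule: cpoly_induct[OF subset_UNIV]) simp_all

lemma cpoly_eval_cong:
  assumes "cpoly_vars p \<subseteq> V" "\<And>i. i \<in> V \<Longrightarrow> x i = y i"
  shows "cpoly_eval x p = cpoly_eval y p"
  using assms by (induction p rule: cpoly_induct) simp_all

lemma psubst_cvar_id: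
  assumes "cpoly_vars p \<subseteq> V" "\<And>i. i \<in> V \<Longrightarrow> s i = cvar i"
  shows "psubst s p = p"
  using assms by (induction p rule: cpoly_induct) simp_all

section \<open>Variables occurring in a polynomial\<close>

lemma cpoly_vars_cconst [simp]: "cpoly_vars (cconst c) = {}"
  by (simp add: cpoly_vars_def)

lemma cpoly_vars_cvar [simp]: "cpoly_vars (cvar i) = {i}"
  by (simp add: cpoly_vars_def cvar_def)

lemma cpoly_vars_0 [simp]: "cpoly_vars 0 = {}"
  by (simp add: cpoly_vars_def)

lemma cpoly_vars_1 [simp]: "cpoly_vars 1 = {}"
  by (simp add: cpoly_vars_def)

lemma cpoly_vars_numeral [simp]: "cpoly_vars (numeral k) = {}"
  by (metis cpoly_vars_cconst single_numeral)

lemma cpoly_vars_add: "cpoly_vars p \<subseteq> V \<Longrightarrow> cpoly_vars q \<subseteq> V \<Longrightarrow> cpoly_vars (p + q) \<subseteq> V"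
proof
  assume V: "cpoly_vars p \<subseteq> V" "cpoly_vars q \<subseteq> V"
  fix i assume "i \<in> cpoly_vars (p + q)"
  then obtain m where "m \<in> Poly_Mapping.keys (p + q)" "i \<in> Poly_Mapping.keys m"
    by (auto simp: cpoly_vars_def)
  moreover from this have "m \<in> Poly_Mapping.keys p \<or> m \<in> Poly_Mapping.keys q"
    using keys_add[of p q] by auto
  ultimately have "i \<in> cpoly_vars p \<or> i \<in> cpoly_vars q"
    by (auto simp: cpoly_vars_def)
  with V show "i \<in> V" by auto
qed

lemma cpoly_vars_uminus [simp]: "cpoly_vars (- p) = cpoly_vars p"
  by (simp add: cpoly_vars_def)

lemma cpoly_vars_diff: "cpoly_vars p \<subseteq> V \<Longrightarrow> cpoly_vars q \<subseteq> V \<Longrightarrow> cpoly_vars (p - q) \<subseteq> V"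
  using cpoly_vars_add[of p V "- q"] by simp

lemma cpoly_vars_mult: "cpoly_vars p \<subseteq> V \<Longrightarrow> cpoly_vars q \<subseteq> V \<Longrightarrow> cpoly_vars (p * q) \<subseteq> V"
proof
  assume V: "cpoly_vars p \<subseteq> V" "cpoly_vars q \<subseteq> V"
  fix i assume "i \<in> cpoly_vars (p * q)"
  then obtain m where m: "m \<in> Poly_Mapping.keys (p * q)" "i \<in> Poly_Mapping.keys m"
    by (auto simp: cpoly_vars_def)
  then obtain a b where "m = a + b" "a \<in> Poly_Mapping.keys p" "b \<in> Poly_Mapping.keys q"
    using keys_mult[of p q] by auto
  moreover have "i \<in> Poly_Mapping.keys a \<or> i \<in> Poly_Mapping.keys b"
    using m keys_add[of a b] \<open>m = a + b\<close> by auto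
  ultimately have "i \<in> cpoly_vars p \<or> i \<in> cpoly_vars q"
    by (auto simp: cpoly_vars_def)
  with V show "i \<in> V" by auto
qed

lemma cpoly_vars_power: "cpoly_vars p \<subseteq> V \<Longrightarrow> cpoly_vars (p ^ k) \<subseteq> V"
  by (induction k) (simp_all add: cpoly_vars_mult)

lemmas cpoly_vars_intros = cpoly_vars_add cpoly_vars_diff cpoly_vars_mult cpoly_vars_power

lemma cpoly_vars_psubst:
  assumes "\<And>i. cpoly_vars (s i) \<subseteq> V"
  shows "cpoly_vars (psubst s p) \<subseteq> V"
  by (induction p rule: cpoly_induct[OF subset_UNIV]) (simp_all add: cpoly_vars_intros assms)

text \<open>Dedekind's argument: distinct monomials are distinct characters of the multiplicative
  monoid of points, hence linearly independent.\<close>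

lemma mono_eval_independent:
  fixes c :: "('v \<Rightarrow>\<^sub>0 nat) \<Rightarrow> complex"
  assumes "finite M" "\<And>x. (\<Sum>m\<in>M. c m * mono_eval x m) = 0" "m \<in> M"
  shows "c m = 0"
  using assms
proof (induction M arbitrary: c m)
  case (insert m0 M)
  have mult: "mono_eval (\<lambda>i. x i * y i) n = mono_eval x n * mono_eval y n"
    for x y :: "'v \<Rightarrow> complex" and n
    by (simp add: mono_eval_def power_mult_distrib prod.distrib)
  have M: "c n = 0" if n: "n \<in> M" for n
  proof -
    obtain i where i: "Poly_Mapping.lookup n i \<noteq> Poly_Mapping.lookup m0 i"
      using insert.hyps n by (metis poly_mapping_eqI)
    define y where "y = (\<lambda>j. if j = i then 2 else 1 :: complex)"
    have y: "mono_eval y k = 2 ^ Poly_Mapping.lookup k i" for k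
    proof -
      have "mono_eval y k = (\<Prod>j\<in>insert i (Poly_Mapping.keys k). y j ^ Poly_Mapping.lookup k j)"
        by (rule mono_eval_superset) auto
      also have "\<dots> = (\<Prod>j\<in>{i}. y j ^ Poly_Mapping.lookup k j)"
        by (rule prod.mono_neutral_right) (auto simp: y_def)
      finally show ?thesis by (simp add: y_def)
    qed
    \<comment> \<open>Subtracting \<open>mono_eval y m0\<close> times the relation at
      \<open>x\<close> from the relation at the product point \<open>x i * y i\<close> cancels the
      term of \<open>m0\<close> and leaves a relation over \<open>M\<close> alone.\<close>
    have "c n * (mono_eval y n - mono_eval y m0) = 0"
    proof (rule insert.IH[of "\<lambda>m. c m * (mono_eval y m - mono_eval y m0)" n])
      fix x :: "'v \<Rightarrow> complex"
      have "(\<Sum>m\<in>M. c m * (mono_eval y m - mono_eval y m0) * mono_eval x m)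
          = (\<Sum>m\<in>insert m0 M. c m * (mono_eval y m - mono_eval y m0) * mono_eval x m)"
        using insert.hyps by simp
      also have "\<dots> = (\<Sum>m\<in>insert m0 M. c m * mono_eval (\<lambda>i. x i * y i) m)
          - mono_eval y m0 * (\<Sum>m\<in>insert m0 M. c m * mono_eval x m)"
        by (simp only: mult sum_distrib_left flip: sum_subtractf) (simp add: algebra_simps)
      also have "\<dots> = 0"
        by (simp only: insert.prems(1)) simp
      finally show "(\<Sum>m\<in>M. c m * (mono_eval y m - mono_eval y m0) * mono_eval x m) = 0" .
    qed (use n in auto)
    moreover have "mono_eval y n \<noteq> mono_eval y m0"
      proof
      assume "mono_eval y n = mono_eval y m0"
      then have "norm ((2::complex) ^ Poly_Mapping.lookup n i) = norm ((2::complex) ^ Poly_Mapping.lookup m0 i)"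
        by (simp only: y)
      with i show False by (simp add: norm_power)
    qed
    ultimately show ?thesis by simp
  qed
  have "c m0 = 0"
    using insert.prems(1)[of "\<lambda>_. 1"] insert.hyps M by (simp add: mono_eval_def)
  with M insert.prems show ?case by auto
qed simp

lemma cpoly_eq_0I:
  fixes p :: "'v cpoly"
  assumes "\<And>x. cpoly_eval x p = 0"
  shows "p = 0"
proof (rule poly_mapping_eqI)
  fix m
  have "Poly_Mapping.lookup p m = 0" if "m \<in> Poly_Mapping.keys p"
    by (rule mono_eval_independent[of "Poly_Mapping.keys p"])
       (use that assms in \<open>auto simp: cpoly_eval_def mono_eval_def\<close>)
  then show "Poly_Mapping.lookup p m = Poly_Mapping.lookup 0 m"
    by (cases "m \<in> Poly_Mapping.keys p") (auto simp: in_keys_iff)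
qed

section \<open>The relations and the two localisations\<close>

text \<open>The relations are functions of a tuple in any integral domain, so that one identity
  serves the variables themselves, the traces of a pair and substituted tuples.\<close>

definition rel1 :: "(nat \<Rightarrow> 'r::idom) \<Rightarrow> 'r" where
  "rel1 a = a 3 * a 9 - 2 * a 4 * a 8 + a 5 * a 7"

definition rel2 :: "(nat \<Rightarrow> 'r::idom) \<Rightarrow> 'r" where
  "rel2 a = a 5 * a 6 - 2 * a 4 * a 7 + a 3 * a 8"

definition rel3 :: "(nat \<Rightarrow> 'r::idom) \<Rightarrow> 'r" where
  "rel3 a = 9 * a 3 - a 3 * a 4^2 + a 3^2 * a 5 + 6 * a 6 * a 8 - 6 * a 7^2"

definition rel4 :: "(nat \<Rightarrow> 'r::idom) \<Rightarrow> 'r" where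
  "rel4 a = 9 * a 4 - a 4^3 + a 3 * a 4 * a 5 + 3 * a 6 * a 9 - 3 * a 7 * a 8"

definition rel5 :: "(nat \<Rightarrow> 'r::idom) \<Rightarrow> 'r" where
  "rel5 a = 9 * a 5 - a 4^2 * a 5 + a 3 * a 5^2 + 6 * a 7 * a 9 - 6 * a 8^2"

lemmas rel_defs = rel1_def rel2_def rel3_def rel4_def rel5_def

text \<open>Up to a constant factor, \<open>gram_det\<close> is the Gram determinant of \<open>(w, wA, wB)\<close> against
  \<open>(v, Av, Bv)\<close>, where \<open>[A, B] + 1 = v w\<close>, and \<open>disc_poly\<close> is the discriminant of \<open>A\<close>.\<close>

definition gram_det :: "(nat \<Rightarrow> 'r::idom) \<Rightarrow> 'r" where
  "gram_det a = a 3 * a 5 - a 4^2 + 9"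

definition disc_poly :: "(nat \<Rightarrow> 'r::idom) \<Rightarrow> 'r" where
  "disc_poly a = 6 * a 6^2 - a 3^3"

text \<open>The action of the substitution \<open>A \<mapsto> A + t B\<close> on the traces.\<close>

definition shear :: "'r::idom \<Rightarrow> (nat \<Rightarrow> 'r) \<Rightarrow> nat \<Rightarrow> 'r" where
  "shear t a i =
     (if i = 1 then a 1 + t * a 2
      else if i = 3 then a 3 + 2 * t * a 4 + t^2 * a 5
      else if i = 4 then a 4 + t * a 5
      else if i = 6 then a 6 + 3 * t * a 7 + 3 * t^2 * a 8 + t^3 * a 9
      else if i = 7 then a 7 + 2 * t * a 8 + t^2 * a 9
      else if i = 8 then a 8 + t * a 9
      else a i)"

text \<open>Under linear substitutions in \<open>(A, B)\<close> the pair \<open>rel1\<close>,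
  \<open>rel2\<close> behaves like the coefficients of a linear form and \<open>rel3\<close>,
  \<open>rel4\<close>, \<open>rel5\<close> like those of a binary quadratic form. This makes the
  ideal of relations stable under shears.\<close>

lemma rel_shear:
  "rel1 (shear t a) = rel1 a"
  "rel2 (shear t a) = rel2 a + t * rel1 a"
  "rel3 (shear t a) = rel3 a + 2 * t * rel4 a + t^2 * rel5 a"
  "rel4 (shear t a) = rel4 a + t * rel5 a"
  "rel5 (shear t a) = rel5 a"
  unfolding rel_defs shear_def
  by (simp_all add: algebra_simps power2_eq_square power3_eq_cube)

lemma shear_shear_neg: "shear (- t) (shear t a) = a"
  by (rule ext) (auto simp: shear_def algebra_simps power2_eq_square power3_eq_cube)

text \<open>Coefficients of the sextic \<open>6 c^2 - q^3\<close> in \<open>t\<close>, with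
  \<open>q\<close> and \<open>c\<close> the traces of the square and the cube of
  \<open>A + t B\<close>; up to the factor -2 it is the discriminant of
  \<open>A + t B\<close>.\<close>

definition disc_coef :: "(nat \<Rightarrow> 'r::idom) \<Rightarrow> nat \<Rightarrow> 'r" where
  "disc_coef a j =
     [6 * a 6^2 - a 3^3,
      36 * a 6 * a 7 - 6 * a 3^2 * a 4,
      36 * a 6 * a 8 + 54 * a 7^2 - 3 * a 3^2 * a 5 - 12 * a 3 * a 4^2,
      12 * a 6 * a 9 + 108 * a 7 * a 8 - 12 * a 3 * a 4 * a 5 - 8 * a 4^3,
      36 * a 7 * a 9 + 54 * a 8^2 - 3 * a 3 * a 5^2 - 12 * a 4^2 * a 5,
      36 * a 8 * a 9 - 6 * a 4 * a 5^2,
      6 * a 9^2 - a 5^3] ! j"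

lemma disc_poly_shear:
  "disc_poly (shear t a) = disc_coef a 0 + disc_coef a 1 * t + disc_coef a 2 * t^2 + disc_coef a 3 * t^3
     + disc_coef a 4 * t^4 + disc_coef a 5 * t^5 + disc_coef a 6 * t^6"
  unfolding disc_poly_def disc_coef_def shear_def
  by (simp add: algebra_simps power2_eq_square power3_eq_cube eval_nat_numeral(2-3))

text \<open>Lagrange interpolation of a sextic at its seven nodes 0, 1, -1, 2, -2, 3, -3; the
  denominators divide 6! = 720. It recovers the coefficients from discriminants at integers
  \<open>t\<close>.\<close>

lemma disc_coef_interpolation:
  fixes a :: "nat \<Rightarrow> 'r::idom"
  defines "H \<equiv> \<lambda>t. disc_poly (shear t a)"
  shows
  "720 * disc_coef a 0 = 720 * H 0"
  "720 * disc_coef a 1 = 540 * H 1 - 540 * H (- 1) - 108 * H 2 + 108 * H (- 2) + 12 * H 3 - 12 * H (- 3)"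
  "720 * disc_coef a 2 = 540 * H 1 + 540 * H (- 1) - 54 * H 2 - 54 * H (- 2) + 4 * H 3 + 4 * H (- 3) - 980 * H 0"
  "720 * disc_coef a 3 = 195 * H (- 1) - 195 * H 1 + 120 * H 2 - 120 * H (- 2) - 15 * H 3 + 15 * H (- 3)"
  "720 * disc_coef a 4 = 280 * H 0 - 195 * H 1 - 195 * H (- 1) + 60 * H 2 + 60 * H (- 2) - 5 * H 3 - 5 * H (- 3)"
  "720 * disc_coef a 5 = 15 * H 1 - 15 * H (- 1) - 12 * H 2 + 12 * H (- 2) + 3 * H 3 - 3 * H (- 3)"
  "720 * disc_coef a 6 = 15 * H 1 + 15 * H (- 1) - 6 * H 2 - 6 * H (- 2) + H 3 + H (- 3) - 20 * H 0"
  unfolding H_def disc_poly_shear by simp_all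

text \<open>The pairing of the sextic \<open>q\<^sup>3\<close> with \<open>6 c\<^sup>2 - q\<^sup>3\<close> under the invariant form on binary
  sextics, where \<open>q = a\<^sub>3 + 2 a\<^sub>4 t + a\<^sub>5 t\<^sup>2\<close> and \<open>c = a\<^sub>6 + 3 a\<^sub>7 t + 3 a\<^sub>8 t\<^sup>2 + a\<^sub>9 t\<^sup>3\<close>. The
  relations say that \<open>q\<close> is apolar to \<open>c\<close> and proportional to the Hessian of \<open>c\<close>.\<close>

lemma unit_certificate:
  fixes a :: "nat \<Rightarrow> 'r::idom"
  shows "192 * (9 - gram_det a)^3 =
      60 * a 3^3 * disc_coef a 6 - 60 * a 3^2 * a 4 * disc_coef a 5
    + 4 * (3 * a 3^2 * a 5 + 12 * a 3 * a 4^2) * disc_coef a 4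
    - 3 * (12 * a 3 * a 4 * a 5 + 8 * a 4^3) * disc_coef a 3
    + 4 * (3 * a 3 * a 5^2 + 12 * a 4^2 * a 5) * disc_coef a 2
    - 60 * a 4 * a 5^2 * disc_coef a 1 + 60 * a 5^3 * disc_coef a 0
    - 48 * (9 - gram_det a) * (a 3 * (rel5 a - a 5 * gram_det a) - 2 * a 4 * (rel4 a - a 4 * gram_det a)
        + a 5 * (rel3 a - a 3 * gram_det a))
    - 360 * (a 3 * (rel1 a)^2 - 2 * a 4 * rel1 a * rel2 a + a 5 * (rel2 a)^2)"
  unfolding gram_det_def rel_defs disc_coef_def
  by (simp add: algebra_simps power2_eq_square power3_eq_cube)


subsection \<open>Ideals and radicals\<close>

text \<open>A carrier-free notion, applied to \<open>rel_ideal\<close>, to the ideals of multipliers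
  and their radicals, and to \<open>{0}\<close> in the complex numbers.\<close>

definition ring_ideal :: "'r::idom set \<Rightarrow> bool" where
  "ring_ideal J \<longleftrightarrow> 0 \<in> J \<and> (\<forall>x\<in>J. \<forall>y\<in>J. x + y \<in> J) \<and> (\<forall>r. \<forall>x\<in>J. r * x \<in> J)"

definition radical :: "'r::idom set \<Rightarrow> 'r set" where
  "radical J = {x. \<exists>n. x ^ n \<in> J}"

context
  fixes J :: "'r::idom set"
  assumes J: "ring_ideal J"
begin

lemma ring_ideal_0: "0 \<in> J"
  using J by (simp add: ring_ideal_def)

lemma ring_ideal_add: "x \<in> J \<Longrightarrow> y \<in> J \<Longrightarrow> x + y \<in> J"
  using J by (simp add: ring_ideal_def)

lemma ring_ideal_mult: "x \<in> J \<Longrightarrow> r * x \<in> J"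
  using J by (simp add: ring_ideal_def)

lemma ring_ideal_mult': "x \<in> J \<Longrightarrow> x * r \<in> J"
  using ring_ideal_mult[of x r] by (simp add: mult.commute)

lemma ring_ideal_uminus: "x \<in> J \<Longrightarrow> - x \<in> J"
  using ring_ideal_mult[of x "- 1"] by simp

lemma ring_ideal_diff: "x \<in> J \<Longrightarrow> y \<in> J \<Longrightarrow> x - y \<in> J"
  using ring_ideal_add[of x "- y"] ring_ideal_uminus[of y] by simp

lemma ring_ideal_sum: "(\<And>i. i \<in> S \<Longrightarrow> f i \<in> J) \<Longrightarrow> sum f S \<in> J"
  by (induction S rule: infinite_finite_induct) (simp_all add: ring_ideal_0 ring_ideal_add)

lemma ring_ideal_power: "x ^ m \<in> J \<Longrightarrow> m \<le> n \<Longrightarrow> x ^ n \<in> J"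
  using ring_ideal_mult[of "x ^ m" "x ^ (n - m)"] by (simp flip: power_add)

lemma radicalI: "x \<in> J \<Longrightarrow> x \<in> radical J"
  unfolding radical_def by (auto intro!: exI[of _ 1])

lemma ring_ideal_radical: "ring_ideal (radical J)"
  unfolding ring_ideal_def
proof (intro conjI ballI allI)
  show "0 \<in> radical J" by (rule radicalI) (rule ring_ideal_0)
next
  fix x y assume "x \<in> radical J" "y \<in> radical J"
  then obtain m n where mn: "x ^ m \<in> J" "y ^ n \<in> J" by (auto simp: radical_def)
  have "(x + y) ^ (m + n) \<in> J"
    unfolding binomial_ring
  proof (rule ring_ideal_sum)
    fix k assume "k \<in> {..m + n}"
    show "of_nat (m + n choose k) * x ^ k * y ^ (m + n - k) \<in> J"
    proof (cases "m \<le> k")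
      case True
      then show ?thesis
        using mn(1) by (intro ring_ideal_mult' ring_ideal_mult) (rule ring_ideal_power)
    next
      case False
      then show ?thesis
        using mn(2) by (intro ring_ideal_mult) (rule ring_ideal_power, auto)
    qed
  qed
  then show "x + y \<in> radical J" by (auto simp: radical_def)
next
  fix r x assume "x \<in> radical J"
  then obtain m where "x ^ m \<in> J" by (auto simp: radical_def)
  then have "(r * x) ^ m \<in> J" by (simp add: power_mult_distrib ring_ideal_mult)
  then show "r * x \<in> radical J" by (auto simp: radical_def)
qed

end

lemmas ring_ideal_intros =
  ring_ideal_0 ring_ideal_add ring_ideal_mult ring_ideal_mult' ring_ideal_uminus ring_ideal_diff

text \<open>Modulo \<open>J\<close> every term on the right of \<open>unit_certificate\<close>
  vanishes, while the left becomes \<open>192 * 9^3\<close>. The assumption \<open>inv\<close> says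
  that positive integers are units; it removes 720 and this last constant.\<close>

lemma ring_ideal_one:
  fixes a :: "nat \<Rightarrow> 'r::idom"
  assumes J: "ring_ideal J"
    and inv: "\<And>n. n > 0 \<Longrightarrow> \<exists>r :: 'r. r * of_nat n = 1"
    and rel: "rel1 a \<in> J" "rel2 a \<in> J" "rel3 a \<in> J" "rel4 a \<in> J" "rel5 a \<in> J"
    and g: "gram_det a \<in> J" and h: "\<And>t :: int. disc_poly (shear (of_int t) a) \<in> J"
  shows "1 \<in> J"
proof -
  have div: "x \<in> J" if "of_nat n * x \<in> J" "n > 0" for x n
  proof -
    obtain r :: 'r where r: "r * of_nat n = 1" using inv \<open>n > 0\<close> by blast
    have "r * (of_nat n * x) = x" using r by (simp flip: mult.assoc)
    with ring_ideal_mult[OF J that(1), of r] show ?thesis by simp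
  qed
  have h': "disc_poly (shear 0 a) \<in> J" "disc_poly (shear 1 a) \<in> J" "disc_poly (shear (- 1) a) \<in> J"
    "disc_poly (shear 2 a) \<in> J" "disc_poly (shear (- 2) a) \<in> J" "disc_poly (shear 3 a) \<in> J" "disc_poly (shear (- 3) a) \<in> J"
    using h[of 0] h[of 1] h[of "- 1"] h[of 2] h[of "- 2"] h[of 3] h[of "- 3"] by simp_all
  have "720 * disc_coef a 0 \<in> J" "720 * disc_coef a 1 \<in> J" "720 * disc_coef a 2 \<in> J" "720 * disc_coef a 3 \<in> J"
    "720 * disc_coef a 4 \<in> J" "720 * disc_coef a 5 \<in> J" "720 * disc_coef a 6 \<in> J"
    unfolding disc_coef_interpolation
    by (intro ring_ideal_add[OF J] ring_ideal_diff[OF J] ring_ideal_mult[OF J] h')+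
  then have hc720: "of_nat 720 * disc_coef a j \<in> J" if "j \<in> {0,1,2,3,4,5,6}" for j
    using that by auto
  have hc: "disc_coef a j \<in> J" if "j \<in> {0,1,2,3,4,5,6}" for j
    by (rule div[OF hc720[OF that]]) simp
  have "192 * (9 - gram_det a)^3 \<in> J"
    unfolding unit_certificate power2_eq_square
    by (intro ring_ideal_add[OF J] ring_ideal_diff[OF J] ring_ideal_mult[OF J] hc rel g insertCI refl disjI1 disjI2) simp_all
  \<comment> \<open>The cube is expanded about \<open>gram_det a = 0\<close>; the constant term is
    192 * 729 = 139968.\<close>
  moreover have "192 * (9 - gram_det a)^3 = 139968 + 192 * (27 * gram_det a - 243 - (gram_det a)^2) * gram_det a"
    by (simp add: algebra_simps power2_eq_square power3_eq_cube)
  moreover have "192 * (27 * gram_det a - 243 - (gram_det a)^2) * gram_det a \<in> J"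
    by (rule ring_ideal_mult[OF J g])
  ultimately have "139968 \<in> J"
    using ring_ideal_diff[OF J] by (metis add_diff_cancel_right')
  then show ?thesis
    using div[of 139968 1] by simp
qed

subsection \<open>The ideal of relations\<close>

text \<open>Cofactors may involve every variable with a natural index, so no bookkeeping of
  variables is needed until \<open>genideal_CM_relations\<close> cuts the ideal down to a given set
  of variables.\<close>

definition rel_ideal :: "nat cpoly set" where
  "rel_ideal = {p. \<exists>c1 c2 c3 c4 c5. p = c1 * rel1 cvar + c2 * rel2 cvar + c3 * rel3 cvar
     + c4 * rel4 cvar + c5 * rel5 cvar}"

lemma rel_idealI:
  "c1 * rel1 cvar + c2 * rel2 cvar + c3 * rel3 cvar + c4 * rel4 cvar + c5 * rel5 cvar \<in> rel_ideal"
  unfolding rel_ideal_def by blast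

lemma ring_ideal_rel_ideal: "ring_ideal rel_ideal"
  unfolding ring_ideal_def
proof (intro conjI ballI allI)
  show "0 \<in> rel_ideal" using rel_idealI[of 0 0 0 0 0] by simp
next
  fix x y assume "x \<in> rel_ideal" "y \<in> rel_ideal"
  then obtain c1 c2 c3 c4 c5 d1 d2 d3 d4 d5 where
    xy: "x = c1 * rel1 cvar + c2 * rel2 cvar + c3 * rel3 cvar + c4 * rel4 cvar + c5 * rel5 cvar"
    "y = d1 * rel1 cvar + d2 * rel2 cvar + d3 * rel3 cvar + d4 * rel4 cvar + d5 * rel5 cvar"
    unfolding rel_ideal_def by blast
  show "x + y \<in> rel_ideal"
    using rel_idealI[of "c1 + d1" "c2 + d2" "c3 + d3" "c4 + d4" "c5 + d5"]
    unfolding xy by (simp add: algebra_simps)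
next
  fix r x assume "x \<in> rel_ideal"
  then obtain c1 c2 c3 c4 c5 where
    x: "x = c1 * rel1 cvar + c2 * rel2 cvar + c3 * rel3 cvar + c4 * rel4 cvar + c5 * rel5 cvar"
    unfolding rel_ideal_def by blast
  show "r * x \<in> rel_ideal"
    using rel_idealI[of "r * c1" "r * c2" "r * c3" "r * c4" "r * c5"]
    unfolding x by (simp add: distrib_left mult.assoc)
qed

lemmas rel_ideal_intros = ring_ideal_intros[OF ring_ideal_rel_ideal]

lemmas rel_ideal_linear =
  ring_ideal_add[OF ring_ideal_rel_ideal] ring_ideal_mult[OF ring_ideal_rel_ideal]

lemma rel_in_rel_ideal:
  "rel1 cvar \<in> rel_ideal" "rel2 cvar \<in> rel_ideal" "rel3 cvar \<in> rel_ideal"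
  "rel4 cvar \<in> rel_ideal" "rel5 cvar \<in> rel_ideal"
  using rel_idealI[of 1 0 0 0 0] rel_idealI[of 0 1 0 0 0] rel_idealI[of 0 0 1 0 0]
    rel_idealI[of 0 0 0 1 0] rel_idealI[of 0 0 0 0 1] by simp_all

lemma cpoly_eval_rel:
  "cpoly_eval x (rel1 a) = rel1 (\<lambda>i. cpoly_eval x (a i))"
  "cpoly_eval x (rel2 a) = rel2 (\<lambda>i. cpoly_eval x (a i))"
  "cpoly_eval x (rel3 a) = rel3 (\<lambda>i. cpoly_eval x (a i))"
  "cpoly_eval x (rel4 a) = rel4 (\<lambda>i. cpoly_eval x (a i))"
  "cpoly_eval x (rel5 a) = rel5 (\<lambda>i. cpoly_eval x (a i))"
  "cpoly_eval x (gram_det a) = gram_det (\<lambda>i. cpoly_eval x (a i))"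
  "cpoly_eval x (disc_poly a) = disc_poly (\<lambda>i. cpoly_eval x (a i))"
  by (simp_all add: rel_defs gram_det_def disc_poly_def)

lemma psubst_rel:
  "psubst s (rel1 a) = rel1 (\<lambda>i. psubst s (a i))"
  "psubst s (rel2 a) = rel2 (\<lambda>i. psubst s (a i))"
  "psubst s (rel3 a) = rel3 (\<lambda>i. psubst s (a i))"
  "psubst s (rel4 a) = rel4 (\<lambda>i. psubst s (a i))"
  "psubst s (rel5 a) = rel5 (\<lambda>i. psubst s (a i))"
  "psubst s (gram_det a) = gram_det (\<lambda>i. psubst s (a i))"
  "psubst s (disc_poly a) = disc_poly (\<lambda>i. psubst s (a i))"
  by (simp_all add: rel_defs gram_det_def disc_poly_def)

definition satisfies_relations :: "(nat \<Rightarrow> complex) \<Rightarrow> bool" where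
  "satisfies_relations x \<longleftrightarrow> rel1 x = 0 \<and> rel2 x = 0 \<and> rel3 x = 0 \<and> rel4 x = 0 \<and> rel5 x = 0"

lemma cpoly_eval_rel_ideal:
  assumes "p \<in> rel_ideal" "satisfies_relations x"
  shows "cpoly_eval x p = 0"
  using assms by (auto simp: rel_ideal_def satisfies_relations_def cpoly_eval_rel)

lemma psubst_rel_ideal:
  assumes "p \<in> rel_ideal" "rel1 s \<in> rel_ideal" "rel2 s \<in> rel_ideal" "rel3 s \<in> rel_ideal"
    "rel4 s \<in> rel_ideal" "rel5 s \<in> rel_ideal"
  shows "psubst s p \<in> rel_ideal"
proof -
  obtain c1 c2 c3 c4 c5 where
    p: "p = c1 * rel1 cvar + c2 * rel2 cvar + c3 * rel3 cvar + c4 * rel4 cvar + c5 * rel5 cvar"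
    using assms(1) unfolding rel_ideal_def by blast
  show ?thesis
    unfolding p by (simp add: psubst_rel) (intro rel_ideal_intros assms(2-))
qed

lemma psubst_shear_rel_ideal:
  assumes "p \<in> rel_ideal"
  shows "psubst (shear t cvar) p \<in> rel_ideal"
  by (rule psubst_rel_ideal[OF assms]; unfold rel_shear; intro rel_ideal_linear rel_in_rel_ideal)

lemma psubst_shear:
  "psubst s (shear (cconst t) a i) = shear (cconst t) (\<lambda>i. psubst s (a i)) i"
  by (simp add: shear_def)

lemma cpoly_eval_shear:
  "cpoly_eval x (shear (cconst t) a i) = shear t (\<lambda>i. cpoly_eval x (a i)) i"
  by (simp add: shear_def)


subsection \<open>The chart where the Gram determinant is invertible\<close>

text \<open>The traces of \<open>A = (0, \<alpha>, \<beta>+1; 1, p, q; 0, r, -p)\<close> and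
  \<open>B = (0, \<beta>-1, \<gamma>; 0, q, u; 1, -p, -q)\<close>, where \<open>\<alpha> = 2 (p\<^sup>2 + q r)\<close>, \<open>\<beta> = p q + u r\<close>,
  \<open>\<gamma> = 2 (q\<^sup>2 - p u)\<close>, in the coordinates \<open>p = y 3\<close>, \<open>q = y 4\<close>, \<open>r = y 5\<close>, \<open>u = y 6\<close>. These
  are the matrices of \<open>A\<close> and \<open>B\<close> in the basis \<open>(v, Av, Bv)\<close>.\<close>

text \<open>\<open>gram_chart_hom\<close> is made homogeneous by means of the Gram determinant \<open>y 7\<close>.\<close>

definition gram_chart_hom :: "(nat \<Rightarrow> 'r::idom) \<Rightarrow> nat \<Rightarrow> 'r" where
  "gram_chart_hom y i =
    (let p = y 3; q = y 4; r = y 5; u = y 6; d = y 7;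
         a3 = 6 * (p^2 + q * r); a4 = 3 * (p * q + u * r); a5 = 6 * (q^2 - p * u)
     in if i = 3 then a3 else if i = 4 then a4 else if i = 5 then a5
        else if i = 6 then a3 * p + (a4 + 3 * d^2) * r
        else if i = 7 then a3 * q - (a4 + 3 * d^2) * p
        else if i = 8 then a3 * u - (a4 + 3 * d^2) * q
        else if i = 9 then (a4 - 3 * d^2) * u - a5 * q
        else y i)"

definition gram_chart :: "(nat \<Rightarrow> 'r::idom) \<Rightarrow> nat \<Rightarrow> 'r" where
  "gram_chart y = gram_chart_hom (y(7 := 1))"

text \<open>The degree of \<open>gram_chart_hom y i\<close> in \<open>p\<close>, \<open>q\<close>,
  \<open>r\<close>, \<open>u\<close>, \<open>d\<close> jointly.\<close>

definition gram_chart_degree :: "nat \<Rightarrow> nat" where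
  "gram_chart_degree i = (if i \<in> {3, 4, 5} then 2 else if i \<in> {6..9} then 3 else 0)"

text \<open>Cramer's rule: these are the numerators over \<open>gram_det a\<close> of four entries
  of \<open>A\<close> and \<open>B\<close> in the frame \<open>(v, Av, Bv)\<close>, obtained by
  solving the Gram system with the cubic traces as right-hand sides. The entries \<open>-p\<close>
  and \<open>-q\<close> need no numerators of their own, since \<open>rel2\<close> and
  \<open>rel1\<close> say that \<open>A\<close> and \<open>B\<close> have trace 0 in this
  frame.\<close>

definition gram_coord :: "(nat \<Rightarrow> 'r::idom) \<Rightarrow> nat \<Rightarrow> 'r" where
  "gram_coord a i =
     (if i = 3 then a 5 * a 6 - (a 4 + 3) * a 7
      else if i = 4 then a 5 * a 7 - (a 4 + 3) * a 8
      else if i = 5 then a 3 * a 7 - (a 4 - 3) * a 6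
      else if i = 6 then a 5 * a 8 - (a 4 + 3) * a 9
      else if i = 7 then gram_det a
      else a i)"

text \<open>Modulo the relations the chart is inverted by \<open>gram_coord\<close>. The quadratic
  traces are recovered from \<open>rel3\<close>, \<open>rel4\<close>, \<open>rel5\<close>; the cubic
  ones are rows of the Gram system solved by Cramer's rule, with \<open>rel1\<close> and
  \<open>rel2\<close> replacing an entry by its negative partner.\<close>

lemma gram_identities:
  fixes a :: "nat \<Rightarrow> 'r::idom"
  defines "d \<equiv> gram_det a" and "p \<equiv> gram_coord a 3" and "q \<equiv> gram_coord a 4"
    and "r \<equiv> gram_coord a 5" and "u \<equiv> gram_coord a 6"
  shows "d^2 * a 3 = 6 * (p^2 + q * r) + (d * rel3 a - 6 * p * rel2 a)"
    and "d^2 * a 4 = 3 * (p * q + u * r) + (d * rel4 a - 3 * p * rel1 a)"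
    and "d^2 * a 5 = 6 * (q^2 - p * u) + (d * rel5 a - 6 * q * rel1 a + 6 * u * rel2 a)"
    and "d * a 6 = a 3 * p + (a 4 + 3) * r"
    and "d * a 7 = a 3 * q - (a 4 + 3) * p + (a 4 + 3) * rel2 a"
    and "d * a 8 = a 3 * u - (a 4 + 3) * q + (a 4 + 3) * rel1 a"
    and "d * a 9 = (a 4 - 3) * u - a 5 * q + a 5 * rel1 a"
  unfolding d_def p_def q_def r_def u_def gram_det_def gram_coord_def rel_defs
  by (simp_all add: algebra_simps power2_eq_square power3_eq_cube)

text \<open>The cubic cases follow by multiplying the linear identities for \<open>d * a i\<close>
  by \<open>d^2\<close> and inserting the quadratic ones. The ideal is arbitrary because the fact is
  used both for \<open>rel_ideal\<close> and, at a point satisfying the relations, for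
  \<open>{0}\<close>.\<close>

lemma gram_chart_hom_gram_coord:
  fixes a :: "nat \<Rightarrow> 'r::idom"
  assumes J: "ring_ideal J" and rel: "rel1 a \<in> J" "rel2 a \<in> J" "rel3 a \<in> J" "rel4 a \<in> J" "rel5 a \<in> J"
  shows "gram_det a ^ gram_chart_degree i * a i - gram_chart_hom (gram_coord a) i \<in> J"
proof -
  note intros = ring_ideal_add[OF J] ring_ideal_diff[OF J] ring_ideal_mult[OF J] rel
  define d where "d = gram_det a"
  define p where "p = gram_coord a 3"
  define q where "q = gram_coord a 4"
  define r where "r = gram_coord a 5"
  define u where "u = gram_coord a 6"
  note ids = gram_identities[of a, folded d_def p_def q_def r_def u_def]
  define e3 where "e3 = d * rel3 a - 6 * p * rel2 a"
  define e4 where "e4 = d * rel4 a - 3 * p * rel1 a"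
  define e5 where "e5 = d * rel5 a - 6 * q * rel1 a + 6 * u * rel2 a"
  have e: "e3 \<in> J" "e4 \<in> J" "e5 \<in> J"
    unfolding e3_def e4_def e5_def by (intro intros)+
  define b3 where "b3 = 6 * (p^2 + q * r)"
  define b4 where "b4 = 3 * (p * q + u * r)"
  define b5 where "b5 = 6 * (q^2 - p * u)"
  note ids = ids[folded e3_def e4_def e5_def b3_def b4_def b5_def]
  have cub: "d^3 * x = d^2 * (d * x)" for x by (simp add: power2_eq_square power3_eq_cube)
  have "d^3 * a 6 - (b3 * p + (b4 + 3 * d^2) * r) = p * e3 + r * e4"
    "d^3 * a 7 - (b3 * q - (b4 + 3 * d^2) * p) = q * e3 - p * e4 + d^2 * (a 4 + 3) * rel2 a"
    "d^3 * a 8 - (b3 * u - (b4 + 3 * d^2) * q) = u * e3 - q * e4 + d^2 * (a 4 + 3) * rel1 a"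
    "d^3 * a 9 - ((b4 - 3 * d^2) * u - b5 * q) = u * e4 - q * e5 + d^2 * a 5 * rel1 a"
  proof -
    have "d^3 * a 6 = (d^2 * a 3) * p + (d^2 * a 4 + 3 * d^2) * r"
      "d^3 * a 7 = (d^2 * a 3) * q - (d^2 * a 4 + 3 * d^2) * p + d^2 * (a 4 + 3) * rel2 a"
      "d^3 * a 8 = (d^2 * a 3) * u - (d^2 * a 4 + 3 * d^2) * q + d^2 * (a 4 + 3) * rel1 a"
      "d^3 * a 9 = (d^2 * a 4 - 3 * d^2) * u - (d^2 * a 5) * q + d^2 * a 5 * rel1 a"
      unfolding cub ids(4-7) by (simp_all add: algebra_simps)
    then show "d^3 * a 6 - (b3 * p + (b4 + 3 * d^2) * r) = p * e3 + r * e4"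
      "d^3 * a 7 - (b3 * q - (b4 + 3 * d^2) * p) = q * e3 - p * e4 + d^2 * (a 4 + 3) * rel2 a"
      "d^3 * a 8 - (b3 * u - (b4 + 3 * d^2) * q) = u * e3 - q * e4 + d^2 * (a 4 + 3) * rel1 a"
      "d^3 * a 9 - ((b4 - 3 * d^2) * u - b5 * q) = u * e4 - q * e5 + d^2 * a 5 * rel1 a"
      unfolding ids(1-3) by (simp_all add: algebra_simps)
  qed
  then have cub_J: "d^3 * a 6 - (b3 * p + (b4 + 3 * d^2) * r) \<in> J"
    "d^3 * a 7 - (b3 * q - (b4 + 3 * d^2) * p) \<in> J"
    "d^3 * a 8 - (b3 * u - (b4 + 3 * d^2) * q) \<in> J"
    "d^3 * a 9 - ((b4 - 3 * d^2) * u - b5 * q) \<in> J"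
    by (simp_all only:) (intro intros e)+
  have sq_J: "d^2 * a 3 - b3 \<in> J" "d^2 * a 4 - b4 \<in> J" "d^2 * a 5 - b5 \<in> J"
    using e ids(1-3) by simp_all
  have d: "gram_coord a 7 = d" and other: "\<And>i. i \<notin> {3..9} \<Longrightarrow> gram_coord a i = a i"
    by (auto simp: gram_coord_def d_def)
  have hom: "gram_chart_hom (gram_coord a) 3 = b3" "gram_chart_hom (gram_coord a) 4 = b4"
    "gram_chart_hom (gram_coord a) 5 = b5"
    "gram_chart_hom (gram_coord a) 6 = b3 * p + (b4 + 3 * d^2) * r"
    "gram_chart_hom (gram_coord a) 7 = b3 * q - (b4 + 3 * d^2) * p"
    "gram_chart_hom (gram_coord a) 8 = b3 * u - (b4 + 3 * d^2) * q"
    "gram_chart_hom (gram_coord a) 9 = (b4 - 3 * d^2) * u - b5 * q"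
    unfolding gram_chart_hom_def Let_def b3_def b4_def b5_def p_def q_def r_def u_def d by simp_all
  have hom': "gram_chart_hom (gram_coord a) i = a i" if "i \<notin> {3..9}"
    using that other[OF that] by (auto simp: gram_chart_hom_def)
  have deg: "gram_chart_degree 3 = 2" "gram_chart_degree 4 = 2" "gram_chart_degree 5 = 2"
    "gram_chart_degree 6 = 3" "gram_chart_degree 7 = 3" "gram_chart_degree 8 = 3" "gram_chart_degree 9 = 3"
    by (simp_all add: gram_chart_degree_def)
  have deg': "gram_chart_degree i = 0" if "i \<notin> {3..9}"
    using that by (auto simp: gram_chart_degree_def)
  consider "i = 3" | "i = 4" | "i = 5" | "i = 6" | "i = 7" | "i = 8" | "i = 9" | "i \<notin> {3..9}"
    by fastforce
  then show ?thesis
    unfolding d_def[symmetric]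
    by cases (use cub_J sq_J hom hom' deg deg' in \<open>simp_all add: ring_ideal_0[OF J]\<close>)
qed

text \<open>Homogeneous coordinates of the chart point \<open>y\<close>, with
  \<open>\<delta>\<close> as the homogenising coordinate in slot 7.\<close>

definition gram_scale :: "(nat \<Rightarrow> complex) \<Rightarrow> complex \<Rightarrow> nat \<Rightarrow> complex" where
  "gram_scale y \<delta> i = (if i \<in> {3..6} then \<delta> * y i else if i = 7 then \<delta> else y i)"

lemma gram_scale_7 [simp]: "gram_scale y \<delta> 7 = \<delta>"
  by (simp add: gram_scale_def)

lemma gram_chart_hom_scale:
  "gram_chart_hom (gram_scale y \<delta>) i = \<delta> ^ gram_chart_degree i * gram_chart y i"
proof -
  consider "i = 3" | "i = 4" | "i = 5" | "i = 6" | "i = 7" | "i = 8" | "i = 9" | "i \<notin> {3..9}"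
    by fastforce
  then show ?thesis
    by cases (auto simp: gram_chart_hom_def gram_chart_def gram_scale_def gram_chart_degree_def
        Let_def algebra_simps power2_eq_square power3_eq_cube)
qed

lemma psubst_gram_chart_hom:
  "psubst s (gram_chart_hom a i) = gram_chart_hom (\<lambda>i. psubst s (a i)) i"
  by (simp add: gram_chart_hom_def Let_def)

lemma cpoly_eval_gram_chart_hom:
  "cpoly_eval x (gram_chart_hom a i) = gram_chart_hom (\<lambda>i. cpoly_eval x (a i)) i"
  by (simp add: gram_chart_hom_def Let_def)

text \<open>The polynomial \<open>g\<close> is the homogenisation of \<open>p\<close> composed with
  the chart. Both properties are carried through one induction because they must hold for the same
  \<open>g\<close>: the first ties it to \<open>p\<close> modulo the relations, the second to the
  values of \<open>p\<close> on the chart.\<close>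

lemma gram_chart_clearing:
  "\<exists>N g. gram_det cvar ^ N * p - psubst (gram_coord cvar) g \<in> rel_ideal \<and>
     (\<forall>y \<delta>. cpoly_eval (gram_scale y \<delta>) g = \<delta> ^ N * cpoly_eval (gram_chart y) p)"
  (is "?Good p")
proof (induction p rule: cpoly_induct[OF subset_UNIV])
  case (1 c)
  have "?Good (cconst c)"
    by (rule exI[of _ 0], rule exI[of _ "cconst c"]) (simp add: rel_ideal_intros)
  then show ?case .
next
  case (2 i)
  show ?case
  proof (intro exI conjI allI)
    show "gram_det cvar ^ gram_chart_degree i * cvar i
        - psubst (gram_coord cvar) (gram_chart_hom cvar i) \<in> rel_ideal"
      using gram_chart_hom_gram_coord[OF ring_ideal_rel_ideal rel_in_rel_ideal, of i]
      by (simp add: psubst_gram_chart_hom)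
  qed (simp add: cpoly_eval_gram_chart_hom gram_chart_hom_scale)
next
  case (3 p q)
  then obtain M f N g where
    f: "gram_det cvar ^ M * p - psubst (gram_coord cvar) f \<in> rel_ideal"
      "\<And>y \<delta>. cpoly_eval (gram_scale y \<delta>) f = \<delta> ^ M * cpoly_eval (gram_chart y) p" and
    g: "gram_det cvar ^ N * q - psubst (gram_coord cvar) g \<in> rel_ideal"
      "\<And>y \<delta>. cpoly_eval (gram_scale y \<delta>) g = \<delta> ^ N * cpoly_eval (gram_chart y) q"
    by blast
  show ?case
  proof (intro exI conjI allI)
    \<comment> \<open>The variable \<open>cvar 7\<close> goes to the Gram determinant under
      \<open>gram_coord\<close> and to \<open>\<delta>\<close> under \<open>gram_scale\<close>, so
      its powers bring both summands to the common degree \<open>M + N\<close>.\<close>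
    have "gram_det cvar ^ (M + N) * (p + q)
        - psubst (gram_coord cvar) (cvar 7 ^ N * f + cvar 7 ^ M * g)
      = gram_det cvar ^ N * (gram_det cvar ^ M * p - psubst (gram_coord cvar) f)
      + gram_det cvar ^ M * (gram_det cvar ^ N * q - psubst (gram_coord cvar) g)"
      by (simp add: gram_coord_def algebra_simps power_add)
    also have "\<dots> \<in> rel_ideal"
      by (intro rel_ideal_linear f g)
    finally show "gram_det cvar ^ (M + N) * (p + q)
        - psubst (gram_coord cvar) (cvar 7 ^ N * f + cvar 7 ^ M * g) \<in> rel_ideal" .
  qed (simp add: f g algebra_simps power_add)
next
  case (4 p q)
  then obtain M f N g where
    f: "gram_det cvar ^ M * p - psubst (gram_coord cvar) f \<in> rel_ideal"
      "\<And>y \<delta>. cpoly_eval (gram_scale y \<delta>) f = \<delta> ^ M * cpoly_eval (gram_chart y) p" and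
    g: "gram_det cvar ^ N * q - psubst (gram_coord cvar) g \<in> rel_ideal"
      "\<And>y \<delta>. cpoly_eval (gram_scale y \<delta>) g = \<delta> ^ N * cpoly_eval (gram_chart y) q"
    by blast
  show ?case
  proof (intro exI conjI allI)
    have "gram_det cvar ^ (M + N) * (p * q) - psubst (gram_coord cvar) (f * g)
      = (gram_det cvar ^ N * q) * (gram_det cvar ^ M * p - psubst (gram_coord cvar) f)
      + psubst (gram_coord cvar) f * (gram_det cvar ^ N * q - psubst (gram_coord cvar) g)"
      by (simp add: algebra_simps power_add)
    also have "\<dots> \<in> rel_ideal"
      by (intro rel_ideal_linear f g)
    finally show "gram_det cvar ^ (M + N) * (p * q) - psubst (gram_coord cvar) (f * g) \<in> rel_ideal" .
  qed (simp add: f g algebra_simps power_add)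
qed

lemma gram_det_power_in_rel_ideal:
  assumes "\<And>y. cpoly_eval (gram_chart y) p = 0"
  shows "\<exists>N. gram_det cvar ^ N * p \<in> rel_ideal"
proof -
  obtain N g where g: "gram_det cvar ^ N * p - psubst (gram_coord cvar) g \<in> rel_ideal"
    "\<And>y \<delta>. cpoly_eval (gram_scale y \<delta>) g = \<delta> ^ N * cpoly_eval (gram_chart y) p"
    using gram_chart_clearing[of p] by blast
  \<comment> \<open>Every point with \<open>x 7\<close> nonzero is a scaled chart point. The factor
    \<open>cvar 7\<close> takes care of the remaining hyperplane and costs one more power of the
    Gram determinant.\<close>
  have "cvar 7 * g = 0"
  proof (rule cpoly_eq_0I)
    fix x :: "nat \<Rightarrow> complex"
    show "cpoly_eval x (cvar 7 * g) = 0"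
    proof (cases "x 7 = 0")
      case False
      define y where "y i = (if i \<in> {3..6} then x i / x 7 else x i)" for i
      have "gram_scale y (x 7) = x"
        using False by (auto simp: gram_scale_def y_def)
      then show ?thesis
        using g(2)[of y "x 7"] assms by simp
    qed simp
  qed
  then have "psubst (gram_coord cvar) (cvar 7 * g) = 0" by (simp only: psubst_simps(4))
  then have "gram_det cvar * psubst (gram_coord cvar) g = 0" by (simp add: gram_coord_def)
  then have "gram_det cvar ^ Suc N * p
      = gram_det cvar * (gram_det cvar ^ N * p - psubst (gram_coord cvar) g)"
    by (simp add: algebra_simps)
  also have "\<dots> \<in> rel_ideal"
    by (intro ring_ideal_mult[OF ring_ideal_rel_ideal] g)
  finally show ?thesis by blast
qed


subsection \<open>The chart where the discriminant of \<open>A\<close> is invertible\<close>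

text \<open>\<open>rel2\<close> and \<open>rel3\<close> are linear in \<open>a 5\<close> and
  \<open>a 8\<close> with determinant \<open>disc_poly a\<close>; eliminating gives the first two.
  The third combines \<open>rel4\<close> and \<open>rel1\<close> so that \<open>a 9\<close> gets the
  same coefficient.\<close>

lemma disc_identities:
  fixes a :: "nat \<Rightarrow> 'r::idom"
  shows "disc_poly a * a 5 - (12 * a 4 * a 6 * a 7 + 9 * a 3^2 - a 3^2 * a 4^2 - 6 * a 3 * a 7^2)
      = 6 * a 6 * rel2 a - a 3 * rel3 a"
    and "disc_poly a * a 8 - (a 3 * a 4^2 * a 6 - 9 * a 3 * a 6 + 6 * a 6 * a 7^2 - 2 * a 3^2 * a 4 * a 7)
      = a 6 * rel3 a - a 3^2 * rel2 a"
    and "disc_poly a * a 9 - (2 * a 4^3 * a 6 - 18 * a 4 * a 6 - 2 * a 3 * a 4 * a 5 * a 6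
        + 6 * a 6 * a 7 * a 8 - 2 * a 3^2 * a 4 * a 8 + a 3^2 * a 5 * a 7)
      = 2 * a 6 * rel4 a - a 3^2 * rel1 a"
  by (simp_all add: disc_poly_def rel_defs algebra_simps power2_eq_square power3_eq_cube)

definition disc_clearable :: "nat cpoly \<Rightarrow> bool" where
  "disc_clearable p \<longleftrightarrow>
     (\<exists>N g. cpoly_vars g \<subseteq> - {5, 8, 9} \<and> disc_poly cvar ^ N * p - g \<in> rel_ideal)"

lemma cpoly_vars_disc_poly: "cpoly_vars (disc_poly cvar :: nat cpoly) \<subseteq> - {5, 8, 9}"
  unfolding disc_poly_def by (intro cpoly_vars_intros) auto

lemma disc_clearableI: "cpoly_vars p \<subseteq> - {5, 8, 9} \<Longrightarrow> disc_clearable p"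
  unfolding disc_clearable_def
  by (rule exI[of _ 0], rule exI[of _ p]) (simp add: rel_ideal_intros)

lemma disc_clearable_add:
  assumes "disc_clearable p" "disc_clearable q"
  shows "disc_clearable (p + q)"
proof -
  obtain M f N g where f: "cpoly_vars f \<subseteq> - {5, 8, 9}" "disc_poly cvar ^ M * p - f \<in> rel_ideal"
    and g: "cpoly_vars g \<subseteq> - {5, 8, 9}" "disc_poly cvar ^ N * q - g \<in> rel_ideal"
    using assms unfolding disc_clearable_def by blast
  have "disc_poly cvar ^ (M + N) * (p + q) - (disc_poly cvar ^ N * f + disc_poly cvar ^ M * g)
      = disc_poly cvar ^ N * (disc_poly cvar ^ M * p - f)
      + disc_poly cvar ^ M * (disc_poly cvar ^ N * q - g)"
    by (simp add: algebra_simps power_add)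
  also have "\<dots> \<in> rel_ideal"
    by (intro rel_ideal_linear f g)
  finally have "disc_poly cvar ^ (M + N) * (p + q)
      - (disc_poly cvar ^ N * f + disc_poly cvar ^ M * g) \<in> rel_ideal" .
  moreover have "cpoly_vars (disc_poly cvar ^ N * f + disc_poly cvar ^ M * g) \<subseteq> - {5, 8, 9}"
    by (intro cpoly_vars_intros f g cpoly_vars_disc_poly)
  ultimately show ?thesis
    unfolding disc_clearable_def by blast
qed

lemma disc_clearable_mult:
  assumes "disc_clearable p" "disc_clearable q"
  shows "disc_clearable (p * q)"
proof -
  obtain M f N g where f: "cpoly_vars f \<subseteq> - {5, 8, 9}" "disc_poly cvar ^ M * p - f \<in> rel_ideal"
    and g: "cpoly_vars g \<subseteq> - {5, 8, 9}" "disc_poly cvar ^ N * q - g \<in> rel_ideal"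
    using assms unfolding disc_clearable_def by blast
  have "disc_poly cvar ^ (M + N) * (p * q) - f * g
      = (disc_poly cvar ^ N * q) * (disc_poly cvar ^ M * p - f) + f * (disc_poly cvar ^ N * q - g)"
    by (simp add: algebra_simps power_add)
  also have "\<dots> \<in> rel_ideal"
    by (intro rel_ideal_linear f g)
  finally show ?thesis
    unfolding disc_clearable_def
    by (intro exI conjI) (rule cpoly_vars_mult[OF f(1) g(1)])
qed

lemma disc_clearable_divide:
  assumes "disc_clearable q" "disc_poly cvar * p - q \<in> rel_ideal"
  shows "disc_clearable p"
proof -
  obtain N g where g: "cpoly_vars g \<subseteq> - {5, 8, 9}" "disc_poly cvar ^ N * q - g \<in> rel_ideal"
    using assms unfolding disc_clearable_def by blast
  have "disc_poly cvar ^ Suc N * p - g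
      = disc_poly cvar ^ N * (disc_poly cvar * p - q) + (disc_poly cvar ^ N * q - g)"
    by (simp add: algebra_simps)
  also have "\<dots> \<in> rel_ideal"
    by (intro rel_ideal_linear g assms)
  finally show ?thesis
    unfolding disc_clearable_def using g(1) by blast
qed

lemma disc_clearable: "disc_clearable p"
proof (induction p rule: cpoly_induct[OF subset_UNIV])
  case (2 i)
  have base: "disc_clearable (cvar i)" if "i \<notin> {5, 8, 9}" for i
    using that by (intro disc_clearableI) auto
  have ideal: "r * rel2 cvar - s * rel3 cvar \<in> rel_ideal" "r * rel3 cvar - s * rel2 cvar \<in> rel_ideal"
    "r * rel4 cvar - s * rel1 cvar \<in> rel_ideal" for r s
    by (intro ring_ideal_diff[OF ring_ideal_rel_ideal] ring_ideal_mult[OF ring_ideal_rel_ideal]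
        rel_in_rel_ideal)+
  have num: "disc_clearable (numeral k)" for k
    by (intro disc_clearableI) simp
  have diff: "disc_clearable (p - q)" if "disc_clearable p" "disc_clearable q" for p q
    using disc_clearable_add[OF that(1) disc_clearable_mult[OF disc_clearableI that(2), of "- 1"]]
    by simp
  have pw: "disc_clearable (p ^ k)" if "disc_clearable p" for p k
    using that by (induction k) (simp_all add: disc_clearable_mult disc_clearableI)
  note closure = disc_clearable_add disc_clearable_mult diff num pw base
  have 5: "disc_clearable (cvar 5)"
    by (rule disc_clearable_divide[OF _ ideal(1)[of "6 * cvar 6" "cvar 3",
        unfolded disc_identities(1)[of cvar, symmetric]]])
       (intro closure; simp)
  have 8: "disc_clearable (cvar 8)"
    by (rule disc_clearable_divide[OF _ ideal(2)[of "cvar 6" "cvar 3^2",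
        unfolded disc_identities(2)[of cvar, symmetric]]])
       (intro closure; simp)
  have 9: "disc_clearable (cvar 9)"
    by (rule disc_clearable_divide[OF _ ideal(3)[of "2 * cvar 6" "cvar 3^2",
        unfolded disc_identities(3)[of cvar, symmetric]]])
       (intro closure 5 8; simp)
  show ?case
    using base[of i] 5 8 9 by blast
qed (auto intro: disc_clearableI disc_clearable_add disc_clearable_mult)

text \<open>Once variables 5, 8 and 9 are eliminated, the rest \<open>g\<close> is subject to no
  relation: by \<open>chart\<close> its variables take all values with nonzero discriminant. So
  \<open>disc_poly cvar * g\<close> vanishes at every point and is the zero polynomial.\<close>

lemma disc_poly_power_in_rel_ideal:
  assumes sat: "\<And>x. x \<in> Z \<Longrightarrow> satisfies_relations x"
    and chart: "\<And>y. disc_poly y \<noteq> 0 \<Longrightarrow> \<exists>x\<in>Z. \<forall>i\<in>- {5, 8, 9}. x i = y i"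
    and "\<And>x. x \<in> Z \<Longrightarrow> cpoly_eval x p = 0"
  shows "\<exists>N. disc_poly cvar ^ N * p \<in> rel_ideal"
proof -
  obtain N g where g: "cpoly_vars g \<subseteq> - {5, 8, 9}" "disc_poly cvar ^ N * p - g \<in> rel_ideal"
    using disc_clearable[of p] unfolding disc_clearable_def by blast
  have "disc_poly cvar * g = 0"
  proof (rule cpoly_eq_0I)
    fix y :: "nat \<Rightarrow> complex"
    show "cpoly_eval y (disc_poly cvar * g) = 0"
    proof (cases "disc_poly y = 0")
      case True
      then show ?thesis by (simp add: cpoly_eval_rel)
    next
      case False
      then obtain x where x: "x \<in> Z" "\<forall>i\<in>- {5, 8, 9}. x i = y i"
        using chart by blast
      have "cpoly_eval x (disc_poly cvar ^ N * p - g) = 0"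
        by (rule cpoly_eval_rel_ideal[OF g(2) sat[OF x(1)]])
      then have "cpoly_eval x g = 0"
        using assms(3)[OF x(1)] by simp
      moreover have "cpoly_eval y g = cpoly_eval x g"
        by (rule cpoly_eval_cong[OF g(1)]) (use x(2) in auto)
      ultimately show ?thesis by simp
    qed
  qed
  then have "disc_poly cvar ^ Suc N * p = disc_poly cvar * (disc_poly cvar ^ N * p - g)"
    by (simp add: algebra_simps)
  also have "\<dots> \<in> rel_ideal"
    by (intro ring_ideal_mult[OF ring_ideal_rel_ideal] g)
  finally show ?thesis by blast
qed


subsection \<open>Polynomials vanishing on both charts\<close>

lemma cconst_int: "cconst (of_int t) = of_int t"
  by (metis single_of_int)

lemma cpoly_nat_invertible: "n > 0 \<Longrightarrow> \<exists>r :: 'v cpoly. r * of_nat n = 1"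
  by (rule exI[of _ "cconst (1 / of_nat n)"]) (simp add: mult_single flip: single_of_nat)

text \<open>The multipliers \<open>r\<close> with \<open>r * p\<close> in \<open>rel_ideal\<close>
  form an ideal \<open>J\<close>. Each chart puts a power of its denominator into \<open>J\<close>,
  so \<open>ring_ideal_one\<close> applies to the radical of \<open>J\<close>.\<close>

lemma in_rel_idealI:
  assumes sat: "\<And>x. x \<in> Z \<Longrightarrow> satisfies_relations x"
    and gram: "\<And>y. gram_chart y \<in> Z"
    and disc: "\<And>y. disc_poly y \<noteq> 0 \<Longrightarrow> \<exists>x\<in>Z. \<forall>i\<in>- {5, 8, 9}. x i = y i"
    and shear: "\<And>x t. x \<in> Z \<Longrightarrow> shear t x \<in> Z"
    and p: "\<And>x. x \<in> Z \<Longrightarrow> cpoly_eval x p = 0"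
  shows "p \<in> rel_ideal"
proof -
  define J where "J = {r. r * p \<in> rel_ideal}"
  have J: "ring_ideal J"
    unfolding J_def ring_ideal_def
    by (simp add: distrib_right mult.assoc rel_ideal_intros)
  note rad = ring_ideal_radical[OF J]
  have rel: "x \<in> radical J" if "x \<in> rel_ideal" for x
    by (rule radicalI[OF J]) (simp add: J_def that ring_ideal_mult'[OF ring_ideal_rel_ideal])
  have "1 \<in> radical J"
  proof (rule ring_ideal_one[OF rad, of cvar])
    show "\<exists>r :: nat cpoly. r * of_nat n = 1" if "n > 0" for n
      using that by (rule cpoly_nat_invertible)
    show "gram_det cvar \<in> radical J"
      using gram_det_power_in_rel_ideal[of p] p[OF gram] by (auto simp: radical_def J_def)
    fix t :: int
    let ?s = "of_int t :: complex"
    \<comment> \<open>To reach the discriminant of \<open>A + t B\<close>, \<open>p\<close> is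
      sheared by \<open>-t\<close>, the chart for \<open>A\<close> itself is applied, and the
      resulting membership is sheared back by \<open>t\<close>.\<close>
    let ?q = "psubst (shear (cconst (- ?s)) cvar) p"
    have "cpoly_eval x ?q = 0" if "x \<in> Z" for x
      using p[OF shear[OF that, of "- ?s"]] by (simp add: cpoly_eval_psubst cpoly_eval_shear)
    from disc_poly_power_in_rel_ideal[OF sat disc this]
    obtain N where "disc_poly cvar ^ N * ?q \<in> rel_ideal" by blast
    then have "psubst (shear (cconst ?s) cvar) (disc_poly cvar ^ N * ?q) \<in> rel_ideal"
      by (rule psubst_shear_rel_ideal)
    moreover have "psubst (shear (cconst ?s) cvar) ?q = p"
      unfolding psubst_psubst psubst_shear
      by (rule psubst_cvar_id[OF subset_UNIV])
         (simp add: single_uminus shear_shear_neg)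
    ultimately show "disc_poly (shear (of_int t) cvar) \<in> radical J"
      by (auto simp: psubst_rel cconst_int radical_def J_def)
  qed (intro rel rel_in_rel_ideal)+
  then show ?thesis by (simp add: radical_def J_def)
qed

section \<open>Matrices\<close>

type_synonym mat3 = "complex^3^3"

definition smat :: "complex \<Rightarrow> mat3 \<Rightarrow> mat3" where
  "smat c M = (\<chi> i j. c * M $ i $ j)"

definition outer :: "complex^3 \<Rightarrow> complex^3 \<Rightarrow> mat3" where
  "outer v w = (\<chi> i j. v $ i * w $ j)"

lemma matrix_eq_3:
  "M = N \<longleftrightarrow> (\<forall>i j. M $ i $ j = (N::mat3) $ i $ j)"
  by (simp add: vec_eq_iff)

lemma smat_nth [simp]: "smat c M $ i $ j = c * M $ i $ j"
  by (simp add: smat_def)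

lemma outer_nth [simp]: "outer v w $ i $ j = v $ i * w $ j"
  by (simp add: outer_def)

lemma mat_nth_3: "(mat c :: mat3) $ i $ j = (if i = j then c else 0)"
  by (simp add: mat_def)

lemma mult_nth_3: "((M::mat3) ** N) $ i $ j = M $ i $ 1 * N $ 1 $ j + M $ i $ 2 * N $ 2 $ j + M $ i $ 3 * N $ 3 $ j"
  by (simp add: matrix_matrix_mult_def sum_3)

lemma trace_3: "trace (M::mat3) = M $ 1 $ 1 + M $ 2 $ 2 + M $ 3 $ 3"
  by (simp add: trace_def sum_3)

lemma mat_3_neqs [simp]: "(1::3) \<noteq> 2" "(2::3) \<noteq> 1" "(1::3) \<noteq> 3" "(3::3) \<noteq> 1" "(2::3) \<noteq> 3" "(3::3) \<noteq> 2"
  by simp_all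

lemmas mat3_entries = matrix_eq_3 forall_3 mult_nth_3 mat_nth_3

lemma matrix_sub_ldistrib:
  fixes M N K :: mat3
  shows "M ** (N - K) = M ** N - M ** K"
  unfolding matrix_eq_3 by (simp add: mult_nth_3 algebra_simps)

lemma matrix_sub_rdistrib:
  fixes M N K :: mat3
  shows "(N - K) ** M = N ** M - K ** M"
  unfolding matrix_eq_3 by (simp add: mult_nth_3 algebra_simps)

lemma matrix_add_rdistrib:
  fixes M N K :: mat3
  shows "(N + K) ** M = N ** M + K ** M"
  unfolding matrix_eq_3 by (simp add: mult_nth_3 algebra_simps)

lemma smat_mult:
  "smat c M ** N = smat c (M ** N)" "M ** smat c N = smat c (M ** N)"
  by (simp_all add: mat3_entries algebra_simps)

lemma trace_smat: "trace (smat c M) = c * trace M"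
  by (simp add: trace_3 algebra_simps)

lemma mat_mult_commute:
  fixes M :: mat3
  shows "mat c ** M = M ** (mat c :: mat3)"
  by (simp add: mat3_entries algebra_simps)

lemma mat_conj:
  fixes g h :: mat3
  assumes "g ** h = mat 1"
  shows "g ** mat c ** h = mat c"
proof -
  have "g ** mat c ** h = mat c ** (g ** h)"
    by (simp only: matrix_mul_assoc mat_mult_commute[of c g])
  then show ?thesis using assms by simp
qed

lemma trace_mat_3: "trace (mat c :: mat3) = 3 * c"
  by (simp add: trace_3 mat_nth_3)

lemma rank_1_outer:
  assumes "rank (M::mat3) = 1"
  obtains v w where "M = outer v w"
proof -
  obtain B where B: "B \<subseteq> rows M" "vec.independent B" "rows M \<subseteq> vec.span B" "card B = 1"
    using vec.basis_exists[of "rows M"] assms by (auto simp: row_rank_def_gen)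
  then obtain w where "B = {w}" by (auto simp: card_1_singleton_iff)
  with B have "\<exists>k. row i M = k *s w" for i
    by (auto simp: vec.span_singleton rows_def)
  then obtain k where k: "\<And>i. row i M = k i *s w" by metis
  have "M = outer (\<chi> i. k i) w"
    using k by (auto simp: vec_eq_iff row_def)
  then show thesis by (rule that)
qed

lemma rank_outer:
  assumes "outer v w \<noteq> 0"
  shows "rank (outer v w) = 1"
proof -
  have row: "row i (outer v w) = v $ i *s w" for i
    by (simp add: vec_eq_iff row_def)
  from assms obtain i where i: "v $ i \<noteq> 0" "w \<noteq> 0"
    by (auto simp: vec_eq_iff)
  have "vec.dim (rows (outer v w)) = 1"
  proof (rule vec.dim_unique)
    show "{row i (outer v w)} \<subseteq> rows (outer v w)" by (auto simp: rows_def)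
    show "vec.independent {row i (outer v w)}"
      using i by (simp add: row vec.dependent_single)
    show "rows (outer v w) \<subseteq> vec.span {row i (outer v w)}"
    proof
      fix x assume "x \<in> rows (outer v w)"
      then obtain j where "x = v $ j *s w" by (auto simp: rows_def row)
      then have "x = (v $ j / v $ i) *s row i (outer v w)"
        using i by (simp add: row)
      then show "x \<in> vec.span {row i (outer v w)}"
        unfolding vec.span_singleton by blast
    qed
  qed simp
  then show ?thesis by (simp add: row_rank_def_gen)
qed

lemma rank_1_iff: "rank (M::mat3) = 1 \<longleftrightarrow> M \<noteq> 0 \<and> (\<exists>v w. M = outer v w)"
proof
  assume M: "rank M = 1"
  have "rank (0::mat3) \<noteq> 1"
  proof
    assume "rank (0::mat3) = 1"
    moreover have "vec.dim (rows (0::mat3)) \<le> vec.dim {0 :: complex^3}"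
      by (rule vec.dim_subset) (auto simp: rows_def row_def vec_eq_iff)
    ultimately show False by (simp add: row_rank_def_gen)
  qed
  with M show "M \<noteq> 0 \<and> (\<exists>v w. M = outer v w)" by (metis rank_1_outer)
qed (metis rank_outer)

lemma outer_mult: "M ** outer v w = outer (M *v v) w" "outer v w ** M = outer v (w v* M)"
  by (simp_all add: matrix_eq_3 matrix_matrix_mult_def matrix_vector_mult_def
      vector_matrix_mult_def sum_distrib_left sum_distrib_right algebra_simps)

lemma trace_outer: "trace (outer v w) = (\<Sum>i\<in>UNIV. v $ i * w $ i)"
  by (simp add: trace_def)

lemma trace_outer_sandwich:
  "trace (outer v w ** M ** outer v w ** N) = trace (outer v w ** M) * trace (outer v w ** N)"
proof -
  have "outer v w ** M ** outer v w = smat (trace (outer v w ** M)) (outer v w)"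
    unfolding outer_mult(2)[of v w M] trace_outer matrix_eq_3
    by (simp add: matrix_matrix_mult_def sum_distrib_left sum_distrib_right algebra_simps)
  then show ?thesis by (simp add: smat_mult trace_smat)
qed


subsection \<open>Traces of words\<close>

text \<open>With words as lists, cyclicity of the trace is rotation of lists, and every word can be
  rewritten to a chosen representative of its rotation class.\<close>

definition word_trace :: "mat3 list \<Rightarrow> complex" where
  "word_trace ws = trace (foldr (**) ws (mat 1))"

lemma foldr_matrix_mult_append:
  "foldr (**) (us @ ws) (mat 1) = foldr (**) us (mat 1) ** (foldr (**) ws (mat 1) :: mat3)"
  by (induction us) (simp_all add: matrix_mul_assoc)

lemma word_trace_rotate: "word_trace (us @ ws) = word_trace (ws @ us)"
  unfolding word_trace_def foldr_matrix_mult_append by (rule trace_mul_sym)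

text \<open>The coefficient of \<open>t\<close> in the Cayley-Hamilton identity for the traceless
  matrix \<open>A + t B\<close>.\<close>

lemma cayley_hamilton_polarised:
  fixes A B :: mat3
  assumes "trace A = 0" "trace B = 0"
  shows "A ** (A ** B) + A ** (B ** A) + B ** (A ** A)
    = smat (trace (A ** A) / 2) B + smat (trace (A ** B)) A + mat (trace (A ** (A ** B)))"
proof -
  have A: "A $ 3 $ 3 = - (A $ 1 $ 1 + A $ 2 $ 2)" and B: "B $ 3 $ 3 = - (B $ 1 $ 1 + B $ 2 $ 2)"
    using assms unfolding trace_3 by (simp_all only: eq_neg_iff_add_eq_0 add.commute)
  show ?thesis
    unfolding mat3_entries trace_3 smat_nth plus_vec_def vec_lambda_beta A B
    by (simp add: field_simps)
qed

lemma word_trace_cayley_hamilton: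
  fixes A B :: mat3
  assumes "trace A = 0" "trace B = 0"
  shows "word_trace (A # A # B # ws) + word_trace (A # B # A # ws) + word_trace (B # A # A # ws)
    = word_trace [A, A] / 2 * word_trace (B # ws) + word_trace [A, B] * word_trace (A # ws)
      + word_trace [A, A, B] * word_trace ws"
proof -
  let ?M = "foldr (**) ws (mat 1) :: mat3"
  have "trace ((A ** (A ** B) + A ** (B ** A) + B ** (A ** A)) ** ?M)
    = trace ((smat (trace (A ** A) / 2) B + smat (trace (A ** B)) A + mat (trace (A ** (A ** B)))) ** ?M)"
    by (simp only: cayley_hamilton_polarised[OF assms])
  moreover have "mat c ** ?M = smat c ?M" for c
    by (simp add: mat3_entries)
  ultimately show ?thesis
    by (simp add: word_trace_def matrix_add_rdistrib trace_add smat_mult trace_smat matrix_mul_assoc)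
qed

lemma word_trace_cayley_hamilton_cube:
  fixes A :: mat3
  assumes "trace A = 0"
  shows "word_trace (A # A # A # ws)
    = word_trace [A, A] / 2 * word_trace (A # ws) + word_trace [A, A, A] / 3 * word_trace ws"
  using word_trace_cayley_hamilton[OF assms assms, of ws] by (simp add: field_simps)

section \<open>The Calogero-Moser matrices\<close>

definition traceless :: "mat3 \<Rightarrow> mat3" where
  "traceless X = X - mat (trace X / 3)"

lemma trace_traceless [simp]: "trace (traceless X) = 0"
  by (simp add: traceless_def trace_sub trace_mat_3)

text \<open>Total in both arguments, unlike \<open>CM_gen\<close>. The value 0 off
  \<open>{1..9}\<close> means that replacing all other variables of a polynomial by 0 does not
  change its values on traces.\<close>

definition cm_traces :: "matrix_pair \<Rightarrow> nat \<Rightarrow> complex" where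
  "cm_traces z i =
    (let A = traceless (fst z); B = traceless (snd z)
     in if i = 1 then trace (fst z) else if i = 2 then trace (snd z)
        else if i = 3 then word_trace [A, A] else if i = 4 then word_trace [A, B]
        else if i = 5 then word_trace [B, B] else if i = 6 then word_trace [A, A, A]
        else if i = 7 then word_trace [A, A, B] else if i = 8 then word_trace [A, B, B]
        else if i = 9 then word_trace [B, B, B] else 0)"

lemma CM_gen_eq_cm_traces:
  assumes "z \<in> CM_bar" "i \<in> {1..9}"
  shows "CM_gen i z = cm_traces z i"
proof -
  have "i \<in> {1, 2, 3, 4, 5, 6, 7, 8, 9}" using assms(2) by auto
  then show ?thesis
    using assms(1)
    by (auto simp: CM_gen_def cm_traces_def Let_def traceless_def word_trace_def matrix_mul_assoc
        split: prod.splits)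
qed

lemma bracket_traceless:
  "traceless X ** traceless Y - traceless Y ** traceless X = X ** Y - Y ** X"
  unfolding matrix_eq_3 by (simp add: traceless_def mult_nth_3 mat_nth_3 forall_3 algebra_simps)

text \<open>\<open>[X, Y] + 1\<close> has trace 3, so the outer product cannot be the zero matrix,
  and every nonzero outer product has rank 1.\<close>

lemma CM_bar_iff:
  "z \<in> CM_bar \<longleftrightarrow> (\<exists>v w. fst z ** snd z - snd z ** fst z + mat 1 = outer v w)"
proof -
  have "M \<noteq> 0" if "M = fst z ** snd z - snd z ** fst z + mat 1" for M
  proof
    assume "M = 0"
    then have "trace (fst z ** snd z - snd z ** fst z + mat 1) = 0"
      using that by (simp add: trace_3)
    then show False
      by (simp add: trace_add trace_sub trace_mat_3 trace_mul_sym[of "fst z"])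
  qed
  then show ?thesis
    by (auto simp: CM_bar_def rank_1_iff[unfolded One_nat_def] split: prod.splits)
qed

locale cm_pair =
  fixes A B :: mat3 and v w :: "complex^3"
  assumes tr_A: "trace A = 0" and tr_B: "trace B = 0"
    and bracket: "A ** B - B ** A + mat 1 = outer v w"
begin

definition E :: mat3 where "E = outer v w"

abbreviation "tr \<equiv> word_trace"

lemma E_expand: "tr (E # ws) = tr (A # B # ws) - tr (B # A # ws) + tr ws"
proof -
  have "trace ((A ** B - B ** A + mat 1) ** foldr (**) ws (mat 1)) =
    trace (A ** B ** foldr (**) ws (mat 1)) - trace (B ** A ** foldr (**) ws (mat 1))
    + trace (foldr (**) ws (mat 1))"
    by (simp add: matrix_add_rdistrib matrix_sub_rdistrib trace_add trace_sub)
  then show ?thesis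
    by (simp add: bracket E_def word_trace_def matrix_mul_assoc)
qed

text \<open>The source of all special trace identities: a word with two letters \<open>E\<close>
  factors here, while \<open>E_expand\<close> turns the same word into traces of words in
  \<open>A\<close> and \<open>B\<close>.\<close>

lemma E_sandwich: "tr (E # us @ E # ws) = tr (E # us) * tr (E # ws)"
  using trace_outer_sandwich[of v w "foldr (**) us (mat 1)" "foldr (**) ws (mat 1)"]
  by (simp add: E_def word_trace_def foldr_matrix_mult_append matrix_mul_assoc del: foldr_append)

lemma tr_simps [simp]: "tr [A] = 0" "tr [B] = 0" "tr [] = 3"
  by (simp_all add: word_trace_def tr_A tr_B trace_mat_3)

lemma tr_BA: "tr [B, A] = tr [A, B]"
  using word_trace_rotate[of "[B]" "[A]"] by simp

lemma tr_A2B: "tr [A, B, A] = tr [A, A, B]" "tr [B, A, A] = tr [A, A, B]"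
  using word_trace_rotate[of "[A, B]" "[A]"] word_trace_rotate[of "[B]" "[A, A]"] by simp_all

lemma tr_AB2: "tr [B, A, B] = tr [A, B, B]" "tr [B, B, A] = tr [A, B, B]"
  using word_trace_rotate[of "[B]" "[A, B]"] word_trace_rotate[of "[B, B]" "[A]"] by simp_all

lemma tr_A3B: "tr [A, A, B, A] = tr [A, A, A, B]" "tr [A, B, A, A] = tr [A, A, A, B]"
  "tr [B, A, A, A] = tr [A, A, A, B]"
  using word_trace_rotate[of "[A, A, B]" "[A]"] word_trace_rotate[of "[A, B]" "[A, A]"]
    word_trace_rotate[of "[B]" "[A, A, A]"] by simp_all

lemma tr_A2B2: "tr [B, A, A, B] = tr [A, A, B, B]" "tr [B, B, A, A] = tr [A, A, B, B]"
  "tr [A, B, B, A] = tr [A, A, B, B]" "tr [B, A, B, A] = tr [A, B, A, B]"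
  using word_trace_rotate[of "[B]" "[A, A, B]"] word_trace_rotate[of "[B, B]" "[A, A]"]
    word_trace_rotate[of "[A, B, B]" "[A]"] word_trace_rotate[of "[B]" "[A, B, A]"] by simp_all

lemma tr_A3B2:
  "tr [B, A, A, A, B] = tr [A, A, A, B, B]" "tr [A, B, B, A, A] = tr [A, A, A, B, B]"
  "tr [A, B, A, A, B] = tr [A, A, B, A, B]" "tr [A, B, A, B, A] = tr [A, A, B, A, B]"
  "tr [B, A, A, B, A] = tr [A, A, B, A, B]" "tr [B, A, B, A, A] = tr [A, A, B, A, B]"
  using word_trace_rotate[of "[B]" "[A, A, A, B]"] word_trace_rotate[of "[A, B, B]" "[A, A]"]
    word_trace_rotate[of "[A, B]" "[A, A, B]"] word_trace_rotate[of "[A, B, A, B]" "[A]"]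
    word_trace_rotate[of "[B]" "[A, A, B, A]"] word_trace_rotate[of "[B, A, B]" "[A, A]"] by simp_all

lemma tr_A2B3:
  "tr [A, B, B, B, A] = tr [B, B, B, A, A]" "tr [B, A, A, B, B] = tr [B, B, B, A, A]"
  "tr [B, A, B, A, B] = tr [B, B, A, B, A]" "tr [B, A, B, B, A] = tr [B, B, A, B, A]"
  "tr [A, B, B, A, B] = tr [B, B, A, B, A]" "tr [A, B, A, B, B] = tr [B, B, A, B, A]"
  using word_trace_rotate[of "[A]" "[B, B, B, A]"] word_trace_rotate[of "[B, A, A]" "[B, B]"]
    word_trace_rotate[of "[B, A, B, A]" "[B]"] word_trace_rotate[of "[B, A]" "[B, B, A]"]
    word_trace_rotate[of "[A]" "[B, B, A, B]"] word_trace_rotate[of "[A, B, A]" "[B, B]"] by simp_all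

lemma tr_A4B2:
  "tr [A, B, A, A, B, A] = tr [A, A, B, A, A, B]" "tr [B, A, A, B, A, A] = tr [A, A, B, A, A, B]"
  "tr [B, A, A, A, B, A] = tr [A, A, A, B, A, B]" "tr [A, B, A, B, A, A] = tr [A, A, A, B, A, B]"
  "tr [A, B, A, A, A, B] = tr [A, A, A, B, A, B]" "tr [B, A, A, A, A, B] = tr [A, A, A, A, B, B]"
  using word_trace_rotate[of "[A, B, A, A, B]" "[A]"] word_trace_rotate[of "[B]" "[A, A, B, A, A]"]
    word_trace_rotate[of "[B]" "[A, A, A, B, A]"] word_trace_rotate[of "[A, B, A, B]" "[A, A]"]
    word_trace_rotate[of "[A, B]" "[A, A, A, B]"] word_trace_rotate[of "[B]" "[A, A, A, A, B]"] by simp_all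

lemmas tr_rotations = tr_BA tr_A2B tr_AB2 tr_A3B tr_A2B2 tr_A3B2 tr_A2B3 tr_A4B2

lemma tr_E_rotations:
  "tr [A, B, E] = tr [E, A, B]" "tr [B, A, E] = tr [E, B, A]"
  "tr [A, B, E, A] = tr [E, A, A, B]" "tr [B, A, E, A] = tr [E, A, B, A]"
  "tr [A, B, E, B] = tr [E, B, A, B]" "tr [B, A, E, B] = tr [E, B, B, A]"
  "tr [A, B, A, E, A] = tr [E, A, A, B, A]" "tr [B, A, A, E, A] = tr [E, A, B, A, A]"
  "tr [A, E, A] = tr [E, A, A]"
  using word_trace_rotate[of "[A, B]" "[E]"] word_trace_rotate[of "[B, A]" "[E]"]
    word_trace_rotate[of "[A, B]" "[E, A]"] word_trace_rotate[of "[B, A]" "[E, A]"]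
    word_trace_rotate[of "[A, B]" "[E, B]"] word_trace_rotate[of "[B, A]" "[E, B]"]
    word_trace_rotate[of "[A, B, A]" "[E, A]"] word_trace_rotate[of "[B, A, A]" "[E, A]"]
    word_trace_rotate[of "[A]" "[E, A]"]
  by simp_all

section \<open>Trace identities forced by the rank one condition\<close>

lemma tr_E: "tr [E] = 3" "tr [E, A] = 0" "tr [E, B] = 0"
  unfolding E_expand by (simp_all add: tr_rotations)

text \<open>The trace of \<open>E E\<close> is \<open>3 * 3 = 9\<close>, expanded through the
  bracket. The next three facts arise likewise from \<open>E E A\<close>, \<open>E E B\<close> and
  \<open>E A E A\<close>, whose traces are 0.\<close>

lemma tr_ABAB: "tr [A, B, A, B] = tr [A, A, B, B] + 3"
proof -
  have "9 = tr [E, A, B] - tr [E, B, A] + 3"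
    using E_sandwich[of "[]" "[]"] E_expand[of "[E]"] by (simp add: tr_E tr_E_rotations)
  then have "2 * (tr [A, B, A, B] - (tr [A, A, B, B] + 3)) = 0"
    unfolding E_expand by (simp add: tr_rotations algebra_simps)
  then show ?thesis by (metis mult_eq_0_iff right_minus_eq zero_neq_numeral)
qed

lemma tr_AABAB: "tr [A, A, B, A, B] = tr [A, A, A, B, B]"
proof -
  have "tr [E, A, A, B] - tr [E, A, B, A] = 0"
    using E_sandwich[of "[]" "[A]"] E_expand[of "[E, A]"] by (simp add: tr_E tr_E_rotations)
  then show ?thesis
    unfolding E_expand by (simp add: tr_rotations)
qed

lemma tr_BBABA: "tr [B, B, A, B, A] = tr [B, B, B, A, A]"
proof -
  have "tr [E, B, A, B] - tr [E, B, B, A] = 0"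
    using E_sandwich[of "[]" "[B]"] E_expand[of "[E, B]"] by (simp add: tr_E tr_E_rotations)
  then show ?thesis
    unfolding E_expand by (simp add: tr_rotations)
qed

lemma tr_AABAAB: "tr [A, A, B, A, A, B] = tr [A, A, A, B, A, B] - tr [A, A] / 2"
proof -
  have "tr [E, A, A, B, A] - tr [E, A, B, A, A] + tr [E, A, A] = 0"
    using E_sandwich[of "[A]" "[A]"] E_expand[of "[A, E, A]"] by (simp add: tr_E tr_E_rotations)
  then have "2 * (tr [A, A, B, A, A, B] - (tr [A, A, A, B, A, B] - tr [A, A] / 2)) = 0"
    unfolding E_expand by (simp add: tr_rotations algebra_simps)
  then show ?thesis by (metis mult_eq_0_iff right_minus_eq zero_neq_numeral)
qed

lemmas tr_cube = word_trace_cayley_hamilton_cube[OF tr_A]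

text \<open>The trace of \<open>A^3 B^2\<close> is computed twice: by Cayley-Hamilton for
  \<open>A^3\<close>, and by the polarised identity with tail \<open>A B\<close>, whose three words
  all have this trace by \<open>tr_AABAB\<close>.\<close>

lemma tr_relation_2: "tr [B, B] * tr [A, A, A] - 2 * tr [A, B] * tr [A, A, B] + tr [A, A] * tr [A, B, B] = 0"
proof -
  \<comment> \<open>The constant carries no meaning: a nonzero multiple is proved and the factor
    cancelled, as with 6912 below.\<close>
  have "432 * (tr [B, B] * tr [A, A, A] - 2 * tr [A, B] * tr [A, A, B] + tr [A, A] * tr [A, B, B]) = 0"
    using word_trace_cayley_hamilton[OF tr_A tr_B, of "[A, B]"] tr_cube[of "[B, B]"] tr_AABAB
    by (simp add: tr_rotations field_simps)
  then show ?thesis by (metis mult_eq_0_iff zero_neq_numeral)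
qed

text \<open>The polarised identity with tail \<open>A A B\<close>. Cubes of \<open>A\<close> are
  removed by Cayley-Hamilton, \<open>tr_AABAAB\<close> merges two of the three words, and the trace
  of \<open>A A B B\<close> is known from the identity with tail \<open>B\<close> and
  \<open>tr_ABAB\<close>.\<close>

lemma tr_relation_3:
  "9 * tr [A, A] - tr [A, A] * tr [A, B]^2 + tr [A, A]^2 * tr [B, B] + 6 * tr [A, A, A] * tr [A, B, B]
    - 6 * tr [A, A, B]^2 = 0"
proof -
  have 1: "3 * tr [A, A, B, B] + 3 = tr [A, A] / 2 * tr [B, B] + tr [A, B]^2"
    using word_trace_cayley_hamilton[OF tr_A tr_B, of "[B]"] tr_ABAB
    by (simp add: tr_rotations power2_eq_square algebra_simps)
  have 2: "tr [A, A, B, A, A, B] + tr [A, A, A, B, A, B] + tr [A, A, A, A, B, B]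
    = tr [A, A] / 2 * tr [A, A, B, B] + tr [A, B] * tr [A, A, A, B] + tr [A, A, B]^2"
    using word_trace_cayley_hamilton[OF tr_A tr_B, of "[A, A, B]"]
    by (simp add: tr_rotations power2_eq_square)
  define t where "t = tr [A, A, B, B]"
  have t: "t = (tr [A, A] / 2 * tr [B, B] + tr [A, B]^2 - 3) / 3"
    using 1 by (simp add: t_def field_simps)
  have "6912 * (9 * tr [A, A] - tr [A, A] * tr [A, B]^2 + tr [A, A]^2 * tr [B, B]
      + 6 * tr [A, A, A] * tr [A, B, B] - 6 * tr [A, A, B]^2) = 0"
    using 2 unfolding tr_AABAAB tr_cube[of "[B]"] tr_cube[of "[B, A, B]"] tr_cube[of "[A, B, B]"]
      tr_ABAB tr_AB2 tr_BA t_def[symmetric] t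
    by (simp add: field_simps power2_eq_square)
  then show ?thesis by (metis mult_eq_0_iff zero_neq_numeral)
qed

text \<open>As \<open>E = v w\<close>, the trace of \<open>E N\<close> is \<open>w N v\<close>.
  These are the entries of the Gram matrix of \<open>(w, wA, wB)\<close> against
  \<open>(v, Av, Bv)\<close> and of the matrices \<open>w M\<^sub>i A M\<^sub>j v\<close> and
  \<open>w M\<^sub>i B M\<^sub>j v\<close> with \<open>M = (1, A, B)\<close>.\<close>

lemma tr_E_words:
  "tr [E, A, A] = tr [A, A]" "tr [E, B, B] = tr [B, B]"
  "tr [E, A, B] = tr [A, B] + 3" "tr [E, B, A] = tr [A, B] - 3"
  "tr [E, A, A, A] = tr [A, A, A]" "tr [E, B, B, B] = tr [B, B, B]"
  "tr [E, A, A, B] = tr [A, A, B]" "tr [E, A, B, A] = tr [A, A, B]" "tr [E, B, A, A] = tr [A, A, B]"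
  "tr [E, A, B, B] = tr [A, B, B]" "tr [E, B, A, B] = tr [A, B, B]" "tr [E, B, B, A] = tr [A, B, B]"
  unfolding E_expand
  using word_trace_rotate[of "[B]" "[A, A, A]"] word_trace_rotate[of "[A, B, B]" "[B]"]
    word_trace_rotate[of "[B]" "[A, A, A, A]"]  word_trace_rotate[of "[A, B, B, B]" "[B]"]
    word_trace_rotate[of "[A, B]" "[A, A, A]"]
  by (simp_all add: tr_rotations tr_ABAB tr_AABAB tr_BBABA)

end

subsection \<open>The relations hold\<close>

lemma minus_mult_3: "(- M) ** N = - (M ** N)" "M ** (- N) = - (M ** N)" for M N :: mat3
  unfolding matrix_eq_3 by (simp_all add: mult_nth_3)

lemma trace_uminus: "trace (- M) = - trace M" for M :: mat3
  by (simp add: trace_3)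

lemma smat_add: "smat c (M + N) = smat c M + smat c N"
  by (simp add: matrix_eq_3 algebra_simps)

definition shear_pair :: "complex \<Rightarrow> matrix_pair \<Rightarrow> matrix_pair" where
  "shear_pair t z = (fst z + smat t (snd z), snd z)"

text \<open>The sign preserves the commutator: \<open>[Y, -X] = [X, Y]\<close>.\<close>

definition swap_pair :: "matrix_pair \<Rightarrow> matrix_pair" where
  "swap_pair z = (snd z, - fst z)"

definition swap :: "(nat \<Rightarrow> complex) \<Rightarrow> nat \<Rightarrow> complex" where
  "swap a i = (if i = 1 then a 2 else if i = 2 then - a 1 else if i = 3 then a 5
     else if i = 4 then - a 4 else if i = 5 then a 3 else if i = 6 then a 9
     else if i = 7 then - a 8 else if i = 8 then a 7 else if i = 9 then - a 6 else a i)"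

lemma traceless_shear: "traceless (X + smat t Y) = traceless X + smat t (traceless Y)"
  by (simp add: traceless_def trace_add trace_smat matrix_eq_3 mat_nth_3 field_simps)

lemma traceless_uminus: "traceless (- X) = - traceless X"
  by (simp add: traceless_def trace_uminus matrix_eq_3 mat_nth_3)

lemma shear_pair_CM_bar: "z \<in> CM_bar \<Longrightarrow> shear_pair t z \<in> CM_bar"
  unfolding CM_bar_iff shear_pair_def
  by (simp add: matrix_add_ldistrib matrix_add_rdistrib smat_mult)

lemma swap_pair_CM_bar: "z \<in> CM_bar \<Longrightarrow> swap_pair z \<in> CM_bar"
  unfolding CM_bar_iff swap_pair_def by (simp add: minus_mult_3)

lemma trace_cyclic_3:
  fixes A B C :: mat3
  shows "trace (A ** (B ** C)) = trace (B ** (C ** A))"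
  using trace_mul_sym[of A "B ** C"] by (simp add: matrix_mul_assoc)

lemma cm_traces_shear: "cm_traces (shear_pair t z) i = shear t (cm_traces z) i"
proof -
  let ?A = "traceless (fst z)" and ?B = "traceless (snd z)"
  have "trace (?B ** ?A) = trace (?A ** ?B)" by (rule trace_mul_sym)
  moreover have "trace (?A ** (?B ** ?A)) = trace (?A ** (?A ** ?B))"
    "trace (?B ** (?A ** ?A)) = trace (?A ** (?A ** ?B))"
    "trace (?B ** (?A ** ?B)) = trace (?A ** (?B ** ?B))"
    "trace (?B ** (?B ** ?A)) = trace (?A ** (?B ** ?B))"
    using trace_cyclic_3 by metis+
  ultimately show ?thesis
    by (simp add: cm_traces_def shear_def shear_pair_def Let_def traceless_shear word_trace_def
      matrix_add_ldistrib matrix_add_rdistrib smat_mult smat_add trace_add trace_smat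
      algebra_simps power2_eq_square power3_eq_cube)
qed

lemma cm_traces_swap: "cm_traces (swap_pair z) i = swap (cm_traces z) i"
proof -
  let ?A = "traceless (fst z)" and ?B = "traceless (snd z)"
  have "trace (?B ** ?A) = trace (?A ** ?B)" by (rule trace_mul_sym)
  moreover have "trace (?B ** (?A ** ?A)) = trace (?A ** (?A ** ?B))"
    "trace (?B ** (?B ** ?A)) = trace (?A ** (?B ** ?B))"
    using trace_cyclic_3 by metis+
  ultimately show ?thesis
    by (simp add: cm_traces_def swap_def swap_pair_def Let_def traceless_uminus word_trace_def
      minus_mult_3 trace_uminus)
qed

lemma CM_bar_cm_pair:
  assumes "z \<in> CM_bar"
  obtains v w where "cm_pair (traceless (fst z)) (traceless (snd z)) v w"
  using assms unfolding CM_bar_iff by (auto simp: cm_pair_def bracket_traceless)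

lemma cm_traces_relation_2_3:
  assumes "z \<in> CM_bar"
  shows "rel2 (cm_traces z) = 0" "rel3 (cm_traces z) = 0"
proof -
  obtain v w where "cm_pair (traceless (fst z)) (traceless (snd z)) v w"
    using assms by (rule CM_bar_cm_pair)
  then interpret cm_pair "traceless (fst z)" "traceless (snd z)" v w .
  show "rel2 (cm_traces z) = 0" "rel3 (cm_traces z) = 0"
    using tr_relation_2 tr_relation_3 by (simp_all add: rel_defs cm_traces_def Let_def)
qed

text \<open>Only \<open>rel2\<close> and \<open>rel3\<close> are computed from words. Swapping turns
  them into \<open>rel1\<close> and \<open>rel5\<close>, and \<open>rel3\<close> at the shear by 1
  equals \<open>rel3 + 2 * rel4 + rel5\<close>, which leaves \<open>rel4\<close>.\<close>

lemma satisfies_relations_cm_traces: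
  assumes z: "z \<in> CM_bar"
  shows "satisfies_relations (cm_traces z)"
proof -
  note 23 = cm_traces_relation_2_3[OF z]
  have swap: "cm_traces (swap_pair z) = swap (cm_traces z)"
    and shear: "cm_traces (shear_pair 1 z) = shear 1 (cm_traces z)"
    by (intro ext cm_traces_swap cm_traces_shear)+
  have 1: "rel1 (cm_traces z) = 0"
    using cm_traces_relation_2_3(1)[OF swap_pair_CM_bar[OF z]]
    by (simp add: swap rel_defs swap_def algebra_simps)
  have 5: "rel5 (cm_traces z) = 0"
    using cm_traces_relation_2_3(2)[OF swap_pair_CM_bar[OF z]]
    by (simp add: swap rel_defs swap_def algebra_simps)
  have "rel3 (shear 1 (cm_traces z)) = 0"
    using cm_traces_relation_2_3(2)[OF shear_pair_CM_bar[OF z, of 1]] by (simp add: shear)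
  then have 4: "rel4 (cm_traces z) = 0"
    using 23 5 by (simp add: rel_shear)
  from 1 23 4 5 show ?thesis by (simp add: satisfies_relations_def)
qed


subsection \<open>Conjugation to normal form\<close>

lemma matrix_inv_unique:
  fixes M N :: mat3
  assumes "M ** N = mat 1" "N ** M = mat 1"
  shows "matrix_inv M = N"
proof -
  have "M ** matrix_inv M = mat 1 \<and> matrix_inv M ** M = mat 1"
    unfolding matrix_inv_def by (rule someI[of _ N]) (use assms in simp)
  then have "matrix_inv M = (N ** M) ** matrix_inv M" using assms by simp
  also have "\<dots> = N"
    using \<open>M ** matrix_inv M = mat 1 \<and> _\<close> by (simp flip: matrix_mul_assoc)
  finally show ?thesis .
qed

lemma trace_outer_mult: "trace (outer v w ** P) = (\<Sum>k\<in>UNIV. w $ k * (P *v v) $ k)"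
  unfolding trace_mul_sym[of "outer v w"] outer_mult(1) trace_outer by (simp add: mult.commute)

lemma vector_matrix_dot:
  fixes P :: mat3
  shows "(\<Sum>k\<in>UNIV. (w v* P) $ k * x $ k) = (\<Sum>k\<in>UNIV. w $ k * (P *v x) $ k)"
  by (simp add: vector_matrix_mult_def matrix_vector_mult_def sum_3 algebra_simps)

text \<open>If the vectors \<open>N\<^sub>j v\<close> and the covectors \<open>w M\<^sub>i\<close> have an invertible Gram matrix, then
  the matrix of \<open>K\<close> in the basis \<open>N\<^sub>j v\<close> can be read off from traces.\<close>

lemma frame_conjugation:
  fixes M N :: "3 \<Rightarrow> mat3" and G :: mat3
  assumes G: "\<And>i j. G $ i $ j = trace (outer v w ** (M i ** N j))"
    and inv: "G ** H = mat 1" "H ** G = mat 1"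
  obtains g where "invertible g"
    "\<And>K K'. (\<And>i j. (G ** K') $ i $ j = trace (outer v w ** (M i ** K ** N j)))
      \<Longrightarrow> g ** K ** matrix_inv g = K'"
proof -
  define W :: mat3 where "W = (\<chi> i. w v* M i)"
  define T :: mat3 where "T = (\<chi> k j. (N j *v v) $ k)"
  have entry: "(W ** K ** T) $ i $ j = trace (outer v w ** (M i ** K ** N j))" for K i j
  proof -
    have "(W ** K ** T) $ i $ j = (\<Sum>k\<in>UNIV. (W ** K) $ i $ k * (N j *v v) $ k)"
      by (simp add: matrix_matrix_mult_def[of "W ** K"] T_def)
    also have "(W ** K) $ i = w v* (M i ** K)"
      unfolding W_def vector_matrix_mul_assoc[symmetric]
      by (simp add: vec_eq_iff matrix_matrix_mult_def vector_matrix_mult_def)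
    finally show ?thesis
      by (simp add: vector_matrix_dot trace_outer_mult matrix_vector_mul_assoc)
  qed
  have WT: "W ** T = G"
    using entry[of "mat 1"] G by (simp add: vec_eq_iff)
  \<comment> \<open>Since \<open>W ** T = G\<close>, this is the inverse of \<open>T\<close>, whose
    columns are the frame vectors; conjugating by it expresses a matrix in that frame.\<close>
  define g where "g = H ** W"
  have gT: "g ** T = mat 1"
    using inv WT by (simp add: g_def flip: matrix_mul_assoc)
  have Tg: "T ** g = mat 1"
    using gT matrix_left_right_inverse[of g T] by simp
  have inv_g: "matrix_inv g = T"
    using gT Tg by (rule matrix_inv_unique)
  show thesis
  proof
    show "invertible g" using gT Tg by (auto simp: invertible_def)
    fix K K' assume K: "\<And>i j. (G ** K') $ i $ j = trace (outer v w ** (M i ** K ** N j))"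
    have "W ** K ** T = G ** K'"
      using entry[of K] K by (simp add: vec_eq_iff)
    then have "H ** (W ** K ** T) = K'"
      using inv by (simp add: matrix_mul_assoc)
    then show "g ** K ** matrix_inv g = K'"
      unfolding inv_g by (simp add: g_def matrix_mul_assoc)
  qed
qed

lemma conj_pair_normal_form:
  assumes g: "invertible g"
    and "g ** traceless (fst z) ** matrix_inv g = A'" "g ** traceless (snd z) ** matrix_inv g = B'"
  shows "conj_pair g z = (A' + mat (trace (fst z) / 3), B' + mat (trace (snd z) / 3))"
proof -
  obtain h where h: "g ** h = mat 1" "h ** g = mat 1" using g by (auto simp: invertible_def)
  have "matrix_inv g = h" using h by (rule matrix_inv_unique)
  then have eq: "g ** X ** matrix_inv g = g ** traceless X ** matrix_inv g + mat (trace X / 3)" for X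
    by (simp add: traceless_def matrix_sub_ldistrib matrix_sub_rdistrib mat_conj[OF h(1)])
  show ?thesis
    using assms(2,3) eq[of "fst z"] eq[of "snd z"] by (simp add: conj_pair_def case_prod_beta)
qed

subsection \<open>Normal form on the Gram chart\<close>

text \<open>The first column says that \<open>A\<close> maps \<open>v\<close> to the second frame
  vector. The first row consists of \<open>w A A v\<close> and \<open>w A B v\<close> divided by
  \<open>w v = 3\<close>.\<close>

definition gram_A :: "(nat \<Rightarrow> complex) \<Rightarrow> mat3" where
  "gram_A y = vector [vector [0, gram_chart y 3 / 3, (gram_chart y 4 + 3) / 3],
     vector [1, y 3, y 4], vector [0, y 5, - y 3]]"

definition gram_B :: "(nat \<Rightarrow> complex) \<Rightarrow> mat3" where
  "gram_B y = vector [vector [0, (gram_chart y 4 - 3) / 3, gram_chart y 5 / 3],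
     vector [0, y 4, y 6], vector [1, - y 3, - y 4]]"

definition gram_pair :: "(nat \<Rightarrow> complex) \<Rightarrow> matrix_pair" where
  "gram_pair y = (gram_A y + mat (y 1 / 3), gram_B y + mat (y 2 / 3))"

definition gram_matrix :: "(nat \<Rightarrow> complex) \<Rightarrow> mat3" where
  "gram_matrix x = vector [vector [3, 0, 0], vector [0, x 3, x 4 + 3], vector [0, x 4 - 3, x 5]]"

lemma traceless_add_mat': "trace A = 0 \<Longrightarrow> traceless (A + mat c) = A"
  by (simp add: traceless_def trace_add trace_mat_3)

lemma gram_chart_simps:
  "gram_chart y 3 = 6 * (y 3^2 + y 4 * y 5)"
  "gram_chart y 4 = 3 * (y 3 * y 4 + y 6 * y 5)"
  "gram_chart y 5 = 6 * (y 4^2 - y 3 * y 6)"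
  "gram_chart y 6 = gram_chart y 3 * y 3 + (gram_chart y 4 + 3) * y 5"
  "gram_chart y 7 = gram_chart y 3 * y 4 - (gram_chart y 4 + 3) * y 3"
  "gram_chart y 8 = gram_chart y 3 * y 6 - (gram_chart y 4 + 3) * y 4"
  "gram_chart y 9 = (gram_chart y 4 - 3) * y 6 - gram_chart y 5 * y 4"
  by (simp_all add: gram_chart_def gram_chart_hom_def Let_def)

text \<open>In its own frame \<open>v\<close> is the first unit vector, and \<open>w\<close> has the
  coordinates \<open>w v = 3\<close>, \<open>w A v = 0\<close>, \<open>w B v = 0\<close>.\<close>

lemma gram_bracket:
  "gram_A y ** gram_B y - gram_B y ** gram_A y + mat 1 = outer (vector [1, 0, 0]) (vector [3, 0, 0])"
  unfolding matrix_eq_3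
  by (simp add: forall_3 mult_nth_3 mat_nth_3 gram_A_def gram_B_def gram_chart_simps
      field_simps power2_eq_square)

lemma trace_gram: "trace (gram_A y) = 0" "trace (gram_B y) = 0"
  by (simp_all add: trace_3 gram_A_def gram_B_def)

lemma traceless_gram_pair:
  "traceless (fst (gram_pair y)) = gram_A y" "traceless (snd (gram_pair y)) = gram_B y"
  by (simp_all add: gram_pair_def traceless_add_mat' trace_gram)

lemma CM_bar_if_traceless:
  assumes "traceless (fst z) ** traceless (snd z) - traceless (snd z) ** traceless (fst z) + mat 1 = outer v w"
  shows "z \<in> CM_bar"
  using assms unfolding CM_bar_iff bracket_traceless by blast

lemma gram_pair_CM_bar: "gram_pair y \<in> CM_bar"
  by (rule CM_bar_if_traceless) (simp add: traceless_gram_pair gram_bracket)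

lemma cm_traces_gram_pair:
  assumes "i \<in> {1..9}"
  shows "cm_traces (gram_pair y) i = gram_chart y i"
proof -
  have "i \<in> {1, 2, 3, 4, 5, 6, 7, 8, 9}" using assms by auto
  moreover have "trace (fst (gram_pair y)) = y 1" "trace (snd (gram_pair y)) = y 2"
    by (simp_all add: gram_pair_def trace_add trace_gram trace_mat_3)
  moreover have "word_trace [gram_A y, gram_A y] = gram_chart y 3"
    "word_trace [gram_A y, gram_B y] = gram_chart y 4"
    "word_trace [gram_B y, gram_B y] = gram_chart y 5"
    "word_trace [gram_A y, gram_A y, gram_A y] = gram_chart y 6"
    "word_trace [gram_A y, gram_A y, gram_B y] = gram_chart y 7"
    "word_trace [gram_A y, gram_B y, gram_B y] = gram_chart y 8"
    "word_trace [gram_B y, gram_B y, gram_B y] = gram_chart y 9"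
    unfolding word_trace_def
    by (simp_all add: trace_3 mult_nth_3 gram_A_def gram_B_def gram_chart_simps
        field_simps power2_eq_square)
  moreover have "gram_chart y 1 = y 1" "gram_chart y 2 = y 2"
    by (simp_all add: gram_chart_def gram_chart_hom_def)
  ultimately show ?thesis
    by (auto simp: cm_traces_def Let_def traceless_gram_pair)
qed

definition gram_point :: "(nat \<Rightarrow> complex) \<Rightarrow> nat \<Rightarrow> complex" where
  "gram_point x i = (if i \<in> {3..6} then gram_coord x i / gram_det x else x i)"

lemma gram_chart_gram_point:
  assumes rel: "satisfies_relations x" and g: "gram_det x \<noteq> 0"
  shows "gram_chart (gram_point x) i = x i"
proof -
  have "gram_scale (gram_point x) (gram_det x) = gram_coord x"
    using g by (auto simp: gram_scale_def gram_point_def gram_coord_def)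
  \<comment> \<open>For the zero ideal of the complex numbers the congruence is an equation.\<close>
  moreover have "gram_det x ^ gram_chart_degree i * x i - gram_chart_hom (gram_coord x) i \<in> {0}"
    using rel by (intro gram_chart_hom_gram_coord) (auto simp: ring_ideal_def satisfies_relations_def)
  ultimately have "gram_det x ^ gram_chart_degree i * x i
      = gram_det x ^ gram_chart_degree i * gram_chart (gram_point x) i"
    by (simp flip: gram_chart_hom_scale)
  with g show ?thesis by simp
qed

lemma matrix_inverse_3:
  assumes "det (G::mat3) \<noteq> 0"
  obtains H where "G ** H = mat 1" "H ** G = mat 1"
  using assms invertible_det_nz[of G] unfolding invertible_def by blast

lemma gram_normal_form:
  assumes z: "z \<in> CM_bar" and g: "gram_det (cm_traces z) \<noteq> 0"
  shows "\<exists>g. invertible g \<and> conj_pair g z = gram_pair (gram_point (cm_traces z))"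
proof -
  define A where "A = traceless (fst z)"
  define B where "B = traceless (snd z)"
  obtain v w where "cm_pair A B v w"
    using z unfolding A_def B_def by (rule CM_bar_cm_pair)
  then interpret cm_pair A B v w .
  define a where "a = cm_traces z"
  define y where "y = gram_point a"
  have a: "tr [A, A] = a 3" "tr [A, B] = a 4" "tr [B, B] = a 5" "tr [A, A, A] = a 6"
    "tr [A, A, B] = a 7" "tr [A, B, B] = a 8" "tr [B, B, B] = a 9"
    by (simp_all add: a_def cm_traces_def A_def B_def Let_def)
  have chart: "gram_chart y i = a i" for i
    unfolding y_def a_def
    by (rule gram_chart_gram_point[OF satisfies_relations_cm_traces[OF z] g])
  define M where "M = (\<lambda>i::3. if i = 1 then mat 1 else if i = 2 then A else B)"
  have M: "M 1 = mat 1" "M 2 = A" "M 3 = B" by (simp_all add: M_def)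
  define G where "G = gram_matrix a"
  note words = tr_E tr_E_words
  note words = words[unfolded word_trace_def, simplified, unfolded E_def]
  note a_words = a[unfolded word_trace_def, simplified]
  have "det G = 3 * gram_det a"
    by (simp add: G_def gram_matrix_def det_3 gram_det_def algebra_simps power2_eq_square)
  with g have "det G \<noteq> 0" by (simp add: a_def)
  then obtain H where H: "G ** H = mat 1" "H ** G = mat 1" by (rule matrix_inverse_3)
  have "G $ i $ j = trace (outer v w ** (M i ** M j))" for i j
  proof -
    have "\<forall>i j. G $ i $ j = trace (outer v w ** (M i ** M j))"
      unfolding forall_3 M by (simp add: words a_words G_def gram_matrix_def)
    then show ?thesis by blast
  qed
  from frame_conjugation[OF this H] obtain g where g: "invertible g"
    and conj: "\<And>K K'. (\<And>i j. (G ** K') $ i $ j = trace (outer v w ** (M i ** K ** M j)))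
      \<Longrightarrow> g ** K ** matrix_inv g = K'" by blast
  \<comment> \<open>Every trace \<open>a i\<close> is rewritten as \<open>gram_chart y i\<close>,
    which encodes the relations, so that both sides become polynomials in \<open>y\<close>.\<close>
  have "\<forall>i j. (G ** gram_A y) $ i $ j = trace (outer v w ** (M i ** A ** M j))"
    unfolding forall_3 M
    by (simp add: words a_words mult_nth_3 G_def gram_matrix_def gram_A_def flip: chart matrix_mul_assoc)
       (simp add: gram_chart_simps algebra_simps power2_eq_square)
  then have 1: "g ** A ** matrix_inv g = gram_A y" by (intro conj) blast
  have "\<forall>i j. (G ** gram_B y) $ i $ j = trace (outer v w ** (M i ** B ** M j))"
    unfolding forall_3 M
    by (simp add: words a_words mult_nth_3 G_def gram_matrix_def gram_B_def flip: chart matrix_mul_assoc)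
       (simp add: gram_chart_simps algebra_simps power2_eq_square)
  then have 2: "g ** B ** matrix_inv g = gram_B y" by (intro conj) blast
  have "conj_pair g z = gram_pair y"
    using conj_pair_normal_form[OF g 1[unfolded A_def] 2[unfolded B_def]]
    by (simp add: gram_pair_def y_def gram_point_def a_def cm_traces_def)
  with g show ?thesis unfolding y_def a_def by blast
qed


subsection \<open>Normal form on the discriminant chart\<close>

text \<open>Here the frame is \<open>(v, Av, A\<^sup>2 v)\<close>, in which \<open>A\<close> is a companion matrix. \<open>disc_gram\<close> has
  the entries \<open>w A\<^bsup>i+j\<^esup> v = Tr A\<^bsup>i+j\<^esup>\<close>, and \<open>disc_moments\<close> the entries
  \<open>w A\<^sup>i B A\<^sup>j v\<close>.\<close>

definition disc_A :: "(nat \<Rightarrow> complex) \<Rightarrow> mat3" where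
  "disc_A y = vector [vector [0, 0, y 6 / 3], vector [1, 0, y 3 / 2], vector [0, 1, 0]]"

definition disc_gram :: "(nat \<Rightarrow> complex) \<Rightarrow> mat3" where
  "disc_gram y = vector [vector [3, 0, y 3], vector [0, y 3, y 6], vector [y 3, y 6, y 3^2 / 2]]"

definition disc_moments :: "(nat \<Rightarrow> complex) \<Rightarrow> mat3" where
  "disc_moments y = vector [vector [0, y 4 - 3, y 7],
     vector [y 4 + 3, y 7, (y 3 * y 4 + y 3) / 2],
     vector [y 7, (y 3 * y 4 - y 3) / 2, y 3 * y 7 / 2 + y 4 * y 6 / 3]]"

definition disc_adjugate :: "(nat \<Rightarrow> complex) \<Rightarrow> mat3" where
  "disc_adjugate y = vector [vector [y 3^3 / 2 - y 6^2, y 3 * y 6, - (y 3^2)],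
     vector [y 3 * y 6, y 3^2 / 2, - 3 * y 6], vector [- (y 3^2), - 3 * y 6, 3 * y 3]]"

text \<open>The inverse Gram matrix times the moments, the inverse being the adjugate over the
  determinant \<open>- disc_poly y / 2\<close>. Its entries are thus polynomials in \<open>y\<close>
  over \<open>disc_poly y\<close>, and they read only the coordinates 3, 4, 6 and 7.\<close>

definition disc_B :: "(nat \<Rightarrow> complex) \<Rightarrow> mat3" where
  "disc_B y = smat (- 2 / disc_poly y) (disc_adjugate y ** disc_moments y)"

definition disc_pair :: "(nat \<Rightarrow> complex) \<Rightarrow> matrix_pair" where
  "disc_pair y = (disc_A y + mat (y 1 / 3), disc_B y + mat (y 2 / 3))"

lemma smat_smat: "smat c (smat d M) = smat (c * d) M"
  by (simp add: matrix_eq_3)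

lemma smat_1: "smat 1 M = M"
  by (simp add: matrix_eq_3)

lemma disc_gram_adjugate: "disc_gram y ** disc_adjugate y = smat (- disc_poly y / 2) (mat 1)"
  unfolding matrix_eq_3
  by (simp add: forall_3 mult_nth_3 mat_nth_3 disc_adjugate_def disc_gram_def disc_poly_def
      field_simps power2_eq_square power3_eq_cube)

lemma disc_gram_B: "disc_poly y \<noteq> 0 \<Longrightarrow> disc_gram y ** disc_B y = disc_moments y"
  by (simp add: disc_B_def smat_mult matrix_mul_assoc disc_gram_adjugate smat_smat smat_1)

lemma det_disc_gram: "det (disc_gram y) = - disc_poly y / 2"
  by (simp add: disc_gram_def det_3 disc_poly_def field_simps power2_eq_square power3_eq_cube)

text \<open>\<open>disc_gram y\<close> is a Hankel matrix of power sums, for which the companion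
  matrix is self-adjoint.\<close>

lemma disc_gram_A: "disc_gram y ** disc_A y = transpose (disc_A y) ** disc_gram y"
  unfolding matrix_eq_3
  by (simp add: forall_3 mult_nth_3 transpose_def disc_A_def disc_gram_def field_simps power2_eq_square)

text \<open>The commutator equation multiplied by the Gram matrix, in which form it has no
  denominators; \<open>disc_bracket\<close> cancels the Gram matrix again.\<close>

lemma disc_moments_bracket:
  "transpose (disc_A y) ** disc_moments y - disc_moments y ** disc_A y + disc_gram y
    = disc_gram y ** outer (vector [1, 0, 0]) (vector [3, 0, y 3])"
  unfolding matrix_eq_3
  by (simp add: forall_3 mult_nth_3 transpose_def disc_A_def disc_gram_def disc_moments_def
      field_simps power2_eq_square)

lemma trace_disc: "trace (disc_A y) = 0" "trace (disc_B y) = 0"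
proof -
  show "trace (disc_A y) = 0" unfolding trace_3 by (simp add: disc_A_def)
  show "trace (disc_B y) = 0" 
    by (simp add: disc_B_def trace_smat)
      (simp add: trace_3 mult_nth_3 disc_adjugate_def disc_moments_def field_simps power2_eq_square power3_eq_cube)
qed

lemma traceless_disc_pair:
  "traceless (fst (disc_pair y)) = disc_A y" "traceless (snd (disc_pair y)) = disc_B y"
  by (simp_all add: disc_pair_def traceless_add_mat' trace_disc)

lemma disc_bracket:
  assumes y: "disc_poly y \<noteq> 0"
  shows "disc_A y ** disc_B y - disc_B y ** disc_A y + mat 1
    = outer (vector [1, 0, 0]) (vector [3, 0, y 3])" (is "?C = ?E")
proof -
  from y have "det (disc_gram y) \<noteq> 0" by (simp add: det_disc_gram)
  then obtain H where H: "H ** disc_gram y = mat 1" by (rule matrix_inverse_3)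
  have "disc_gram y ** ?C = disc_gram y ** ?E"
    using y by (simp add: matrix_add_ldistrib matrix_sub_ldistrib matrix_mul_assoc disc_gram_A disc_gram_B
      flip: disc_moments_bracket) (simp add: disc_gram_B flip: matrix_mul_assoc)
  then have "(H ** disc_gram y) ** ?C = (H ** disc_gram y) ** ?E"
    by (simp only: flip: matrix_mul_assoc)
  then show ?thesis using H by simp
qed

lemma disc_pair_CM_bar: "disc_poly y \<noteq> 0 \<Longrightarrow> disc_pair y \<in> CM_bar"
  by (rule CM_bar_if_traceless) (simp add: traceless_disc_pair disc_bracket)

context cm_pair
begin

text \<open>\<open>A\<close> commutes with its powers, so the bracket in \<open>E\<close>
  contributes trace 0; the power sums that remain follow from Cayley-Hamilton.\<close>

lemma tr_E_powers:
  "tr [E, A, A, A, A] = tr [A, A]^2 / 2"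
  "tr [E, A, A, A, A, A] = 5 / 6 * tr [A, A] * tr [A, A, A]"
proof -
  have "tr [E, A, A, A, A] = tr [A, A, A, A]"
    unfolding E_expand
    using word_trace_rotate[of "[B]" "[A, A, A, A, A]"] word_trace_rotate[of "[A, B]" "[A, A, A, A]"]
    by simp
  then show "tr [E, A, A, A, A] = tr [A, A]^2 / 2"
    by (simp add: tr_cube[of "[A]"] power2_eq_square)
  have "tr [E, A, A, A, A, A] = tr [A, A, A, A, A]"
    unfolding E_expand
    using word_trace_rotate[of "[B]" "[A, A, A, A, A, A]"] word_trace_rotate[of "[A, B]" "[A, A, A, A, A]"]
    by simp
  then show "tr [E, A, A, A, A, A] = 5 / 6 * tr [A, A] * tr [A, A, A]"
    by (simp add: tr_cube[of "[A, A]"])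
qed

text \<open>The remaining entries of \<open>disc_moments\<close>. The two of degree four in
  \<open>A\<close> and \<open>B\<close> differ because \<open>tr_AABAAB\<close> distinguishes the
  two cyclic orders.\<close>

lemma tr_E_moments:
  "tr [E, A, B, A, A] = (tr [A, A] * tr [A, B] + tr [A, A]) / 2"
  "tr [E, A, A, B, A] = (tr [A, A] * tr [A, B] - tr [A, A]) / 2"
  "tr [E, A, A, B, A, A] = tr [A, A] * tr [A, A, B] / 2 + tr [A, B] * tr [A, A, A] / 3"
proof -
  have "tr [A, A, A, B] = tr [A, A] * tr [A, B] / 2"
    by (simp add: tr_cube[of "[B]"])
  then show "tr [E, A, B, A, A] = (tr [A, A] * tr [A, B] + tr [A, A]) / 2"
    "tr [E, A, A, B, A] = (tr [A, A] * tr [A, B] - tr [A, A]) / 2"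
    unfolding E_expand by (simp_all add: tr_rotations tr_AABAAB field_simps)
  have "tr [E, A, A, B, A, A] = tr [A, A, A, A, B]"
    unfolding E_expand
    using word_trace_rotate[of "[A, B, A, A]" "[B, A, A]"] word_trace_rotate[of "[A, A, B]" "[A, A]"]
    by simp
  then show "tr [E, A, A, B, A, A] = tr [A, A] * tr [A, A, B] / 2 + tr [A, B] * tr [A, A, A] / 3"
    by (simp add: tr_cube[of "[A, B]"])
qed

end

lemma cm_traces_disc_pair:
  assumes y: "disc_poly y \<noteq> 0" and i: "i \<in> {1, 2, 3, 4, 6, 7}"
  shows "cm_traces (disc_pair y) i = y i"
proof -
  interpret cm_pair "disc_A y" "disc_B y" "vector [1, 0, 0]" "vector [3, 0, y 3]"
    by unfold_locales (simp_all add: trace_disc disc_bracket[OF y])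
  have "trace (fst (disc_pair y)) = y 1" "trace (snd (disc_pair y)) = y 2"
    by (simp_all add: disc_pair_def trace_add trace_disc trace_mat_3)
  moreover have "tr [disc_A y, disc_A y] = y 3" "tr [disc_A y, disc_A y, disc_A y] = y 6"
    by (simp_all add: word_trace_def trace_3 mult_nth_3 disc_A_def)
  \<comment> \<open>Writing the moments as \<open>disc_gram y ** disc_B y\<close> keeps
    \<open>disc_B y\<close> opaque, so no denominator has to be cleared.\<close>
  moreover have "tr [E, disc_A y, disc_B y] = disc_moments y $ 2 $ 1"
    "tr [E, disc_A y, disc_A y, disc_B y] = disc_moments y $ 3 $ 1"
    unfolding disc_gram_B[OF y, symmetric]
    by (simp_all add: word_trace_def E_def trace_3 mult_nth_3 disc_A_def disc_gram_def field_simps power2_eq_square)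
  then have "tr [disc_A y, disc_B y] = y 4" "tr [disc_A y, disc_A y, disc_B y] = y 7"
    by (simp_all add: tr_E_words disc_moments_def)
  ultimately show ?thesis
    using i by (auto simp: cm_traces_def Let_def traceless_disc_pair)
qed

lemma disc_normal_form:
  assumes z: "z \<in> CM_bar" and h: "disc_poly (cm_traces z) \<noteq> 0"
  shows "\<exists>g. invertible g \<and> conj_pair g z = disc_pair (cm_traces z)"
proof -
  define A where "A = traceless (fst z)"
  define B where "B = traceless (snd z)"
  obtain v w where "cm_pair A B v w"
    using z unfolding A_def B_def by (rule CM_bar_cm_pair)
  then interpret cm_pair A B v w .
  define a where "a = cm_traces z"
  have a: "tr [A, A] = a 3" "tr [A, B] = a 4" "tr [A, A, A] = a 6" "tr [A, A, B] = a 7"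
    by (simp_all add: a_def cm_traces_def A_def B_def Let_def)
  define M where "M = (\<lambda>i::3. if i = 1 then mat 1 else if i = 2 then A else A ** A)"
  have M: "M 1 = mat 1" "M 2 = A" "M 3 = A ** A" by (simp_all add: M_def)
  define G where "G = disc_gram a"
  note words = tr_E tr_E_words tr_E_powers tr_E_moments
  note words = words[unfolded a, unfolded word_trace_def, simplified, unfolded E_def]
  note a_words = a[unfolded word_trace_def, simplified]
  from h have "det G \<noteq> 0" by (simp add: a_def G_def det_disc_gram)
  then obtain H where H: "G ** H = mat 1" "H ** G = mat 1" by (rule matrix_inverse_3)
  have "G $ i $ j = trace (outer v w ** (M i ** M j))" for i j
  proof -
    have "\<forall>i j. G $ i $ j = trace (outer v w ** (M i ** M j))"
      unfolding forall_3 M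
      by (simp add: words a_words G_def disc_gram_def flip: matrix_mul_assoc)
    then show ?thesis by blast
  qed
  from frame_conjugation[OF this H] obtain g where g: "invertible g"
    and conj: "\<And>K K'. (\<And>i j. (G ** K') $ i $ j = trace (outer v w ** (M i ** K ** M j)))
      \<Longrightarrow> g ** K ** matrix_inv g = K'" by blast
  have "\<forall>i j. (G ** disc_A a) $ i $ j = trace (outer v w ** (M i ** A ** M j))"
    unfolding forall_3 M
    by (simp add: words a_words mult_nth_3 G_def disc_gram_def disc_A_def power2_eq_square
        flip: matrix_mul_assoc)
  then have 1: "g ** A ** matrix_inv g = disc_A a" by (intro conj) blast
  have "G ** disc_B a = disc_moments a"
    using h by (simp add: G_def disc_gram_B a_def)
  moreover have "\<forall>i j. disc_moments a $ i $ j = trace (outer v w ** (M i ** B ** M j))"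
    unfolding forall_3 M
    by (simp add: words a_words disc_moments_def flip: matrix_mul_assoc)
  ultimately have 2: "g ** B ** matrix_inv g = disc_B a" by (intro conj) simp
  have "conj_pair g z = disc_pair a"
    using conj_pair_normal_form[OF g 1[unfolded A_def] 2[unfolded B_def]]
    by (simp add: disc_pair_def a_def cm_traces_def)
  with g show ?thesis unfolding a_def by blast
qed

section \<open>Invariant functions\<close>

definition poly_fun :: "'s set \<Rightarrow> ('s \<Rightarrow> 'v \<Rightarrow> complex) \<Rightarrow> ('s \<Rightarrow> complex) \<Rightarrow> bool" where
  "poly_fun S x f \<longleftrightarrow> (\<exists>p. \<forall>s\<in>S. f s = cpoly_eval (x s) p)"

lemma poly_funI: "(\<And>s. s \<in> S \<Longrightarrow> f s = cpoly_eval (x s) p) \<Longrightarrow> poly_fun S x f"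
  unfolding poly_fun_def by blast

lemma poly_fun_const: "poly_fun S x (\<lambda>s. c)"
  by (rule poly_funI[of _ _ _ "cconst c"]) simp

lemma poly_fun_var: "poly_fun S x (\<lambda>s. x s i)"
  by (rule poly_funI[of _ _ _ "cvar i"]) simp

lemma poly_fun_add:
  assumes "poly_fun S x f" "poly_fun S x g" shows "poly_fun S x (\<lambda>s. f s + g s)"
proof -
  obtain p q where "\<forall>s\<in>S. f s = cpoly_eval (x s) p" "\<forall>s\<in>S. g s = cpoly_eval (x s) q"
    using assms unfolding poly_fun_def by blast
  then show ?thesis by (intro poly_funI[of _ _ _ "p + q"]) simp
qed

lemma poly_fun_mult:
  assumes "poly_fun S x f" "poly_fun S x g" shows "poly_fun S x (\<lambda>s. f s * g s)"
proof -
  obtain p q where "\<forall>s\<in>S. f s = cpoly_eval (x s) p" "\<forall>s\<in>S. g s = cpoly_eval (x s) q"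
    using assms unfolding poly_fun_def by blast
  then show ?thesis by (intro poly_funI[of _ _ _ "p * q"]) simp
qed

lemma poly_fun_uminus: "poly_fun S x f \<Longrightarrow> poly_fun S x (\<lambda>s. - f s)"
  using poly_fun_mult[OF poly_fun_const[of _ _ "- 1"]] by fastforce

lemma poly_fun_diff:
  assumes "poly_fun S x f" "poly_fun S x g" shows "poly_fun S x (\<lambda>s. f s - g s)"
  using poly_fun_add[OF assms(1) poly_fun_uminus[OF assms(2)]] by simp

lemma poly_fun_power: "poly_fun S x f \<Longrightarrow> poly_fun S x (\<lambda>s. f s ^ n)"
  by (induction n) (simp_all add: poly_fun_const poly_fun_mult)

lemma poly_fun_divide: "poly_fun S x f \<Longrightarrow> poly_fun S x (\<lambda>s. f s / c)"
  using poly_fun_mult[OF _ poly_fun_const[of _ _ "1 / c"]] by fastforce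

lemmas poly_fun_intros =
  poly_fun_const poly_fun_var poly_fun_add poly_fun_mult poly_fun_uminus poly_fun_diff
  poly_fun_power poly_fun_divide

lemma poly_fun_cong: "poly_fun S x f \<Longrightarrow> (\<And>s. s \<in> S \<Longrightarrow> f s = g s) \<Longrightarrow> poly_fun S x g"
  unfolding poly_fun_def by simp

lemma poly_fun_compose:
  assumes "poly_fun T y f" "\<And>s. s \<in> S \<Longrightarrow> h s \<in> T" "\<And>i. poly_fun S x (\<lambda>s. y (h s) i)"
  shows "poly_fun S x (\<lambda>s. f (h s))"
proof -
  obtain p where p: "\<forall>s\<in>T. f s = cpoly_eval (y s) p"
    using assms(1) unfolding poly_fun_def by blast
  obtain q where q: "\<And>i s. s \<in> S \<Longrightarrow> y (h s) i = cpoly_eval (x s) (q i)"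
    using assms(3) unfolding poly_fun_def by metis
  show ?thesis
    by (rule poly_funI[of _ _ _ "psubst q p"]) (use assms(2) in \<open>simp add: p cpoly_eval_psubst q[symmetric]\<close>)
qed

lemma clear_denominators:
  assumes d: "poly_fun S x d" and e: "\<And>i. poly_fun S x (\<lambda>s. d s * e s i)"
    and f: "poly_fun S e f"
  shows "\<exists>N. poly_fun S x (\<lambda>s. d s ^ N * f s)"
proof -
  obtain p where p: "\<forall>s\<in>S. f s = cpoly_eval (e s) p"
    using f unfolding poly_fun_def by blast
  have "\<exists>N. poly_fun S x (\<lambda>s. d s ^ N * cpoly_eval (e s) p)"
  proof (induction p rule: cpoly_induct[OF subset_UNIV])
    case (1 c)
    show ?case by (rule exI[of _ 0]) (simp add: poly_fun_const)
  next
    case (2 i)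
    show ?case by (rule exI[of _ 1]) (simp add: e)
  next
    case (3 p q)
    then obtain M N where p: "poly_fun S x (\<lambda>s. d s ^ M * cpoly_eval (e s) p)"
      and q: "poly_fun S x (\<lambda>s. d s ^ N * cpoly_eval (e s) q)" by blast
    have "poly_fun S x (\<lambda>s. d s ^ N * (d s ^ M * cpoly_eval (e s) p)
        + d s ^ M * (d s ^ N * cpoly_eval (e s) q))"
      by (rule poly_fun_add[OF poly_fun_mult[OF poly_fun_power[OF d] p] poly_fun_mult[OF poly_fun_power[OF d] q]])
    then show ?case
      by (intro exI[of _ "M + N"]) (simp add: algebra_simps power_add)
  next
    case (4 p q)
    then obtain M N where "poly_fun S x (\<lambda>s. d s ^ M * cpoly_eval (e s) p)"
      "poly_fun S x (\<lambda>s. d s ^ N * cpoly_eval (e s) q)" by blast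
    then have "poly_fun S x (\<lambda>s. (d s ^ M * cpoly_eval (e s) p) * (d s ^ N * cpoly_eval (e s) q))"
      by (rule poly_fun_mult)
    then show ?case
      by (intro exI[of _ "M + N"]) (simp add: algebra_simps power_add)
  qed
  then obtain N where "poly_fun S x (\<lambda>s. d s ^ N * cpoly_eval (e s) p)" by blast
  then have "poly_fun S x (\<lambda>s. d s ^ N * f s)"
    by (rule poly_fun_cong) (simp add: p)
  then show ?thesis by blast
qed

lemma poly_fun_entry:
  assumes "\<And>i j. poly_fun S x (\<lambda>s. fst (h s) $ i $ j)" "\<And>i j. poly_fun S x (\<lambda>s. snd (h s) $ i $ j)"
  shows "poly_fun S x (\<lambda>s. entry (h s) k)"
  by (cases k) (auto simp: entry_def assms)

lemma poly_fun_entry_fst: "poly_fun S entry (\<lambda>z. fst z $ i $ j)"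
  using poly_fun_var[of S entry "Inl (i, j)"] by (simp add: entry_def)

lemma poly_fun_entry_snd: "poly_fun S entry (\<lambda>z. snd z $ i $ j)"
  using poly_fun_var[of S entry "Inr (i, j)"] by (simp add: entry_def)

definition invariant_fun :: "(matrix_pair \<Rightarrow> complex) \<Rightarrow> bool" where
  "invariant_fun f \<longleftrightarrow> poly_fun CM_bar entry f \<and>
     (\<forall>g. invertible g \<longrightarrow> (\<forall>z\<in>CM_bar. f (conj_pair g z) = f z))"

text \<open>By invariance \<open>f z = f (P z)\<close>, and the entries of \<open>P z\<close> are
  polynomials in coordinates \<open>e z\<close> that become polynomial in \<open>x z\<close> after
  multiplication by \<open>d z\<close>.\<close>

lemma invariant_fun_normal_form:
  assumes f: "invariant_fun f" and d: "poly_fun CM_bar x d"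
    and S: "S = {z \<in> CM_bar. d z \<noteq> 0}"
    and P: "\<And>z. z \<in> S \<Longrightarrow> P z \<in> CM_bar \<and> (\<exists>g. invertible g \<and> conj_pair g z = P z)"
    and entries: "\<And>k. poly_fun S e (\<lambda>z. entry (P z) k)"
    and e: "\<And>i. poly_fun S x (\<lambda>z. d z * e z i)"
  shows "\<exists>N. poly_fun CM_bar x (\<lambda>z. d z ^ N * f z)"
proof -
  have fp: "poly_fun CM_bar entry f" and inv: "\<And>g z. invertible g \<Longrightarrow> z \<in> CM_bar \<Longrightarrow> f (conj_pair g z) = f z"
    using f by (auto simp: invariant_fun_def)
  have "poly_fun S e (\<lambda>z. f (P z))"
    by (rule poly_fun_compose[OF fp _ entries]) (use P in blast)
  then have "poly_fun S e f"
    by (rule poly_fun_cong) (use P inv S in \<open>metis (no_types, lifting) mem_Collect_eq\<close>)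
  moreover have "poly_fun S x d" using d S by (auto simp: poly_fun_def)
  ultimately obtain N where "poly_fun S x (\<lambda>z. d z ^ N * f z)"
    using clear_denominators[of S x d e f] e by blast
  then obtain p where p: "\<And>z. z \<in> S \<Longrightarrow> d z ^ N * f z = cpoly_eval (x z) p"
    unfolding poly_fun_def by blast
  obtain q where q: "\<And>z. z \<in> CM_bar \<Longrightarrow> d z = cpoly_eval (x z) q"
    using d unfolding poly_fun_def by blast
  \<comment> \<open>One additional factor \<open>d z\<close> makes both sides 0 where
    \<open>d z = 0\<close>, so the identity extends from \<open>S\<close> to all of
    \<open>CM_bar\<close>.\<close>
  have "poly_fun CM_bar x (\<lambda>z. d z ^ Suc N * f z)"
  proof (rule poly_funI[of _ _ _ "q * p"])
    fix z assume z: "z \<in> CM_bar"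
    show "d z ^ Suc N * f z = cpoly_eval (x z) (q * p)"
      by (cases "d z = 0") (use p[of z] q[OF z] z S in \<open>auto simp: mult.assoc\<close>)
  qed
  then show ?thesis by blast
qed

lemma poly_fun_gram_det: "poly_fun S cm_traces (\<lambda>z. gram_det (cm_traces z))"
  unfolding gram_det_def by (intro poly_fun_intros)

lemma poly_fun_disc_poly: "poly_fun S cm_traces (\<lambda>z. disc_poly (cm_traces z))"
  unfolding disc_poly_def by (intro poly_fun_intros)

lemma invariant_fun_gram_chart:
  assumes f: "invariant_fun f"
  shows "\<exists>N. poly_fun CM_bar cm_traces (\<lambda>z. gram_det (cm_traces z) ^ N * f z)"
proof -
  define S where "S = {z \<in> CM_bar. gram_det (cm_traces z) \<noteq> 0}"
  define e where "e z = gram_point (cm_traces z)" for z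
  have e_i: "poly_fun S e (\<lambda>z. e z i)" for i
    by (rule poly_fun_var)
  have "poly_fun S e (\<lambda>z. entry (gram_pair (e z)) k)" for k
  proof (rule poly_fun_entry)
    have "\<forall>i j. poly_fun S e (\<lambda>z. fst (gram_pair (e z)) $ i $ j)"
      unfolding forall_3 gram_pair_def gram_A_def
      by (simp add: gram_chart_simps mat_nth_3) (intro conjI poly_fun_intros e_i)
    then show "poly_fun S e (\<lambda>z. fst (gram_pair (e z)) $ i $ j)" for i j by blast
    have "\<forall>i j. poly_fun S e (\<lambda>z. snd (gram_pair (e z)) $ i $ j)"
      unfolding forall_3 gram_pair_def gram_B_def
      by (simp add: gram_chart_simps mat_nth_3) (intro conjI poly_fun_intros e_i)
    then show "poly_fun S e (\<lambda>z. snd (gram_pair (e z)) $ i $ j)" for i j by blast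
  qed
  moreover have "poly_fun S cm_traces (\<lambda>z. gram_det (cm_traces z) * e z i)" for i
  proof (cases "i \<in> {3..6}")
    case True
    then have "i \<in> {3, 4, 5, 6}" by auto
    then have "poly_fun S cm_traces (\<lambda>z. gram_coord (cm_traces z) i)"
      by (elim insertE emptyE; simp add: gram_coord_def; intro poly_fun_intros)
    then show ?thesis
      by (rule poly_fun_cong) (use True in \<open>simp add: e_def gram_point_def S_def\<close>)
  next
    case False
    have "poly_fun S cm_traces (\<lambda>z. gram_det (cm_traces z) * cm_traces z i)"
      by (intro poly_fun_mult poly_fun_gram_det poly_fun_var)
    then show ?thesis
      by (rule poly_fun_cong) (use False in \<open>auto simp: e_def gram_point_def\<close>)
  qed
  moreover have "gram_pair (e z) \<in> CM_bar \<and> (\<exists>g. invertible g \<and> conj_pair g z = gram_pair (e z))"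
    if "z \<in> S" for z
    using that gram_normal_form[of z] gram_pair_CM_bar unfolding e_def S_def by blast
  ultimately show ?thesis
    by (intro invariant_fun_normal_form[OF f poly_fun_gram_det S_def])
qed

lemma invariant_fun_disc_chart:
  assumes f: "invariant_fun f"
  shows "\<exists>N. poly_fun CM_bar cm_traces (\<lambda>z. disc_poly (cm_traces z) ^ N * f z)"
proof -
  define S where "S = {z \<in> CM_bar. disc_poly (cm_traces z) \<noteq> 0}"
  \<comment> \<open>Slot 8 is not read by \<open>disc_pair\<close>; it carries the inverse
    discriminant, so that the entries of the normal form are polynomials in
    \<open>e z\<close>.\<close>
  define e where "e z = (cm_traces z)(8 := 1 / disc_poly (cm_traces z))" for z
  define P where "P z = disc_pair (cm_traces z)" for z
  have e_i: "poly_fun S e (\<lambda>z. cm_traces z i)" if "i \<noteq> 8" for i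
    using poly_fun_var[of S e i] that by (simp add: e_def)
  have e_8: "poly_fun S e (\<lambda>z. c / disc_poly (cm_traces z))" for c
    using poly_fun_mult[OF poly_fun_const[of _ _ c] poly_fun_var[of S e 8]] by (simp add: e_def)
  have "poly_fun S e (\<lambda>z. entry (P z) k)" for k
  proof (rule poly_fun_entry)
    have "\<forall>i j. poly_fun S e (\<lambda>z. fst (P z) $ i $ j)"
      unfolding forall_3 P_def disc_pair_def disc_A_def
      by (simp add: mat_nth_3) (intro conjI poly_fun_intros e_i; simp)
    then show "poly_fun S e (\<lambda>z. fst (P z) $ i $ j)" for i j by blast
    have adj: "\<forall>i j. poly_fun S e (\<lambda>z. disc_adjugate (cm_traces z) $ i $ j)"
      unfolding forall_3 disc_adjugate_def by simp (intro conjI poly_fun_intros e_i; simp)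
    have mom: "\<forall>i j. poly_fun S e (\<lambda>z. disc_moments (cm_traces z) $ i $ j)"
      unfolding forall_3 disc_moments_def by simp (intro conjI poly_fun_intros e_i; simp)
    note adj = adj[rule_format] and mom = mom[rule_format]
    fix i j
    have "poly_fun S e (\<lambda>z. (- 2 / disc_poly (cm_traces z)) *
        (disc_adjugate (cm_traces z) ** disc_moments (cm_traces z)) $ i $ j
        + (if i = j then cm_traces z 2 / 3 else 0))"
      unfolding mult_nth_3
      by (cases "i = j"; simp only: if_True if_False simp_thms;
          intro poly_fun_add poly_fun_mult[OF e_8] poly_fun_mult[OF adj mom] poly_fun_const poly_fun_divide e_i; simp)
    then show "poly_fun S e (\<lambda>z. snd (P z) $ i $ j)"
      by (simp add: P_def disc_pair_def disc_B_def mat_nth_3)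
  qed
  moreover have "poly_fun S cm_traces (\<lambda>z. disc_poly (cm_traces z) * e z i)" for i
  proof (cases "i = 8")
    case True
    show ?thesis
      by (rule poly_fun_cong[OF poly_fun_const[of _ _ 1]]) (use True in \<open>simp add: e_def S_def\<close>)
  next
    case False
    have "poly_fun S cm_traces (\<lambda>z. disc_poly (cm_traces z) * cm_traces z i)"
      by (intro poly_fun_mult poly_fun_disc_poly poly_fun_var)
    then show ?thesis
      by (rule poly_fun_cong) (use False in \<open>auto simp: e_def\<close>)
  qed
  moreover have "P z \<in> CM_bar \<and> (\<exists>g. invertible g \<and> conj_pair g z = P z)"
    if "z \<in> S" for z
    using that disc_normal_form[of z] disc_pair_CM_bar unfolding P_def S_def by blast
  ultimately show ?thesis
    by (intro invariant_fun_normal_form[OF f poly_fun_disc_poly S_def])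
qed

lemma conj_shear_pair: "conj_pair g (shear_pair t z) = shear_pair t (conj_pair g z)"
  by (simp add: conj_pair_def shear_pair_def case_prod_beta matrix_add_ldistrib matrix_add_rdistrib smat_mult)

lemma invariant_fun_shear:
  assumes "invariant_fun f"
  shows "invariant_fun (\<lambda>z. f (shear_pair t z))"
  unfolding invariant_fun_def
proof (intro conjI allI impI ballI)
  show "poly_fun CM_bar entry (\<lambda>z. f (shear_pair t z))"
  proof (rule poly_fun_compose[where T = CM_bar and y = entry])
    show "poly_fun CM_bar entry f" using assms by (simp add: invariant_fun_def)
    fix k show "poly_fun CM_bar entry (\<lambda>z. entry (shear_pair t z) k)"
      by (rule poly_fun_entry; simp add: shear_pair_def;
          intro poly_fun_intros poly_fun_entry_fst poly_fun_entry_snd)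
  qed (rule shear_pair_CM_bar)
next
  fix g :: mat3 and z assume "invertible g" "z \<in> CM_bar"
  then show "f (shear_pair t (conj_pair g z)) = f (shear_pair t z)"
    using assms shear_pair_CM_bar[of z t] by (simp add: invariant_fun_def flip: conj_shear_pair)
qed

lemma shear_pair_shear_pair_neg: "shear_pair (- t) (shear_pair t z) = z"
  by (simp add: shear_pair_def prod_eq_iff matrix_eq_3)

text \<open>The argument of \<open>in_rel_idealI\<close> with other multipliers: those
  \<open>r\<close> whose values on the traces make \<open>r f\<close> a polynomial in the traces.
  Relations belong to them because they vanish on \<open>CM_bar\<close>.\<close>

lemma invariant_fun_is_polynomial_in_traces:
  assumes f: "invariant_fun f"
  shows "poly_fun CM_bar cm_traces f"
proof -
  define J where "J = {r. poly_fun CM_bar cm_traces (\<lambda>z. cpoly_eval (cm_traces z) r * f z)}"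
  have poly: "poly_fun CM_bar cm_traces (\<lambda>z. cpoly_eval (cm_traces z) r)" for r
    by (rule poly_funI) (rule refl)
  have J: "ring_ideal J"
    unfolding J_def ring_ideal_def
    using poly_fun_mult[OF poly]
    by (auto simp: distrib_right mult.assoc poly_fun_const intro: poly_fun_add)
  note rad = ring_ideal_radical[OF J]
  have rel: "r \<in> radical J" if "r \<in> rel_ideal" for r
  proof (rule radicalI[OF J])
    have "poly_fun CM_bar cm_traces (\<lambda>z. 0)" by (rule poly_fun_const)
    then have "poly_fun CM_bar cm_traces (\<lambda>z. cpoly_eval (cm_traces z) r * f z)"
      by (rule poly_fun_cong)
         (use cpoly_eval_rel_ideal[OF that satisfies_relations_cm_traces] in simp)
    then show "r \<in> J" by (simp add: J_def)
  qed
  have "1 \<in> radical J"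
  proof (rule ring_ideal_one[OF rad, of cvar])
    show "\<exists>r :: nat cpoly. r * of_nat n = 1" if "n > 0" for n
      using that by (rule cpoly_nat_invertible)
    show "gram_det cvar \<in> radical J"
      using invariant_fun_gram_chart[OF f] by (auto simp: radical_def J_def cpoly_eval_rel)
    fix t :: int
    define s :: complex where "s = of_int t"
    have s: "(of_int t :: nat cpoly) = cconst s"
      by (simp add: s_def)
    \<comment> \<open>The chart for \<open>A\<close> is applied to \<open>f\<close> composed with
      the shear by \<open>-s\<close>; evaluated at the sheared pair, this gives back
      \<open>f z\<close> with the discriminant of \<open>A + s B\<close>.\<close>
    obtain N p where p: "\<And>z. z \<in> CM_bar \<Longrightarrow>
        disc_poly (cm_traces z) ^ N * f (shear_pair (- s) z) = cpoly_eval (cm_traces z) p"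
      using invariant_fun_disc_chart[OF invariant_fun_shear[OF f, of "- s"]]
      unfolding poly_fun_def by blast
    have "poly_fun CM_bar cm_traces
        (\<lambda>z. cpoly_eval (cm_traces z) (disc_poly (shear (cconst s) cvar) ^ N) * f z)"
    proof (rule poly_funI)
      fix z assume z: "z \<in> CM_bar"
      have shear: "cm_traces (shear_pair s z) = shear s (cm_traces z)"
        by (rule ext) (rule cm_traces_shear)
      have "cpoly_eval (cm_traces z) (disc_poly (shear (cconst s) cvar) ^ N) * f z
          = disc_poly (cm_traces (shear_pair s z)) ^ N * f z"
        by (simp add: cpoly_eval_rel cpoly_eval_shear shear)
      also have "\<dots> = cpoly_eval (shear s (cm_traces z)) p"
        using p[OF shear_pair_CM_bar[OF z, of s]] by (simp add: shear_pair_shear_pair_neg shear)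
      also have "\<dots> = cpoly_eval (cm_traces z) (psubst (shear (cconst s) cvar) p)"
        by (simp add: cpoly_eval_psubst cpoly_eval_shear)
      finally show "cpoly_eval (cm_traces z) (disc_poly (shear (cconst s) cvar) ^ N) * f z
          = cpoly_eval (cm_traces z) (psubst (shear (cconst s) cvar) p)" .
    qed
    then show "disc_poly (shear (of_int t) cvar) \<in> radical J"
      unfolding s by (auto simp: radical_def J_def)
  qed (intro rel rel_in_rel_ideal)+
  then show ?thesis by (simp add: radical_def J_def)
qed


subsection \<open>Relations between the traces\<close>

text \<open>Coordinates outside \<open>{1..9}\<close> are left free, which matches
  \<open>rel_ideal\<close>, where those variables are unconstrained, and admits every
  \<open>gram_chart y\<close>.\<close>

definition cm_values :: "(nat \<Rightarrow> complex) set" where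
  "cm_values = {x. \<exists>z\<in>CM_bar. \<forall>i\<in>{1..9}. x i = cm_traces z i}"

lemma vanishing_in_rel_ideal:
  assumes vars: "cpoly_vars p \<subseteq> {1..9}"
    and p: "\<And>z. z \<in> CM_bar \<Longrightarrow> cpoly_eval (cm_traces z) p = 0"
  shows "p \<in> rel_ideal"
proof (rule in_rel_idealI[of cm_values])
  fix x assume "x \<in> cm_values"
  then obtain z where z: "z \<in> CM_bar" and x: "\<And>i. i \<in> {1..9} \<Longrightarrow> x i = cm_traces z i"
    by (auto simp: cm_values_def)
  show "satisfies_relations x"
    using satisfies_relations_cm_traces[OF z] by (simp add: satisfies_relations_def rel_defs x)
  show "shear t x \<in> cm_values" for t
  proof -
    have "shear t x i = cm_traces (shear_pair t z) i" if "i \<in> {1..9}" for i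
      using that by (simp add: cm_traces_shear) (simp add: shear_def x)
    then show ?thesis
      unfolding cm_values_def using shear_pair_CM_bar[OF z] by blast
  qed
  show "cpoly_eval x p = 0"
    using cpoly_eval_cong[OF vars x] p[OF z] by simp
next
  fix y :: "nat \<Rightarrow> complex"
  show "gram_chart y \<in> cm_values"
    unfolding cm_values_def
    by (intro CollectI bexI[of _ "gram_pair y"] ballI) (simp_all add: gram_pair_CM_bar cm_traces_gram_pair)
next
  fix y :: "nat \<Rightarrow> complex"
  assume y: "disc_poly y \<noteq> 0"
  define x where "x i = (if i \<in> {5, 8, 9} then cm_traces (disc_pair y) i else y i)" for i
  have "x i = cm_traces (disc_pair y) i" if "i \<in> {1..9}" for i
  proof (cases "i \<in> {5, 8, 9}")
    case False
    with that have "i \<in> {1, 2, 3, 4, 6, 7}" by auto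
    then show ?thesis using cm_traces_disc_pair[OF y] False by (simp add: x_def)
  qed (simp add: x_def)
  then have "x \<in> cm_values"
    unfolding cm_values_def using disc_pair_CM_bar[OF y] by blast
  then show "\<exists>x\<in>cm_values. \<forall>i\<in>- {5, 8, 9}. x i = y i"
    by (rule bexI[rotated]) (simp add: x_def)
qed


subsection \<open>Points separated by a single trace\<close>

text \<open>\<open>disc_pair x\<close> has the prescribed traces 1, 2, 3, 4, 6, 7. The identities
  eliminating 5, 8 and then 9 hold for its traces and for \<open>x\<close> alike, and force the
  others to agree.\<close>

lemma cm_traces_surj_disc:
  assumes rel: "satisfies_relations x" and h: "disc_poly x \<noteq> 0"
  obtains z where "z \<in> CM_bar" "\<And>i. i \<in> {1..9} \<Longrightarrow> cm_traces z i = x i"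
proof
  define a where "a = cm_traces (disc_pair x)"
  show z: "disc_pair x \<in> CM_bar" using h by (rule disc_pair_CM_bar)
  have a: "a 1 = x 1" "a 2 = x 2" "a 3 = x 3" "a 4 = x 4" "a 6 = x 6" "a 7 = x 7"
    unfolding a_def by (simp_all add: cm_traces_disc_pair[OF h])
  have h_a: "disc_poly a = disc_poly x" by (simp add: disc_poly_def a)
  have rel_a: "satisfies_relations a" unfolding a_def by (rule satisfies_relations_cm_traces[OF z])
  have "disc_poly x * a 5 = disc_poly x * x 5" "disc_poly x * a 8 = disc_poly x * x 8"
    using disc_identities(1,2)[of a] disc_identities(1,2)[of x] rel rel_a
    by (simp_all add: a h_a satisfies_relations_def)
  then have 5: "a 5 = x 5" and 8: "a 8 = x 8"
    using h by simp_all
  have "disc_poly x * a 9 = disc_poly x * x 9"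
    using disc_identities(3)[of a] disc_identities(3)[of x] rel rel_a
    by (simp add: a 5 8 h_a satisfies_relations_def)
  then have 9: "a 9 = x 9"
    using h by simp
  fix i :: nat assume "i \<in> {1..9}"
  then have "i \<in> {1, 2, 3, 4, 5, 6, 7, 8, 9}" by auto
  with a 5 8 9 show "cm_traces (disc_pair x) i = x i" by (auto simp flip: a_def)
qed

definition separated_by :: "nat \<Rightarrow> bool" where
  "separated_by i \<longleftrightarrow> (\<exists>z\<in>CM_bar. \<exists>z'\<in>CM_bar. cm_traces z i \<noteq> cm_traces z' i \<and>
     (\<forall>j\<in>{1..9} - {i}. cm_traces z j = cm_traces z' j))"

lemma separated_byI:
  assumes "satisfies_relations x" "disc_poly x \<noteq> 0" "satisfies_relations (x(i := c))"
    "disc_poly (x(i := c)) \<noteq> 0" "x i \<noteq> c" "i \<in> {1..9}"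
  shows "separated_by i"
proof -
  obtain z z' where z: "z \<in> CM_bar" "\<And>j. j \<in> {1..9} \<Longrightarrow> cm_traces z j = x j"
    and z': "z' \<in> CM_bar" "\<And>j. j \<in> {1..9} \<Longrightarrow> cm_traces z' j = (x(i := c)) j"
    using cm_traces_surj_disc[OF assms(1,2)] cm_traces_surj_disc[OF assms(3,4)] by metis
  show ?thesis
    unfolding separated_by_def
    by (rule bexI[OF _ z(1)], rule bexI[OF _ z'(1)]) (use z z' assms(5,6) in auto)
qed

lemma separated_by_swap:
  assumes "separated_by i" "i \<in> {3, 6, 7}"
  shows "separated_by (if i = 3 then 5 else if i = 6 then 9 else 8)" (is "separated_by ?j")
proof -
  obtain z z' where z: "z \<in> CM_bar" "z' \<in> CM_bar" "cm_traces z i \<noteq> cm_traces z' i"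
    "\<And>j. j \<in> {1..9} - {i} \<Longrightarrow> cm_traces z j = cm_traces z' j"
    using assms(1) unfolding separated_by_def by blast
  have "cm_traces (swap_pair z) ?j \<noteq> cm_traces (swap_pair z') ?j"
    using z(3) assms(2) by (auto simp: cm_traces_swap swap_def)
  moreover have "cm_traces (swap_pair z) k = cm_traces (swap_pair z') k" if "k \<in> {1..9} - {?j}" for k
    using that z(4) assms(2) by (auto simp: cm_traces_swap swap_def split: if_splits)
  ultimately show ?thesis
    unfolding separated_by_def using swap_pair_CM_bar z(1,2) by blast
qed

lemma separated_by_all:
  assumes "i \<in> {1..9}"
  shows "separated_by i"
proof -
  \<comment> \<open>With \<open>a 4 ^ 2 = 9\<close> and all but \<open>a 3\<close>,
    \<open>a 4\<close>, \<open>a 6\<close> zero, the relations hold for any \<open>a 3\<close> and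
    \<open>a 6\<close> and for both signs of \<open>a 4\<close>; indices 1 and 2 occur in no
    relation. At \<open>y\<close>, \<open>rel3\<close> reads \<open>9 * a 3 = 6 * a 7 ^ 2\<close>
    and leaves the sign of \<open>a 7\<close> open.\<close>
  define x :: "nat \<Rightarrow> complex" where "x = (\<lambda>i. if i = 4 then 3 else if i = 6 then 1 else 0)"
  define y :: "nat \<Rightarrow> complex" where "y = (\<lambda>i. if i = 3 then 2 / 3 else if i = 7 then 1 else 0)"
  note simps = satisfies_relations_def rel_defs disc_poly_def x_def y_def
  have 1: "separated_by 1" by (rule separated_byI[of x _ 1]) (simp_all add: simps)
  have 2: "separated_by 2" by (rule separated_byI[of x _ 1]) (simp_all add: simps)
  have 3: "separated_by 3" by (rule separated_byI[of x _ 1]) (simp_all add: simps)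
  have 4: "separated_by 4" by (rule separated_byI[of x _ "- 3"]) (simp_all add: simps)
  have 6: "separated_by 6" by (rule separated_byI[of x _ 2]) (simp_all add: simps)
  have 7: "separated_by 7" by (rule separated_byI[of y _ "- 1"]) (simp_all add: simps power2_eq_square)
  have "separated_by 5" "separated_by 9" "separated_by 8"
    using separated_by_swap[OF 3] separated_by_swap[OF 6] separated_by_swap[OF 7] by simp_all
  moreover have "i \<in> {1, 2, 3, 4, 5, 6, 7, 8, 9}" using assms by auto
  ultimately show ?thesis using 1 2 3 4 6 7 by blast
qed

section \<open>The coordinate ring\<close>

lemma poly_alg_simps [simp]:
  "carrier (poly_alg V) = {p. cpoly_vars p \<subseteq> V}" "mult (poly_alg V) = (*)" "one (poly_alg V) = 1"
  "zero (poly_alg V) = 0" "add (poly_alg V) = (+)" "smult (poly_alg V) = (\<lambda>c p. cconst c * p)"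
  by (simp_all add: poly_alg_def)

lemma cring_poly_alg: "cring (poly_alg V)"
proof (rule cringI)
  show "abelian_group (poly_alg V)"
  proof (rule abelian_groupI)
    fix p assume "p \<in> carrier (poly_alg V)"
    then show "\<exists>q\<in>carrier (poly_alg V). q \<oplus>\<^bsub>poly_alg V\<^esub> p = \<zero>\<^bsub>poly_alg V\<^esub>"
      by (intro bexI[of _ "- p"]) auto
  qed (auto simp: cpoly_vars_add add.assoc add.commute)
  show "comm_monoid (poly_alg V)"
    by (rule comm_monoidI) (auto simp: cpoly_vars_mult mult.assoc mult.commute)
qed (simp add: distrib_right)

lemma CM_coord_simps [simp]:
  "mult CM_coord = (\<lambda>f h. \<lambda>z\<in>CM_bar. f z * h z)" "one CM_coord = (\<lambda>z\<in>CM_bar. 1)"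
  "zero CM_coord = (\<lambda>z\<in>CM_bar. 0)" "add CM_coord = (\<lambda>f h. \<lambda>z\<in>CM_bar. f z + h z)"
  "smult CM_coord = (\<lambda>c f. \<lambda>z\<in>CM_bar. c * f z)"
  by (simp_all add: CM_coord_def)

section \<open>The traces as invariant polynomial functions\<close>

lemma conj_pair_CM_bar:
  assumes g: "invertible g" and z: "z \<in> CM_bar"
  shows "conj_pair g z \<in> CM_bar"
proof -
  obtain h where h: "g ** h = mat 1" "h ** g = mat 1" using g by (auto simp: invertible_def)
  have inv: "matrix_inv g = h" using h by (rule matrix_inv_unique)
  obtain v w where vw: "fst z ** snd z - snd z ** fst z + mat 1 = outer v w"
    using z unfolding CM_bar_iff by blast
  have "(g ** X ** h) ** (g ** Y ** h) = g ** (X ** Y) ** h" for X Y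
    using h by (metis matrix_mul_assoc matrix_mul_rid)
  then have "g ** fst z ** h ** (g ** snd z ** h) - g ** snd z ** h ** (g ** fst z ** h) + mat 1
      = g ** (fst z ** snd z - snd z ** fst z + mat 1) ** h"
    using h by (simp add: matrix_add_ldistrib matrix_add_rdistrib matrix_sub_ldistrib matrix_sub_rdistrib)
  also have "\<dots> = outer (g *v v) (w v* h)"
    by (simp add: vw outer_mult)
  finally show ?thesis
    unfolding CM_bar_iff by (auto simp: conj_pair_def case_prod_beta inv)
qed

lemma traceless_conj:
  assumes "g ** h = mat 1" "h ** g = mat 1"
  shows "traceless (g ** X ** h) = g ** traceless X ** h" "trace (g ** X ** h) = trace X"
proof -
  have "trace (g ** X ** h) = trace (h ** g ** X)"
    using trace_mul_sym[of "g ** X" h] by (simp add: matrix_mul_assoc)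
  then show tr: "trace (g ** X ** h) = trace X" using assms by simp
  show "traceless (g ** X ** h) = g ** traceless X ** h"
    by (simp add: traceless_def tr matrix_sub_ldistrib matrix_sub_rdistrib mat_conj[OF assms(1)])
qed

lemma word_trace_conj:
  assumes "g ** h = mat 1" "h ** g = mat 1"
  shows "word_trace (map (\<lambda>X. g ** X ** h) ws) = word_trace ws"
proof -
  have "foldr (**) (map (\<lambda>X. g ** X ** h) ws) (mat 1) = g ** foldr (**) ws (mat 1) ** h"
  proof (induction ws)
    case (Cons X ws)
    have "g ** X ** h ** (g ** foldr (**) ws (mat 1) ** h) = g ** X ** (h ** g) ** foldr (**) ws (mat 1) ** h"
      by (simp add: matrix_mul_assoc)
    then show ?case using Cons assms by (simp add: matrix_mul_assoc)
  qed (use assms in simp)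
  then show ?thesis
    unfolding word_trace_def by (simp add: traceless_conj(2)[OF assms])
qed

lemma cm_traces_conj:
  assumes "invertible g"
  shows "cm_traces (conj_pair g z) i = cm_traces z i"
proof -
  obtain h where h: "g ** h = mat 1" "h ** g = mat 1" using assms by (auto simp: invertible_def)
  have inv: "matrix_inv g = h" using h by (rule matrix_inv_unique)
  note conj = word_trace_conj[OF h, of "[_, _]", simplified] word_trace_conj[OF h, of "[_, _, _]", simplified]
  show ?thesis
    by (simp add: cm_traces_def Let_def conj_pair_def case_prod_beta inv traceless_conj[OF h] conj)
qed

lemma poly_fun_word_trace:
  assumes "\<And>X i j. X \<in> set ws \<Longrightarrow> poly_fun S x (\<lambda>s. X s $ i $ j)"
  shows "poly_fun S x (\<lambda>s. word_trace (map (\<lambda>X. X s) ws))"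
proof -
  have "poly_fun S x (\<lambda>s. foldr (**) (map (\<lambda>X. X s) ws) (mat 1) $ i $ j)" for i j
    using assms
  proof (induction ws arbitrary: i j)
    case Nil
    show ?case by (simp add: mat_nth_3 poly_fun_const)
  next
    case (Cons X ws)
    then show ?case
      unfolding list.map foldr_Cons comp_apply mult_nth_3
      by (intro poly_fun_add poly_fun_mult) auto
  qed
  then show ?thesis unfolding word_trace_def trace_3 by (intro poly_fun_add)
qed

lemma poly_fun_if:
  "poly_fun S x f \<Longrightarrow> poly_fun S x g \<Longrightarrow> poly_fun S x (\<lambda>s. if P then f s else g s)"
  by (cases P) simp_all

lemma poly_fun_cm_traces: "poly_fun CM_bar entry (\<lambda>z. cm_traces z i)"
proof -
  have tr: "poly_fun CM_bar entry (\<lambda>z. trace (fst z))" "poly_fun CM_bar entry (\<lambda>z. trace (snd z))"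
    unfolding trace_3 by (intro poly_fun_add poly_fun_entry_fst poly_fun_entry_snd)+
  have A: "poly_fun CM_bar entry (\<lambda>z. traceless (fst z) $ i $ j)"
    and B: "poly_fun CM_bar entry (\<lambda>z. traceless (snd z) $ i $ j)" for i j
    by (cases "i = j"; simp add: traceless_def mat_nth_3;
        intro poly_fun_diff poly_fun_divide tr poly_fun_entry_fst poly_fun_entry_snd)+
  have "poly_fun CM_bar entry (\<lambda>z. word_trace (map (\<lambda>X. X z) ws))"
    if "set ws \<subseteq> {\<lambda>z. traceless (fst z), \<lambda>z. traceless (snd z)}" for ws
    by (rule poly_fun_word_trace) (use that A B in auto)
  note words = this[of "[_, _]", simplified] this[of "[_, _, _]", simplified]
  show ?thesis
    unfolding cm_traces_def Let_def
    by (intro poly_fun_if tr words poly_fun_const) simp_all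
qed

definition restrict_traces :: "nat cpoly \<Rightarrow> matrix_pair \<Rightarrow> complex" where
  "restrict_traces p = (\<lambda>z\<in>CM_bar. cpoly_eval (cm_traces z) p)"

lemma CM_eval_eq:
  assumes "cpoly_vars p \<subseteq> {1..9}"
  shows "CM_eval p = restrict_traces p"
  unfolding CM_eval_def restrict_traces_def
  by (intro restrict_ext cpoly_eval_cong[OF assms]) (rule CM_gen_eq_cm_traces)

lemma CM_gen_eq: "i \<in> {1..9} \<Longrightarrow> CM_gen i = restrict_traces (cvar i)"
proof
  fix z assume i: "i \<in> {1..9}"
  show "CM_gen i z = restrict_traces (cvar i) z"
    using CM_gen_eq_cm_traces[OF _ i, of z]
    by (cases "z \<in> CM_bar") (simp_all add: restrict_traces_def CM_gen_def)
qed

lemma carrier_CM_coord: "carrier CM_coord = range restrict_traces"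
proof (intro equalityI subsetI)
  fix f assume f: "f \<in> carrier CM_coord"
  then have "invariant_fun f" "f \<in> extensional CM_bar"
    by (auto simp: CM_coord_def invariant_fun_def poly_fun_def)
  then obtain p where "\<forall>z\<in>CM_bar. f z = cpoly_eval (cm_traces z) p"
    using invariant_fun_is_polynomial_in_traces unfolding poly_fun_def by blast
  with \<open>f \<in> extensional CM_bar\<close> have "f = restrict_traces p"
    by (auto simp: restrict_traces_def extensional_def)
  then show "f \<in> range restrict_traces" by blast
next
  fix f assume "f \<in> range restrict_traces"
  then obtain p where f: "f = restrict_traces p" by blast
  have "poly_fun CM_bar entry (\<lambda>z. cpoly_eval (cm_traces z) p)"
    by (rule poly_fun_compose[where T = CM_bar and y = cm_traces and h = "\<lambda>z. z"])
       (auto simp: poly_fun_cm_traces intro: poly_funI)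
  then have "\<exists>q. \<forall>z\<in>CM_bar. f z = cpoly_eval (entry z) q"
    by (simp add: poly_fun_def f restrict_traces_def)
  moreover have "f (conj_pair g z) = f z" if "invertible g" "z \<in> CM_bar" for g z
  proof -
    have "cm_traces (conj_pair g z) = cm_traces z"
      using that(1) by (intro ext cm_traces_conj)
    then show ?thesis
      using that conj_pair_CM_bar by (simp add: f restrict_traces_def)
  qed
  moreover have "f \<in> extensional CM_bar" by (simp add: f restrict_traces_def)
  ultimately show "f \<in> carrier CM_coord" by (simp add: CM_coord_def)
qed

lemma restrict_traces_hom:
  "restrict_traces (p + q) = restrict_traces p \<oplus>\<^bsub>CM_coord\<^esub> restrict_traces q"
  "restrict_traces (p * q) = restrict_traces p \<otimes>\<^bsub>CM_coord\<^esub> restrict_traces q"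
  "restrict_traces 1 = \<one>\<^bsub>CM_coord\<^esub>" "restrict_traces 0 = \<zero>\<^bsub>CM_coord\<^esub>"
  "restrict_traces (cconst c * p) = c \<odot>\<^bsub>CM_coord\<^esub> restrict_traces p"
  by (auto simp: restrict_traces_def)

lemma restrict_traces_carrier [simp]: "restrict_traces p \<in> carrier CM_coord"
  by (simp add: carrier_CM_coord)

lemma cring_CM_coord: "cring CM_coord"
proof (rule cringI)
  show "abelian_group CM_coord"
  proof (rule abelian_groupI)
    fix f g assume "f \<in> carrier CM_coord" "g \<in> carrier CM_coord"
    then obtain p q where "f = restrict_traces p" "g = restrict_traces q" by (auto simp: carrier_CM_coord)
    then have "f \<oplus>\<^bsub>CM_coord\<^esub> g = restrict_traces (p + q)" by (simp only: restrict_traces_hom)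
    then show "f \<oplus>\<^bsub>CM_coord\<^esub> g \<in> carrier CM_coord" by (simp only: restrict_traces_carrier)
  next
    show "\<zero>\<^bsub>CM_coord\<^esub> \<in> carrier CM_coord"
      unfolding restrict_traces_hom(4)[symmetric] by (rule restrict_traces_carrier)
  next
    fix f assume "f \<in> carrier CM_coord"
    then obtain p where "f = restrict_traces p" by (auto simp: carrier_CM_coord)
    then have "restrict_traces (- p) \<oplus>\<^bsub>CM_coord\<^esub> f = \<zero>\<^bsub>CM_coord\<^esub>"
      by (simp add: restrict_traces_def fun_eq_iff restrict_def)
    then show "\<exists>g\<in>carrier CM_coord. g \<oplus>\<^bsub>CM_coord\<^esub> f = \<zero>\<^bsub>CM_coord\<^esub>"
      using restrict_traces_carrier by blast
  qed (auto simp: carrier_CM_coord fun_eq_iff restrict_traces_def restrict_def algebra_simps)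
  show "comm_monoid CM_coord"
  proof (rule comm_monoidI)
    fix f g assume "f \<in> carrier CM_coord" "g \<in> carrier CM_coord"
    then obtain p q where "f = restrict_traces p" "g = restrict_traces q" by (auto simp: carrier_CM_coord)
    then have "f \<otimes>\<^bsub>CM_coord\<^esub> g = restrict_traces (p * q)" by (simp only: restrict_traces_hom)
    then show "f \<otimes>\<^bsub>CM_coord\<^esub> g \<in> carrier CM_coord" by (simp only: restrict_traces_carrier)
  next
    show "\<one>\<^bsub>CM_coord\<^esub> \<in> carrier CM_coord"
      unfolding restrict_traces_hom(3)[symmetric] by (rule restrict_traces_carrier)
  qed (auto simp: carrier_CM_coord fun_eq_iff restrict_traces_def restrict_def algebra_simps)
qed (auto simp: carrier_CM_coord fun_eq_iff restrict_traces_def restrict_def algebra_simps)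


section \<open>Subalgebras generated by traces, and minimality\<close>

lemma CM_coord_a_inv: "\<ominus>\<^bsub>CM_coord\<^esub> restrict_traces p = restrict_traces (- p)"
proof -
  interpret cring CM_coord by (rule cring_CM_coord)
  have "restrict_traces (- p) \<oplus>\<^bsub>CM_coord\<^esub> restrict_traces p = \<zero>\<^bsub>CM_coord\<^esub>"
    using restrict_traces_hom(1)[of "- p" p] restrict_traces_hom(4) by (simp del: CM_coord_simps)
  then show ?thesis
    by (intro minus_equality) simp_all
qed

text \<open>Stated for all \<open>K\<close>: the full index set gives generation, the proper subsets
  give minimality.\<close>

lemma alg_generate_CM_gen:
  assumes K: "K \<subseteq> {1..9}"
  shows "alg_generate CM_coord (CM_gen ` K) = restrict_traces ` {p. cpoly_vars p \<subseteq> K}"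
proof (intro equalityI subsetI)
  fix f assume "f \<in> alg_generate CM_coord (CM_gen ` K)"
  then show "f \<in> restrict_traces ` {p. cpoly_vars p \<subseteq> K}"
    unfolding alg_generate_def
  proof (induction rule: generate_ring.induct)
    case one
    show ?case by (rule image_eqI[of _ _ 1]) (simp_all add: restrict_traces_def)
  next
    case (incl h)
    then consider c where "h = c \<odot>\<^bsub>CM_coord\<^esub> \<one>\<^bsub>CM_coord\<^esub>" | i where "i \<in> K" "h = CM_gen i"
      by blast
    then show ?case
    proof cases
      case 1
      then show ?thesis
        by (intro image_eqI[of _ _ "cconst c"]) (auto simp: restrict_traces_def fun_eq_iff restrict_def)
    next
      case 2
      then show ?thesis
        using K CM_gen_eq[of i] by (intro image_eqI[of _ _ "cvar i"]) auto
    qed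
  next
    case (a_inv h)
    then obtain p where "cpoly_vars p \<subseteq> K" "h = restrict_traces p" by auto
    then show ?case
      by (intro image_eqI[of _ _ "- p"]) (simp_all add: CM_coord_a_inv)
  next
    case (eng_add h1 h2)
    then obtain p q where "cpoly_vars p \<subseteq> K" "h1 = restrict_traces p"
      "cpoly_vars q \<subseteq> K" "h2 = restrict_traces q" by auto
    then show ?case
      by (intro image_eqI[of _ _ "p + q"]) (simp_all only: restrict_traces_hom mem_Collect_eq cpoly_vars_add)
  next
    case (eng_mult h1 h2)
    then obtain p q where "cpoly_vars p \<subseteq> K" "h1 = restrict_traces p"
      "cpoly_vars q \<subseteq> K" "h2 = restrict_traces q" by auto
    then show ?case
      by (intro image_eqI[of _ _ "p * q"]) (simp_all only: restrict_traces_hom mem_Collect_eq cpoly_vars_mult)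
  qed
next
  fix f assume "f \<in> restrict_traces ` {p. cpoly_vars p \<subseteq> K}"
  then obtain p where "cpoly_vars p \<subseteq> K" "f = restrict_traces p" by auto
  then show "f \<in> alg_generate CM_coord (CM_gen ` K)"
  proof (induction p arbitrary: f rule: cpoly_induct)
    case (const c)
    have "c \<odot>\<^bsub>CM_coord\<^esub> \<one>\<^bsub>CM_coord\<^esub> \<in> alg_generate CM_coord (CM_gen ` K)"
      unfolding alg_generate_def by (intro generate_ring.incl) blast
    also have "c \<odot>\<^bsub>CM_coord\<^esub> \<one>\<^bsub>CM_coord\<^esub> = restrict_traces (cconst c)"
      by (auto simp: restrict_traces_def fun_eq_iff restrict_def)
    finally show ?case using const by simp
  next
    case (var i)
    then have "f = CM_gen i" using K CM_gen_eq[of i] by auto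
    with var(1) show ?case
      unfolding alg_generate_def by (intro generate_ring.incl) blast
  next
    case (add p q)
    have "restrict_traces p \<oplus>\<^bsub>CM_coord\<^esub> restrict_traces q \<in> alg_generate CM_coord (CM_gen ` K)"
      using add(1)[OF refl] add(2)[OF refl] unfolding alg_generate_def by (rule generate_ring.eng_add)
    with add(3) show ?case by (simp only: restrict_traces_hom)
  next
    case (mult p q)
    have "restrict_traces p \<otimes>\<^bsub>CM_coord\<^esub> restrict_traces q \<in> alg_generate CM_coord (CM_gen ` K)"
      using mult(1)[OF refl] mult(2)[OF refl] unfolding alg_generate_def by (rule generate_ring.eng_mult)
    with mult(3) show ?case by (simp only: restrict_traces_hom)
  qed
qed

text \<open>Setting the variables outside \<open>V\<close> to 0 retracts all polynomials onto those
  in \<open>V\<close>.\<close>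

lemma psubst_retract:
  fixes V :: "'v set"
  defines "\<rho> \<equiv> \<lambda>i. if i \<in> V then cvar i else 0"
  shows "cpoly_vars p \<subseteq> V \<Longrightarrow> psubst \<rho> p = p" "cpoly_vars (psubst \<rho> p) \<subseteq> V"
  by (auto intro: psubst_cvar_id simp: \<rho>_def) (rule subsetD[OF cpoly_vars_psubst]; auto)

lemma minimal_generating_family_CM_gen: "minimal_generating_family CM_coord {1..9} CM_gen"
  unfolding minimal_generating_family_def
proof (intro conjI allI impI)
  show "CM_gen ` {1..9} \<subseteq> carrier CM_coord"
    using CM_gen_eq by (auto simp: carrier_CM_coord)
  show "alg_generate CM_coord (CM_gen ` {1..9}) = carrier CM_coord"
  proof -
    have "restrict_traces p \<in> restrict_traces ` {p. cpoly_vars p \<subseteq> {1..9}}" for p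
    proof (rule image_eqI)
      define \<rho> :: "nat \<Rightarrow> nat cpoly" where "\<rho> = (\<lambda>i. if i \<in> {1..9} then cvar i else 0)"
      have "cpoly_eval (cm_traces z) (\<rho> i) = cm_traces z i" for z i
        by (auto simp: \<rho>_def cm_traces_def)
      then show "restrict_traces p = restrict_traces (psubst \<rho> p)"
        by (simp add: restrict_traces_def cpoly_eval_psubst)
      show "psubst \<rho> p \<in> {p. cpoly_vars p \<subseteq> {1..9}}"
        unfolding \<rho>_def mem_Collect_eq by (rule psubst_retract(2))
    qed
    then show ?thesis unfolding alg_generate_CM_gen[OF order_refl] carrier_CM_coord by blast
  qed
  fix K :: "nat set" assume K: "K \<subset> {1..9}"
  then obtain i where i: "i \<in> {1..9}" "i \<notin> K" by blast
  obtain z z' where z: "z \<in> CM_bar" "z' \<in> CM_bar" "cm_traces z i \<noteq> cm_traces z' i"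
    "\<And>j. j \<in> {1..9} - {i} \<Longrightarrow> cm_traces z j = cm_traces z' j"
    using separated_by_all[OF i(1)] unfolding separated_by_def by blast
  show "alg_generate CM_coord (CM_gen ` K) \<noteq> carrier CM_coord"
  proof
    assume "alg_generate CM_coord (CM_gen ` K) = carrier CM_coord"
    then have "restrict_traces (cvar i) \<in> restrict_traces ` {p. cpoly_vars p \<subseteq> K}"
      using alg_generate_CM_gen[of K] K restrict_traces_carrier[of "cvar i"]
      by (simp add: psubset_imp_subset del: restrict_traces_carrier)
    then obtain p where p: "restrict_traces (cvar i) = restrict_traces p" "cpoly_vars p \<subseteq> K"
      by blast
    have "cpoly_eval (cm_traces z) p = cpoly_eval (cm_traces z') p"
      by (rule cpoly_eval_cong[OF p(2)]) (use z(4) K i in blast)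
    moreover have "cm_traces y i = cpoly_eval (cm_traces y) p" if "y \<in> CM_bar" for y
      using fun_cong[OF p(1), of y] that by (simp add: restrict_traces_def)
    ultimately show False using z by simp
  qed
qed

section \<open>The kernel of evaluation as an ideal of the polynomial ring\<close>

lemma CM_relations_eq: "CM_relations = {rel1 cvar, rel2 cvar, rel3 cvar, rel4 cvar, rel5 cvar}"
  by (simp add: CM_relations_def rel_defs Let_def)

lemma cpoly_vars_rel:
  "cpoly_vars (rel1 cvar :: nat cpoly) \<subseteq> {3..9}" "cpoly_vars (rel2 cvar :: nat cpoly) \<subseteq> {3..9}"
  "cpoly_vars (rel3 cvar :: nat cpoly) \<subseteq> {3..9}" "cpoly_vars (rel4 cvar :: nat cpoly) \<subseteq> {3..9}"
  "cpoly_vars (rel5 cvar :: nat cpoly) \<subseteq> {3..9}"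
  unfolding rel_defs by (intro cpoly_vars_intros; simp)+

lemma poly_alg_a_inv: "cpoly_vars p \<subseteq> V \<Longrightarrow> \<ominus>\<^bsub>poly_alg V\<^esub> p = - p"
proof -
  interpret cring "poly_alg V" by (rule cring_poly_alg)
  assume "cpoly_vars p \<subseteq> V"
  then show ?thesis by (intro minus_equality) simp_all
qed

text \<open>A combination of relations lying in \<open>V\<close> may have cofactors with other
  variables; retracting onto \<open>V\<close> fixes the relations and the combination and moves the
  cofactors into the ring. The set \<open>V\<close> is used with both \<open>{1..9}\<close> and
  \<open>{3..9}\<close>.\<close>

lemma genideal_CM_relations:
  assumes V: "{3..9} \<subseteq> V"
  shows "Idl\<^bsub>poly_alg V\<^esub> CM_relations = rel_ideal \<inter> {p. cpoly_vars p \<subseteq> V}"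
proof
  interpret cring "poly_alg V" by (rule cring_poly_alg)
  have rel_V: "CM_relations \<subseteq> carrier (poly_alg V)"
    unfolding CM_relations_eq using cpoly_vars_rel V by auto
  have "ideal (rel_ideal \<inter> {p. cpoly_vars p \<subseteq> V}) (poly_alg V)"
  proof (rule idealI)
    show "ring (poly_alg V)" by (rule ring_axioms)
    show "subgroup (rel_ideal \<inter> {p. cpoly_vars p \<subseteq> V}) (add_monoid (poly_alg V))"
    proof (rule group.subgroupI)
      show "group (add_monoid (poly_alg V))" by (rule add.is_group)
      show "rel_ideal \<inter> {p. cpoly_vars p \<subseteq> V} \<noteq> {}"
        using ring_ideal_0[OF ring_ideal_rel_ideal] by force
      fix p assume p: "p \<in> rel_ideal \<inter> {p. cpoly_vars p \<subseteq> V}"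
      then have "inv\<^bsub>add_monoid (poly_alg V)\<^esub> p = - p"
        using poly_alg_a_inv[of p V] by (simp only: a_inv_def) simp
      with p show "inv\<^bsub>add_monoid (poly_alg V)\<^esub> p \<in> rel_ideal \<inter> {p. cpoly_vars p \<subseteq> V}"
        by (simp add: rel_ideal_intros)
    qed (auto simp: cpoly_vars_add rel_ideal_intros)
  qed (auto simp: cpoly_vars_mult rel_ideal_intros)
  then show "Idl\<^bsub>poly_alg V\<^esub> CM_relations \<subseteq> rel_ideal \<inter> {p. cpoly_vars p \<subseteq> V}"
    by (rule genideal_minimal)
       (use rel_V rel_in_rel_ideal in \<open>auto simp: CM_relations_eq\<close>)
  show "rel_ideal \<inter> {p. cpoly_vars p \<subseteq> V} \<subseteq> Idl\<^bsub>poly_alg V\<^esub> CM_relations"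
  proof
    fix p assume p: "p \<in> rel_ideal \<inter> {p. cpoly_vars p \<subseteq> V}"
    then obtain c1 c2 c3 c4 c5 where
      "p = c1 * rel1 cvar + c2 * rel2 cvar + c3 * rel3 cvar + c4 * rel4 cvar + c5 * rel5 cvar"
      unfolding rel_ideal_def by blast
    moreover define \<rho> :: "nat \<Rightarrow> nat cpoly" where "\<rho> = (\<lambda>i. if i \<in> V then cvar i else 0)"
    have \<rho>: "psubst \<rho> q = q" if "cpoly_vars q \<subseteq> V" for q
      unfolding \<rho>_def using that by (rule psubst_retract(1))
    have vars: "cpoly_vars (psubst \<rho> q) \<subseteq> V" for q
      unfolding \<rho>_def by (rule psubst_retract(2))
    have rels: "psubst \<rho> (rel1 cvar) = rel1 cvar" "psubst \<rho> (rel2 cvar) = rel2 cvar"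
      "psubst \<rho> (rel3 cvar) = rel3 cvar" "psubst \<rho> (rel4 cvar) = rel4 cvar"
      "psubst \<rho> (rel5 cvar) = rel5 cvar"
      using cpoly_vars_rel V by (intro \<rho>; blast)+
    ultimately have "p = psubst \<rho> c1 * rel1 cvar + psubst \<rho> c2 * rel2 cvar + psubst \<rho> c3 * rel3 cvar
      + psubst \<rho> c4 * rel4 cvar + psubst \<rho> c5 * rel5 cvar"
      using \<rho>[of p] p by (simp add: rels)
    moreover interpret I: ideal "Idl\<^bsub>poly_alg V\<^esub> CM_relations" "poly_alg V"
      by (rule genideal_ideal[OF rel_V])
    have "psubst \<rho> c * r \<in> Idl\<^bsub>poly_alg V\<^esub> CM_relations" if "r \<in> CM_relations" for c r
      using I.I_l_closed[of r "psubst \<rho> c"] genideal_self[OF rel_V] that vars[of c] by auto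
    moreover have "x + y \<in> Idl\<^bsub>poly_alg V\<^esub> CM_relations"
      if "x \<in> Idl\<^bsub>poly_alg V\<^esub> CM_relations" "y \<in> Idl\<^bsub>poly_alg V\<^esub> CM_relations" for x y
      using I.a_closed[OF that] by simp
    ultimately show "p \<in> Idl\<^bsub>poly_alg V\<^esub> CM_relations"
      by (simp add: CM_relations_eq)
  qed
qed

lemma a_kernel_CM_eval:
  "a_kernel (poly_alg {1..9}) CM_coord CM_eval = Idl\<^bsub>poly_alg {1..9}\<^esub> CM_relations"
proof -
  have "a_kernel (poly_alg {1..9}) CM_coord CM_eval
      = {p. cpoly_vars p \<subseteq> {1..9} \<and> restrict_traces p = restrict_traces 0}"
    by (auto simp: a_kernel_def' CM_eval_eq restrict_traces_hom(4) simp del: CM_coord_simps)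
  also have "\<dots> = rel_ideal \<inter> {p. cpoly_vars p \<subseteq> {1..9}}"
  proof (intro equalityI subsetI)
    fix p assume "p \<in> {p. cpoly_vars p \<subseteq> {1..9} \<and> restrict_traces p = restrict_traces 0}"
    then have p: "cpoly_vars p \<subseteq> {1..9}" "restrict_traces p = restrict_traces 0" by auto
    have "cpoly_eval (cm_traces z) p = 0" if "z \<in> CM_bar" for z
      using fun_cong[OF p(2), of z] that by (simp add: restrict_traces_def)
    with p(1) show "p \<in> rel_ideal \<inter> {p. cpoly_vars p \<subseteq> {1..9}}"
      using vanishing_in_rel_ideal by blast
  next
    fix p assume "p \<in> rel_ideal \<inter> {p. cpoly_vars p \<subseteq> {1..9}}"
    then show "p \<in> {p. cpoly_vars p \<subseteq> {1..9} \<and> restrict_traces p = restrict_traces 0}"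
      using cpoly_eval_rel_ideal satisfies_relations_cm_traces
      by (auto simp: restrict_traces_def intro!: restrict_ext)
  qed
  also have "\<dots> = Idl\<^bsub>poly_alg {1..9}\<^esub> CM_relations"
    by (rule genideal_CM_relations[symmetric]) auto
  finally show ?thesis .
qed

section \<open>The tensor product\<close>

text \<open>An element of the free vector space is determined by the values of the linear extensions
  of all \<open>\<phi>\<close>, and \<open>f g\<close> pairs with \<open>\<phi>\<close> like \<open>f\<close> and \<open>g\<close> with \<open>\<lambda>u v. \<phi> (u v)\<close>. So the
  ring axioms reduce to those of the monoid of pairs.\<close>

definition pairing :: "('u \<Rightarrow> complex) \<Rightarrow> ('u \<Rightarrow> complex) \<Rightarrow> complex" where
  "pairing f \<phi> = (\<Sum>u | f u \<noteq> 0. f u * \<phi> u)"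

lemma pairing_superset:
  assumes "finite S" "{u. f u \<noteq> 0} \<subseteq> S"
  shows "pairing f \<phi> = (\<Sum>u\<in>S. f u * \<phi> u)"
  unfolding pairing_def by (rule sum.mono_neutral_left) (use assms in auto)

lemma pairing_add:
  assumes "finite {u. f u \<noteq> 0}" "finite {u. g u \<noteq> 0}"
  shows "pairing (\<lambda>u. f u + g u) \<phi> = pairing f \<phi> + pairing g \<phi>"
proof -
  let ?S = "{u. f u \<noteq> 0} \<union> {u. g u \<noteq> 0}"
  have "pairing (\<lambda>u. f u + g u) \<phi> = (\<Sum>u\<in>?S. (f u + g u) * \<phi> u)"
    by (rule pairing_superset) (use assms in auto)
  also have "\<dots> = pairing f \<phi> + pairing g \<phi>"
    using assms by (simp add: pairing_superset[of ?S f] pairing_superset[of ?S g] distrib_right sum.distrib)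
  finally show ?thesis .
qed

lemma pairing_scale: "pairing (\<lambda>u. c * f u) \<phi> = c * pairing f \<phi>"
  by (cases "c = 0") (simp_all add: pairing_def sum_distrib_left mult.assoc)

lemma pairing_diff:
  assumes "finite {u. f u \<noteq> 0}" "finite {u. g u \<noteq> 0}"
  shows "pairing (\<lambda>u. f u - g u) \<phi> = pairing f \<phi> - pairing g \<phi>"
  using pairing_add[OF assms(1), of "\<lambda>u. - 1 * g u"] assms(2) by (simp add: pairing_scale[of "- 1" g, simplified])

lemma pairing_cong:
  "(\<And>u. f u \<noteq> 0 \<Longrightarrow> \<phi> u = \<psi> u) \<Longrightarrow> pairing f \<phi> = pairing f \<psi>"
  unfolding pairing_def by (rule sum.cong) auto

lemma pairing_nonzeroE:
  assumes "pairing f \<phi> \<noteq> 0"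
  obtains u where "f u \<noteq> 0" "\<phi> u \<noteq> 0"
proof -
  have "\<exists>u\<in>{u. f u \<noteq> 0}. f u * \<phi> u \<noteq> 0"
    using assms sum.neutral[of "{u. f u \<noteq> 0}" "\<lambda>u. f u * \<phi> u"] unfolding pairing_def by blast
  then show thesis using that by auto
qed

lemma pairing_basis [simp]: "pairing (free_pair_basis u) \<phi> = \<phi> u"
  by (simp add: pairing_def free_pair_basis_def)

lemma finite_basis [simp]: "finite {z. free_pair_basis u z \<noteq> 0}"
  by (simp add: free_pair_basis_def)

lemma pairing_0 [simp]: "pairing (\<lambda>u. 0) \<phi> = 0"
  by (simp add: pairing_def)

lemma pairing_sum_right: "pairing f (\<lambda>u. \<Sum>i\<in>I. \<phi> i u) = (\<Sum>i\<in>I. pairing f (\<phi> i))"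
  unfolding pairing_def by (simp add: sum_distrib_left sum.swap[of _ I])

lemma pairing_mult_right: "pairing f (\<lambda>u. \<phi> u * c) = pairing f \<phi> * c"
  unfolding pairing_def by (simp add: sum_distrib_right mult.assoc)

lemma pairing_swap:
  "pairing f (\<lambda>u. pairing g (\<lambda>v. \<phi> u v)) = pairing g (\<lambda>v. pairing f (\<lambda>u. \<phi> u v))"
  unfolding pairing_def
  by (simp add: sum_distrib_left mult.left_commute) (rule sum.swap)

lemma eq_pairing_basis:
  fixes f :: "'a \<times> 'b \<Rightarrow> complex"
  assumes "finite {u. f u \<noteq> 0}"
  shows "f z = pairing f (\<lambda>u. free_pair_basis u z)"
proof -
  have "pairing f (\<lambda>u. free_pair_basis u z) = (\<Sum>u | f u \<noteq> 0. if u = z then f z else 0)"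
    unfolding pairing_def by (rule sum.cong) (auto simp: free_pair_basis_def)
  also have "\<dots> = f z" using assms by (simp add: sum.delta)
  finally show ?thesis by simp
qed

lemma ext_pairing:
  fixes f g :: "'a \<times> 'b \<Rightarrow> complex"
  assumes "finite {u. f u \<noteq> 0}" "finite {u. g u \<noteq> 0}" "\<And>\<phi>. pairing f \<phi> = pairing g \<phi>"
  shows "f = g"
  using eq_pairing_basis[OF assms(1)] eq_pairing_basis[OF assms(2)] assms(3) by (metis ext)

definition pair_mult :: "(complex, 'a) module \<Rightarrow> (complex, 'b) module \<Rightarrow> 'a \<times> 'b \<Rightarrow> 'a \<times> 'b \<Rightarrow> 'a \<times> 'b" where
  "pair_mult A B u v = (fst u \<otimes>\<^bsub>A\<^esub> fst v, snd u \<otimes>\<^bsub>B\<^esub> snd v)"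

lemma free_pair_alg_simps [simp]:
  "carrier (free_pair_alg A B) = {f. finite {z. f z \<noteq> 0} \<and> {z. f z \<noteq> 0} \<subseteq> carrier A \<times> carrier B}"
  "one (free_pair_alg A B) = free_pair_basis (\<one>\<^bsub>A\<^esub>, \<one>\<^bsub>B\<^esub>)"
  "zero (free_pair_alg A B) = (\<lambda>z. 0)"
  "add (free_pair_alg A B) = (\<lambda>f g z. f z + g z)"
  "smult (free_pair_alg A B) = (\<lambda>c f z. c * f z)"
  by (simp_all add: free_pair_alg_def)

lemma free_pair_mult_eq:
  "(f \<otimes>\<^bsub>free_pair_alg A B\<^esub> g) z
    = pairing f (\<lambda>u. pairing g (\<lambda>v. free_pair_basis (pair_mult A B u v) z))"
  by (simp add: free_pair_alg_def pairing_def pair_mult_def sum_distrib_left mult.assoc)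

lemma free_pair_mult_support:
  "{z. (f \<otimes>\<^bsub>free_pair_alg A B\<^esub> g) z \<noteq> 0}
    \<subseteq> (\<lambda>(u, v). pair_mult A B u v) ` ({u. f u \<noteq> 0} \<times> {v. g v \<noteq> 0})"
proof
  fix z assume "z \<in> {z. (f \<otimes>\<^bsub>free_pair_alg A B\<^esub> g) z \<noteq> 0}"
  then have "pairing f (\<lambda>u. pairing g (\<lambda>v. free_pair_basis (pair_mult A B u v) z)) \<noteq> 0"
    by (simp add: free_pair_mult_eq)
  then obtain u where u: "f u \<noteq> 0" "pairing g (\<lambda>v. free_pair_basis (pair_mult A B u v) z) \<noteq> 0"
    by (rule pairing_nonzeroE)
  from u(2) obtain v where "g v \<noteq> 0" "free_pair_basis (pair_mult A B u v) z \<noteq> 0"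
    by (rule pairing_nonzeroE)
  with u show "z \<in> (\<lambda>(u, v). pair_mult A B u v) ` ({u. f u \<noteq> 0} \<times> {v. g v \<noteq> 0})"
    by (auto simp: free_pair_basis_def split: if_splits)
qed

lemma finite_free_pair_mult:
  assumes "finite {u. f u \<noteq> 0}" "finite {v. g v \<noteq> 0}"
  shows "finite {z. (f \<otimes>\<^bsub>free_pair_alg A B\<^esub> g) z \<noteq> 0}"
  by (rule finite_subset[OF free_pair_mult_support]) (use assms in simp)

lemma pairing_free_pair_mult:
  assumes f: "finite {u. f u \<noteq> 0}" and g: "finite {v. g v \<noteq> 0}"
  shows "pairing (f \<otimes>\<^bsub>free_pair_alg A B\<^esub> g) \<phi>
    = pairing f (\<lambda>u. pairing g (\<lambda>v. \<phi> (pair_mult A B u v)))"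
proof -
  let ?S = "(\<lambda>(u, v). pair_mult A B u v) ` ({u. f u \<noteq> 0} \<times> {v. g v \<noteq> 0})"
  have S: "finite ?S" using f g by simp
  have "pairing (f \<otimes>\<^bsub>free_pair_alg A B\<^esub> g) \<phi> = (\<Sum>z\<in>?S. (f \<otimes>\<^bsub>free_pair_alg A B\<^esub> g) z * \<phi> z)"
    by (rule pairing_superset[OF S free_pair_mult_support])
  also have "\<dots> = (\<Sum>z\<in>?S. pairing f (\<lambda>u. pairing g (\<lambda>v. free_pair_basis (pair_mult A B u v) z * \<phi> z)))"
    by (simp add: free_pair_mult_eq pairing_mult_right)
  also have "\<dots> = pairing f (\<lambda>u. pairing g (\<lambda>v. \<Sum>z\<in>?S. free_pair_basis (pair_mult A B u v) z * \<phi> z))"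
    by (simp add: pairing_sum_right)
  also have "\<dots> = pairing f (\<lambda>u. pairing g (\<lambda>v. \<phi> (pair_mult A B u v)))"
  proof (intro pairing_cong)
    fix u v assume "f u \<noteq> 0" "g v \<noteq> 0"
    then have "pair_mult A B u v \<in> ?S" by force
    moreover have "(\<Sum>z\<in>?S. free_pair_basis (pair_mult A B u v) z * \<phi> z)
        = (\<Sum>z\<in>?S. if z = pair_mult A B u v then \<phi> (pair_mult A B u v) else 0)"
      by (rule sum.cong) (auto simp: free_pair_basis_def)
    ultimately show "(\<Sum>z\<in>?S. free_pair_basis (pair_mult A B u v) z * \<phi> z) = \<phi> (pair_mult A B u v)"
      using S by (simp only: sum.delta if_True)
  qed
  finally show ?thesis .
qed

lemma basis_carrier:
  "x \<in> carrier A \<Longrightarrow> y \<in> carrier B \<Longrightarrow> free_pair_basis (x, y) \<in> carrier (free_pair_alg A B)"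
  using finite_basis[of "(x, y)"] by (auto simp: free_pair_basis_def split: if_splits)

lemma cring_free_pair_alg:
  assumes A: "cring A" and B: "cring B"
  shows "cring (free_pair_alg A B)"
proof -
  interpret A: cring A by (rule A)
  interpret B: cring B by (rule B)
  let ?F = "free_pair_alg A B"
  have fin: "finite {u. f u \<noteq> 0}" and sup: "\<And>u. f u \<noteq> 0 \<Longrightarrow> fst u \<in> carrier A \<and> snd u \<in> carrier B"
    if "f \<in> carrier ?F" for f
    using that by auto
  have closed: "f \<otimes>\<^bsub>?F\<^esub> g \<in> carrier ?F" if "f \<in> carrier ?F" "g \<in> carrier ?F" for f g
  proof -
    have "{z. (f \<otimes>\<^bsub>?F\<^esub> g) z \<noteq> 0} \<subseteq> carrier A \<times> carrier B"
    proof
      fix z assume "z \<in> {z. (f \<otimes>\<^bsub>?F\<^esub> g) z \<noteq> 0}"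
      then have "z \<in> (\<lambda>(u, v). pair_mult A B u v) ` ({u. f u \<noteq> 0} \<times> {v. g v \<noteq> 0})"
        by (rule subsetD[OF free_pair_mult_support])
      then obtain u v where uv: "f u \<noteq> 0" "g v \<noteq> 0" and z: "z = pair_mult A B u v" by auto
      show "z \<in> carrier A \<times> carrier B"
        using sup[OF that(1) uv(1)] sup[OF that(2) uv(2)] by (simp add: z pair_mult_def)
    qed
    then show ?thesis using finite_free_pair_mult[OF fin fin] that by simp
  qed
  have add_closed: "f \<oplus>\<^bsub>?F\<^esub> g \<in> carrier ?F" if "f \<in> carrier ?F" "g \<in> carrier ?F" for f g
  proof -
    have "{z. f z + g z \<noteq> 0} \<subseteq> {z. f z \<noteq> 0} \<union> {z. g z \<noteq> 0}" by auto
    with that show ?thesis by (auto intro: finite_subset)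
  qed
  show ?thesis
  proof (rule cringI)
    show "abelian_group ?F"
    proof (rule abelian_groupI)
      fix f assume f: "f \<in> carrier ?F"
      then have "(\<lambda>z. - f z) \<in> carrier ?F" by simp
      then show "\<exists>g\<in>carrier ?F. g \<oplus>\<^bsub>?F\<^esub> f = \<zero>\<^bsub>?F\<^esub>"
        by (rule bexI[rotated]) simp
    qed (use add_closed in \<open>auto simp: fun_eq_iff algebra_simps\<close>)
    show "comm_monoid ?F"
    proof (rule comm_monoidI)
      show "\<one>\<^bsub>?F\<^esub> \<in> carrier ?F"
        unfolding free_pair_alg_simps(2) by (rule basis_carrier) auto
    next
      fix f g h assume fgh: "f \<in> carrier ?F" "g \<in> carrier ?F" "h \<in> carrier ?F"
      show "f \<otimes>\<^bsub>?F\<^esub> g \<otimes>\<^bsub>?F\<^esub> h = f \<otimes>\<^bsub>?F\<^esub> (g \<otimes>\<^bsub>?F\<^esub> h)"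
      proof (rule ext_pairing)
        fix \<phi>
        show "pairing (f \<otimes>\<^bsub>?F\<^esub> g \<otimes>\<^bsub>?F\<^esub> h) \<phi> = pairing (f \<otimes>\<^bsub>?F\<^esub> (g \<otimes>\<^bsub>?F\<^esub> h)) \<phi>"
          unfolding pairing_free_pair_mult[OF fin[OF closed[OF fgh(1,2)]] fin[OF fgh(3)]]
            pairing_free_pair_mult[OF fin[OF fgh(1)] fin[OF closed[OF fgh(2,3)]]]
            pairing_free_pair_mult[OF fin[OF fgh(1)] fin[OF fgh(2)]]
            pairing_free_pair_mult[OF fin[OF fgh(2)] fin[OF fgh(3)]]
          by (intro pairing_cong arg_cong[where f = \<phi>])
             (use sup fgh in \<open>simp add: pair_mult_def A.m_assoc B.m_assoc\<close>)
      qed (rule fin closed fgh)+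
    next
      fix f assume f: "f \<in> carrier ?F"
      show "\<one>\<^bsub>?F\<^esub> \<otimes>\<^bsub>?F\<^esub> f = f"
      proof (rule ext_pairing)
        show "finite {u. (\<one>\<^bsub>?F\<^esub> \<otimes>\<^bsub>?F\<^esub> f) u \<noteq> 0}"
          by (rule finite_free_pair_mult) (use fin[OF f] in simp_all)
        fix \<phi>
        have "pairing (\<one>\<^bsub>?F\<^esub> \<otimes>\<^bsub>?F\<^esub> f) \<phi> = pairing f (\<lambda>v. \<phi> (pair_mult A B (\<one>\<^bsub>A\<^esub>, \<one>\<^bsub>B\<^esub>) v))"
          by (subst pairing_free_pair_mult) (use fin[OF f] in simp_all)
        also have "\<dots> = pairing f \<phi>"
          by (intro pairing_cong arg_cong[where f = \<phi>]) (use sup[OF f] in \<open>simp add: pair_mult_def\<close>)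
        finally show "pairing (\<one>\<^bsub>?F\<^esub> \<otimes>\<^bsub>?F\<^esub> f) \<phi> = pairing f \<phi>" .
      qed (rule fin[OF f])
    next
      fix f g assume fg: "f \<in> carrier ?F" "g \<in> carrier ?F"
      show "f \<otimes>\<^bsub>?F\<^esub> g = g \<otimes>\<^bsub>?F\<^esub> f"
      proof (rule ext_pairing)
        fix \<phi>
        have "pairing (f \<otimes>\<^bsub>?F\<^esub> g) \<phi> = pairing g (\<lambda>v. pairing f (\<lambda>u. \<phi> (pair_mult A B u v)))"
          unfolding pairing_free_pair_mult[OF fin[OF fg(1)] fin[OF fg(2)]] by (rule pairing_swap)
        also have "\<dots> = pairing (g \<otimes>\<^bsub>?F\<^esub> f) \<phi>"
          unfolding pairing_free_pair_mult[OF fin[OF fg(2)] fin[OF fg(1)]]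
          by (intro pairing_cong arg_cong[where f = \<phi>])
             (use sup fg in \<open>simp add: pair_mult_def A.m_comm B.m_comm\<close>)
        finally show "pairing (f \<otimes>\<^bsub>?F\<^esub> g) \<phi> = pairing (g \<otimes>\<^bsub>?F\<^esub> f) \<phi>" .
      qed (rule fin closed fg)+
    qed (rule closed)
    fix f g h assume fgh: "f \<in> carrier ?F" "g \<in> carrier ?F" "h \<in> carrier ?F"
    show "(f \<oplus>\<^bsub>?F\<^esub> g) \<otimes>\<^bsub>?F\<^esub> h = f \<otimes>\<^bsub>?F\<^esub> h \<oplus>\<^bsub>?F\<^esub> g \<otimes>\<^bsub>?F\<^esub> h"
      unfolding fun_eq_iff free_pair_mult_eq
      using fin[OF fgh(1)] fin[OF fgh(2)] by (simp add: pairing_add free_pair_mult_eq)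
  qed
qed

subsection \<open>Quotient algebras\<close>

lemma alg_quot_simps:
  "carrier (alg_quot A I) = carrier (A Quot I)" "mult (alg_quot A I) = mult (A Quot I)"
  "one (alg_quot A I) = one (A Quot I)" "zero (alg_quot A I) = zero (A Quot I)"
  "add (alg_quot A I) = add (A Quot I)"
  "smult (alg_quot A I) = (\<lambda>c U. \<Union>x\<in>U. I +>\<^bsub>A\<^esub> (c \<odot>\<^bsub>A\<^esub> x))"
  by (simp_all add: alg_quot_def)

lemma cring_alg_quot:
  assumes "ideal I A" "cring A"
  shows "cring (alg_quot A I)"
proof -
  interpret Q: cring "A Quot I"
    by (rule ideal.quotient_is_cring[OF assms])
  show ?thesis
  proof (rule cringI)
    show "abelian_group (alg_quot A I)"
      by (rule abelian_groupI)
         (auto simp: alg_quot_simps Q.a_ac intro: Q.a_inv_closed Q.l_neg)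
    show "comm_monoid (alg_quot A I)"
      by (rule comm_monoidI) (auto simp: alg_quot_simps Q.m_ac)
  qed (simp add: alg_quot_simps Q.l_distr)
qed

text \<open>Scalars must act through elements of \<open>A\<close> for the union defining the scalar
  multiplication of cosets to be a coset.\<close>

lemma alg_quot_smult:
  assumes I: "ideal I A" and A: "cring A" and k: "k \<in> carrier A" and x: "x \<in> carrier A"
    and smult: "\<And>y. y \<in> carrier A \<Longrightarrow> c \<odot>\<^bsub>A\<^esub> y = k \<otimes>\<^bsub>A\<^esub> y"
  shows "c \<odot>\<^bsub>alg_quot A I\<^esub> (I +>\<^bsub>A\<^esub> x) = I +>\<^bsub>A\<^esub> (c \<odot>\<^bsub>A\<^esub> x)"
proof -
  interpret cring A by (rule A)
  interpret ideal I A by (rule I)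
  have "I +>\<^bsub>A\<^esub> (c \<odot>\<^bsub>A\<^esub> y) = I +>\<^bsub>A\<^esub> (c \<odot>\<^bsub>A\<^esub> x)" if "y \<in> I +>\<^bsub>A\<^esub> x" for y
  proof -
    from that obtain i where i: "i \<in> I" "y = i \<oplus>\<^bsub>A\<^esub> x"
      by (auto simp: a_r_coset_def')
    then have "i \<in> carrier A" by simp
    then have "c \<odot>\<^bsub>A\<^esub> y = k \<otimes>\<^bsub>A\<^esub> i \<oplus>\<^bsub>A\<^esub> c \<odot>\<^bsub>A\<^esub> x"
      using i x k by (simp add: smult r_distr)
    then have "c \<odot>\<^bsub>A\<^esub> y \<in> I +>\<^bsub>A\<^esub> (c \<odot>\<^bsub>A\<^esub> x)"
      using I_l_closed[OF i(1) k] by (auto simp: a_r_coset_def')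
    then show ?thesis
      using k x by (intro a_repr_independence'[symmetric]) (simp_all add: smult)
  qed
  moreover have "x \<in> I +>\<^bsub>A\<^esub> x" using x by (rule a_rcos_self)
  ultimately show ?thesis
    unfolding alg_quot_simps by blast
qed


subsection \<open>Comparison with the polynomial ring in all nine variables\<close>

declare One_nat_def [simp del]

abbreviation (input) "PA \<equiv> poly_alg {1, 2 :: nat}"
abbreviation (input) "PB \<equiv> poly_alg {3..9 :: nat}"
abbreviation (input) "PQ \<equiv> alg_quot PB CM_ideal"
abbreviation (input) "PF \<equiv> free_pair_alg PA PQ"
abbreviation (input) "PT \<equiv> tensor_ideal PA PQ"

definition coset :: "nat cpoly \<Rightarrow> nat cpoly set" where
  "coset q = CM_ideal +>\<^bsub>PB\<^esub> q"

lemma CM_ideal_eq: "CM_ideal = rel_ideal \<inter> {p. cpoly_vars p \<subseteq> {3..9}}"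
  unfolding CM_ideal_def by (rule genideal_CM_relations) simp

lemma ideal_CM_ideal: "ideal CM_ideal PB"
proof -
  interpret cring PB by (rule cring_poly_alg)
  show ?thesis
    unfolding CM_ideal_def
    by (rule genideal_ideal) (use cpoly_vars_rel in \<open>auto simp: CM_relations_eq\<close>)
qed

lemma cring_PQ: "cring PQ"
  by (rule cring_alg_quot[OF ideal_CM_ideal cring_poly_alg])

lemma in_coset: "q' \<in> coset q \<longleftrightarrow> (\<exists>i\<in>CM_ideal. q' = i + q)"
  by (auto simp: coset_def a_r_coset_def')

lemma carrier_PQ: "carrier PQ = coset ` {q. cpoly_vars q \<subseteq> {3..9}}"
  by (auto simp: alg_quot_simps FactRing_def A_RCOSETS_def' coset_def)

lemma coset_carrier: "cpoly_vars q \<subseteq> {3..9} \<Longrightarrow> coset q \<in> carrier PQ"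
  by (auto simp: carrier_PQ)

lemma coset_hom:
  assumes "cpoly_vars p \<subseteq> {3..9}" "cpoly_vars q \<subseteq> {3..9}"
  shows "coset p \<oplus>\<^bsub>PQ\<^esub> coset q = coset (p + q)" "coset p \<otimes>\<^bsub>PQ\<^esub> coset q = coset (p * q)"
    "c \<odot>\<^bsub>PQ\<^esub> coset p = coset (cconst c * p)"
proof -
  interpret cring PB by (rule cring_poly_alg)
  interpret ideal CM_ideal PB by (rule ideal_CM_ideal)
  show "coset p \<oplus>\<^bsub>PQ\<^esub> coset q = coset (p + q)"
    using assms a_rcos_sum[of p q] by (simp add: alg_quot_simps FactRing_def coset_def)
  show "coset p \<otimes>\<^bsub>PQ\<^esub> coset q = coset (p * q)"
    using assms rcoset_mult_add[of p q] by (simp add: alg_quot_simps FactRing_def coset_def)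
  show "c \<odot>\<^bsub>PQ\<^esub> coset p = coset (cconst c * p)"
    unfolding coset_def
    using assms by (subst alg_quot_smult[OF ideal_CM_ideal cring_poly_alg, of "cconst c"]) simp_all
qed

lemma coset_one: "\<one>\<^bsub>PQ\<^esub> = coset 1"
  by (simp add: alg_quot_simps FactRing_def coset_def)

lemma coset_eq_0:
  assumes "r \<in> CM_ideal"
  shows "coset r = coset 0"
proof -
  have vars: "cpoly_vars r \<subseteq> {3..9}" and r: "r \<in> rel_ideal" using assms by (auto simp: CM_ideal_eq)
  interpret cring PB by (rule cring_poly_alg)
  interpret ideal CM_ideal PB by (rule ideal_CM_ideal)
  have "r \<in> CM_ideal +>\<^bsub>PB\<^esub> 0" using assms by (auto simp: a_r_coset_def')
  then show ?thesis unfolding coset_def by (intro a_repr_independence'[symmetric]) simp_all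
qed

lemma cring_PF: "cring PF"
  by (rule cring_free_pair_alg[OF cring_poly_alg cring_PQ])

lemma PF_add: "f \<in> carrier PF \<Longrightarrow> g \<in> carrier PF \<Longrightarrow> (\<lambda>z. f z + g z) \<in> carrier PF"
  using cring.cring_simprules(1)[OF cring_PF, of f g] by simp

lemma PF_scale: "f \<in> carrier PF \<Longrightarrow> (\<lambda>z. c * f z) \<in> carrier PF"
  by (cases "c = 0") auto

lemma PF_diff: "f \<in> carrier PF \<Longrightarrow> g \<in> carrier PF \<Longrightarrow> (\<lambda>z. f z - g z) \<in> carrier PF"
  using PF_add[OF _ PF_scale[of g "- 1"], of f] by simp

lemma PF_basis: "cpoly_vars x \<subseteq> {1, 2} \<Longrightarrow> y \<in> carrier PQ \<Longrightarrow> free_pair_basis (x, y) \<in> carrier PF"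
  using basis_carrier[of x PA y PQ] by simp

text \<open>Scalars act through multiples of the unit. Hence the ideal \<open>PT\<close> is a linear
  subspace, and \<open>alg_quot_smult\<close> applies to the tensor product.\<close>

lemma PF_scalar:
  assumes "f \<in> carrier PF"
  shows "(\<lambda>z. c * \<one>\<^bsub>PF\<^esub> z) \<otimes>\<^bsub>PF\<^esub> f = (\<lambda>z. c * f z)"
proof -
  interpret cring PF by (rule cring_PF)
  show ?thesis
  proof
    fix z
    have "((\<lambda>z. c * \<one>\<^bsub>PF\<^esub> z) \<otimes>\<^bsub>PF\<^esub> f) z = c * (\<one>\<^bsub>PF\<^esub> \<otimes>\<^bsub>PF\<^esub> f) z"
      unfolding free_pair_mult_eq pairing_scale ..
    then show "((\<lambda>z. c * \<one>\<^bsub>PF\<^esub> z) \<otimes>\<^bsub>PF\<^esub> f) z = c * f z"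
      by (simp only: l_one[OF assms])
  qed
qed

lemma bilinear_relations_carrier: "bilinear_relations PA PQ \<subseteq> carrier PF"
proof -
  interpret A: cring PA by (rule cring_poly_alg)
  interpret Q: cring PQ by (rule cring_PQ)
  have "c \<odot>\<^bsub>PQ\<^esub> y \<in> carrier PQ" if "y \<in> carrier PQ" for c y
  proof -
    from that obtain q where "cpoly_vars q \<subseteq> {3..9}" "y = coset q" by (auto simp: carrier_PQ)
    then show ?thesis by (simp add: coset_hom coset_carrier cpoly_vars_mult)
  qed
  then show ?thesis
    unfolding bilinear_relations_def
    by (intro subsetI, elim UnE; clarify; intro PF_diff PF_scale PF_basis;
        simp add: cpoly_vars_add cpoly_vars_mult Q.a_closed)
qed

lemma ideal_PT: "ideal PT PF"
proof -
  interpret cring PF by (rule cring_PF)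
  show ?thesis unfolding tensor_ideal_def by (rule genideal_ideal[OF bilinear_relations_carrier])
qed

lemma PT_carrier: "f \<in> PT \<Longrightarrow> f \<in> carrier PF"
  using ideal.Icarr[OF ideal_PT] .

lemma PT_add: "f \<in> PT \<Longrightarrow> g \<in> PT \<Longrightarrow> (\<lambda>z. f z + g z) \<in> PT"
  using additive_subgroup.a_closed[OF ideal.axioms(1)[OF ideal_PT], of f g] by simp

lemma PT_scale: "f \<in> PT \<Longrightarrow> (\<lambda>z. c * f z) \<in> PT"
proof -
  assume f: "f \<in> PT"
  interpret cring PF by (rule cring_PF)
  have "(\<lambda>z. c * \<one>\<^bsub>PF\<^esub> z) \<in> carrier PF"
    using PF_scale[OF one_closed, of c] .
  from ideal.I_l_closed[OF ideal_PT f this] show ?thesis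
    by (simp only: PF_scalar[OF PT_carrier[OF f]])
qed

lemma PT_bilinear: "f \<in> bilinear_relations PA PQ \<Longrightarrow> f \<in> PT"
proof -
  interpret cring PF by (rule cring_PF)
  show "f \<in> bilinear_relations PA PQ \<Longrightarrow> f \<in> PT"
    unfolding tensor_ideal_def using genideal_self[OF bilinear_relations_carrier] by blast
qed

text \<open>Congruence modulo the tensor ideal on representatives, so that calculations with tensors
  stay among functions rather than cosets.\<close>

definition teq :: "(nat cpoly \<times> nat cpoly set \<Rightarrow> complex) \<Rightarrow> (nat cpoly \<times> nat cpoly set \<Rightarrow> complex) \<Rightarrow> bool" where
  "teq f g \<longleftrightarrow> (\<lambda>z. f z - g z) \<in> PT"

lemma teq_refl: "teq f f"
  using additive_subgroup.zero_closed[OF ideal.axioms(1)[OF ideal_PT]] by (simp add: teq_def)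

lemma teq_sym: "teq f g \<Longrightarrow> teq g f"
  unfolding teq_def using PT_scale[of "\<lambda>z. f z - g z" "- 1"] by simp

lemma teq_trans [trans]: "teq f g \<Longrightarrow> teq g h \<Longrightarrow> teq f h"
  unfolding teq_def using PT_add[of "\<lambda>z. f z - g z" "\<lambda>z. g z - h z"] by simp

lemma teq_add: "teq f g \<Longrightarrow> teq f' g' \<Longrightarrow> teq (\<lambda>z. f z + f' z) (\<lambda>z. g z + g' z)"
  unfolding teq_def using PT_add[of "\<lambda>z. f z - g z" "\<lambda>z. f' z - g' z"] by (simp add: algebra_simps)

lemma teq_scale: "teq f g \<Longrightarrow> teq (\<lambda>z. c * f z) (\<lambda>z. c * g z)"
  unfolding teq_def using PT_scale[of "\<lambda>z. f z - g z" c] by (simp add: algebra_simps)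

context
  fixes x x' :: "nat cpoly" and y y'
  assumes x: "cpoly_vars x \<subseteq> {1, 2}" "cpoly_vars x' \<subseteq> {1, 2}" and y: "y \<in> carrier PQ" "y' \<in> carrier PQ"
begin

lemma teq_add_left:
  "teq (free_pair_basis (x + x', y)) (\<lambda>z. free_pair_basis (x, y) z + free_pair_basis (x', y) z)"
proof -
  have "(\<lambda>z. free_pair_basis (x + x', y) z - free_pair_basis (x, y) z - free_pair_basis (x', y) z) \<in> PT"
    by (rule PT_bilinear) (unfold bilinear_relations_def, rule UnI1, rule UnI1, rule UnI1, rule CollectI,
        rule exI[of _ x], rule exI[of _ "x'"], rule exI[of _ y], use x y in simp)
  then show ?thesis by (simp add: teq_def diff_diff_eq)
qed

lemma teq_add_right:
  "teq (free_pair_basis (x, y \<oplus>\<^bsub>PQ\<^esub> y')) (\<lambda>z. free_pair_basis (x, y) z + free_pair_basis (x, y') z)"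
proof -
  have "(\<lambda>z. free_pair_basis (x, y \<oplus>\<^bsub>PQ\<^esub> y') z - free_pair_basis (x, y) z - free_pair_basis (x, y') z) \<in> PT"
    by (rule PT_bilinear) (unfold bilinear_relations_def, rule UnI1, rule UnI1, rule UnI2, rule CollectI,
        rule exI[of _ x], rule exI[of _ y], rule exI[of _ "y'"], use x y in simp)
  then show ?thesis by (simp add: teq_def diff_diff_eq)
qed

lemma teq_smult_left: "teq (free_pair_basis (cconst c * x, y)) (\<lambda>z. c * free_pair_basis (x, y) z)"
proof -
  have "(\<lambda>z. free_pair_basis (cconst c * x, y) z - c * free_pair_basis (x, y) z) \<in> PT"
    by (rule PT_bilinear) (unfold bilinear_relations_def, rule UnI1, rule UnI2, rule CollectI,
        rule exI[of _ c], rule exI[of _ x], rule exI[of _ y], use x y in simp)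
  then show ?thesis by (simp add: teq_def)
qed

lemma teq_smult_right: "teq (free_pair_basis (x, c \<odot>\<^bsub>PQ\<^esub> y)) (\<lambda>z. c * free_pair_basis (x, y) z)"
proof -
  have "(\<lambda>z. free_pair_basis (x, c \<odot>\<^bsub>PQ\<^esub> y) z - c * free_pair_basis (x, y) z) \<in> PT"
    by (rule PT_bilinear) (unfold bilinear_relations_def, rule UnI2, rule CollectI,
        rule exI[of _ c], rule exI[of _ x], rule exI[of _ y], use x y in simp)
  then show ?thesis by (simp add: teq_def)
qed

end

text \<open>Both \<open>\<complex>[a\<^sub>1, \<dots>, a\<^sub>9]\<close> and the free vector space on pairs are monoid algebras; \<open>tensor_of\<close> is
  the algebra homomorphism induced by splitting a monomial into its part in \<open>a\<^sub>1, a\<^sub>2\<close> and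
  its part in \<open>a\<^sub>3, \<dots>, a\<^sub>9\<close>.\<close>

definition left_mono :: "(nat \<Rightarrow>\<^sub>0 nat) \<Rightarrow> nat cpoly" where
  "left_mono = mono_eval (\<lambda>i. if i \<in> {1, 2} then cvar i else 1)"

definition right_mono :: "(nat \<Rightarrow>\<^sub>0 nat) \<Rightarrow> nat cpoly" where
  "right_mono = mono_eval (\<lambda>i. if i \<in> {3..9} then cvar i else 1)"

definition mono_pair :: "(nat \<Rightarrow>\<^sub>0 nat) \<Rightarrow> nat cpoly \<times> nat cpoly set" where
  "mono_pair m = (left_mono m, coset (right_mono m))"

definition tensor_of :: "nat cpoly \<Rightarrow> nat cpoly \<times> nat cpoly set \<Rightarrow> complex" where
  "tensor_of p z = (\<Sum>m\<in>Poly_Mapping.keys p. Poly_Mapping.lookup p m * free_pair_basis (mono_pair m) z)"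

lemma cpoly_vars_mono_eval:
  assumes "\<And>i. cpoly_vars (s i) \<subseteq> V"
  shows "cpoly_vars (mono_eval s m) \<subseteq> V"
proof -
  have "cpoly_vars (\<Prod>i\<in>S. s i ^ Poly_Mapping.lookup m i) \<subseteq> V" if "finite S" for S
    using that by (induction S) (simp_all add: cpoly_vars_mult cpoly_vars_power assms)
  then show ?thesis by (simp add: mono_eval_def)
qed

lemma cpoly_vars_left_mono: "cpoly_vars (left_mono m) \<subseteq> {1, 2}"
  unfolding left_mono_def by (rule cpoly_vars_mono_eval) auto

lemma cpoly_vars_right_mono: "cpoly_vars (right_mono m) \<subseteq> {3..9}"
  unfolding right_mono_def by (rule cpoly_vars_mono_eval) simp

lemma mono_pair_add: "mono_pair (m + n) = pair_mult PA PQ (mono_pair m) (mono_pair n)"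
  by (simp add: mono_pair_def pair_mult_def coset_hom cpoly_vars_right_mono)
     (simp add: left_mono_def right_mono_def mono_eval_add)

lemma tensor_of_0: "tensor_of 0 = (\<lambda>z. 0)"
  by (simp add: tensor_of_def fun_eq_iff)

lemma tensor_of_single: "tensor_of (Poly_Mapping.single m c) = (\<lambda>z. c * free_pair_basis (mono_pair m) z)"
  by (simp add: tensor_of_def fun_eq_iff)

lemma tensor_of_add: "tensor_of (p + q) = (\<lambda>z. tensor_of p z + tensor_of q z)"
proof
  fix z
  show "tensor_of (p + q) z = tensor_of p z + tensor_of q z"
    unfolding tensor_of_def
    by (rule setsum_keys_plus_distrib[where f = "\<lambda>m c. c * free_pair_basis (mono_pair m) z"])
       (auto simp: algebra_simps)
qed

lemma tensor_of_scale: "tensor_of (cconst c * p) = (\<lambda>z. c * tensor_of p z)"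
  by (induction p rule: poly_mapping_single_induct)
     (simp_all add: tensor_of_0 tensor_of_single tensor_of_add mult_single distrib_left mult.assoc)

lemma tensor_of_carrier: "tensor_of p \<in> carrier PF"
proof (induction p rule: poly_mapping_single_induct)
  case zero
  then show ?case by (simp add: tensor_of_0)
next
  case (single m c)
  show ?case
    unfolding tensor_of_single mono_pair_def
    by (intro PF_scale PF_basis cpoly_vars_left_mono coset_carrier cpoly_vars_right_mono)
next
  case (add p q)
  then show ?case unfolding tensor_of_add by (rule PF_add)
qed

lemma tensor_of_mult: "tensor_of (p * q) = tensor_of p \<otimes>\<^bsub>PF\<^esub> tensor_of q"
proof -
  interpret cring PF by (rule cring_PF)
  show ?thesis
  proof (induction p rule: poly_mapping_single_induct)
    case zero
    have "\<zero>\<^bsub>PF\<^esub> \<otimes>\<^bsub>PF\<^esub> tensor_of q = \<zero>\<^bsub>PF\<^esub>"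
      by (rule l_null[OF tensor_of_carrier])
    then show ?case by (simp add: tensor_of_0)
  next
    case (single m c)
    show ?case
    proof (induction q rule: poly_mapping_single_induct)
      case zero
      have "tensor_of (Poly_Mapping.single m c) \<otimes>\<^bsub>PF\<^esub> \<zero>\<^bsub>PF\<^esub> = \<zero>\<^bsub>PF\<^esub>"
        by (rule r_null[OF tensor_of_carrier])
      then show ?case by (simp add: tensor_of_0)
    next
      case (single n d)
      show ?case
        by (simp add: fun_eq_iff tensor_of_single mult_single free_pair_mult_eq pairing_scale mono_pair_add)
    next
      case (add p q)
      show ?case
        unfolding distrib_left tensor_of_add add
        using r_distr[OF tensor_of_carrier[of p] tensor_of_carrier[of q]
          tensor_of_carrier[of "Poly_Mapping.single m c"]] by simp
    qed
  next
    case (add p p')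
    show ?case
      unfolding distrib_right tensor_of_add add
      using l_distr[OF tensor_of_carrier[of p] tensor_of_carrier[of p'] tensor_of_carrier[of q]] by simp
  qed
qed

lemma mono_eval_if_in:
  assumes "Poly_Mapping.keys m \<subseteq> V"
  shows "mono_eval (\<lambda>i. if i \<in> V then cvar i else 1) m = Poly_Mapping.single m 1"
  unfolding mono_eval_cvar[symmetric] mono_eval_def
  by (rule prod.cong) (use assms in auto)

lemma mono_eval_if_out:
  assumes "Poly_Mapping.keys m \<inter> V = {}"
  shows "mono_eval (\<lambda>i. if i \<in> V then cvar i else 1) m = 1"
  unfolding mono_eval_def by (rule prod.neutral) (use assms in auto)

lemma cpoly_vars_single: "c \<noteq> 0 \<Longrightarrow> cpoly_vars (Poly_Mapping.single m c) = Poly_Mapping.keys m"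
  by (simp add: cpoly_vars_def)

lemma tensor_of_single_mult:
  assumes m: "Poly_Mapping.keys m \<subseteq> {1, 2}" and n: "Poly_Mapping.keys n \<subseteq> {3..9}"
  shows "teq (tensor_of (Poly_Mapping.single m c * Poly_Mapping.single n d))
    (free_pair_basis (Poly_Mapping.single m c, coset (Poly_Mapping.single n d)))"
proof -
  have mn: "Poly_Mapping.keys m \<inter> {3..9} = {}" "Poly_Mapping.keys n \<inter> {1, 2} = {}"
    using m n by auto
  have "mono_pair (m + n) = (Poly_Mapping.single m 1, coset (Poly_Mapping.single n 1))"
    unfolding mono_pair_def left_mono_def right_mono_def mono_eval_add
      mono_eval_if_in[OF m] mono_eval_if_in[OF n] mono_eval_if_out[OF mn(1)] mono_eval_if_out[OF mn(2)]
    by simp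
  then have 1: "tensor_of (Poly_Mapping.single m c * Poly_Mapping.single n d)
      = (\<lambda>z. c * (d * free_pair_basis (Poly_Mapping.single m 1, coset (Poly_Mapping.single n 1)) z))"
    by (simp add: mult_single tensor_of_single mult.assoc)
  have vm: "cpoly_vars (Poly_Mapping.single m (1::complex)) \<subseteq> {1, 2}"
    and vn: "cpoly_vars (Poly_Mapping.single n (1::complex)) \<subseteq> {3..9}"
    using m n by (simp_all add: cpoly_vars_single)
  have d: "d \<odot>\<^bsub>PQ\<^esub> coset (Poly_Mapping.single n 1) = coset (Poly_Mapping.single n d)"
    using coset_hom(3)[OF vn vn, of d] by (simp add: mult_single)
  have vd: "cpoly_vars (Poly_Mapping.single n d) \<subseteq> {3..9}"
    using n by (cases "d = 0") (simp_all add: cpoly_vars_single)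
  have "teq (free_pair_basis (Poly_Mapping.single m 1, coset (Poly_Mapping.single n d)))
      (\<lambda>z. d * free_pair_basis (Poly_Mapping.single m 1, coset (Poly_Mapping.single n 1)) z)"
    using teq_smult_right[OF vm vm coset_carrier[OF vn] coset_carrier[OF vn], of d] by (simp only: d)
  then have 2: "teq (\<lambda>z. c * free_pair_basis (Poly_Mapping.single m 1, coset (Poly_Mapping.single n d)) z)
      (\<lambda>z. c * (d * free_pair_basis (Poly_Mapping.single m 1, coset (Poly_Mapping.single n 1)) z))"
    by (rule teq_scale)
  have "cconst c * Poly_Mapping.single m 1 = Poly_Mapping.single m c"
    by (simp add: mult_single)
  then have 3: "teq (free_pair_basis (Poly_Mapping.single m c, coset (Poly_Mapping.single n d)))
      (\<lambda>z. c * free_pair_basis (Poly_Mapping.single m 1, coset (Poly_Mapping.single n d)) z)"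
    using teq_smult_left[OF vm vm coset_carrier[OF vd] coset_carrier[OF vd], of c] by simp
  show ?thesis unfolding 1 by (rule teq_sym[OF teq_trans[OF 3 2]])
qed

lemma cpoly_vars_induct [consumes 1, case_names single add]:
  assumes "cpoly_vars p \<subseteq> V"
    "\<And>m c. Poly_Mapping.keys m \<subseteq> V \<Longrightarrow> Pr (Poly_Mapping.single m c)"
    "\<And>p q. cpoly_vars p \<subseteq> V \<Longrightarrow> cpoly_vars q \<subseteq> V \<Longrightarrow> Pr p \<Longrightarrow> Pr q \<Longrightarrow> Pr (p + q)"
  shows "Pr p"
proof -
  have "cpoly_vars p \<subseteq> V \<and> Pr p"
  proof (induction p rule: poly_mapping_single_induct)
    case zero
    show ?case using assms(2)[of 0 0] by simp
  next
    case (single m c)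
    then have "Poly_Mapping.keys m \<subseteq> V" using assms(1) by (auto simp: cpoly_vars_def)
    then show ?case using assms(2)[of m c] by (auto simp: cpoly_vars_def split: if_splits)
  qed (auto intro: assms(3) subsetD[OF cpoly_vars_add])
  then show ?thesis ..
qed

text \<open>Both sides are bilinear modulo \<open>PT\<close>, so monomials suffice. The right side
  sees \<open>q\<close> only through its coset, which is why the relations die in the tensor
  product.\<close>

lemma tensor_of_product:
  assumes x: "cpoly_vars x \<subseteq> {1, 2}" and q: "cpoly_vars q \<subseteq> {3..9}"
  shows "teq (tensor_of (x * q)) (free_pair_basis (x, coset q))"
  using x
proof (induction x rule: cpoly_vars_induct)
  case (single m c)
  have vm: "cpoly_vars (Poly_Mapping.single m c) \<subseteq> {1, 2}"
    using single by (cases "c = 0") (simp_all add: cpoly_vars_single)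
  show ?case
    using q
  proof (induction q rule: cpoly_vars_induct)
    case (single n d)
    then show ?case by (rule tensor_of_single_mult[OF \<open>Poly_Mapping.keys m \<subseteq> {1, 2}\<close>])
  next
    case (add p q)
    from teq_add[OF add(3,4)]
    have "teq (tensor_of (Poly_Mapping.single m c * (p + q)))
        (\<lambda>z. free_pair_basis (Poly_Mapping.single m c, coset p) z + free_pair_basis (Poly_Mapping.single m c, coset q) z)"
      by (simp add: distrib_left tensor_of_add)
    also have "teq \<dots> (free_pair_basis (Poly_Mapping.single m c, coset p \<oplus>\<^bsub>PQ\<^esub> coset q))"
      by (rule teq_sym[OF teq_add_right[OF vm vm coset_carrier[OF add(1)] coset_carrier[OF add(2)]]])
    finally show ?case by (simp only: coset_hom(1)[OF add(1,2)])
  qed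
next
  case (add x y)
  from teq_add[OF add(3,4)]
  have "teq (tensor_of ((x + y) * q)) (\<lambda>z. free_pair_basis (x, coset q) z + free_pair_basis (y, coset q) z)"
    by (simp add: distrib_right tensor_of_add)
  also have "teq \<dots> (free_pair_basis (x + y, coset q))"
    by (rule teq_sym[OF teq_add_left[OF add(1,2) coset_carrier[OF q] coset_carrier[OF q]]])
  finally show ?case .
qed

lemma tensor_of_relation: "r \<in> CM_relations \<Longrightarrow> tensor_of r \<in> PT"
proof -
  assume r: "r \<in> CM_relations"
  then have rI: "r \<in> CM_ideal"
    using rel_in_rel_ideal cpoly_vars_rel by (auto simp: CM_relations_eq CM_ideal_eq)
  then have vr: "cpoly_vars r \<subseteq> {3..9}" by (simp add: CM_ideal_eq)
  have "teq (tensor_of (1 * r)) (free_pair_basis (1, coset r))"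
    by (rule tensor_of_product) (use vr in simp_all)
  \<comment> \<open>The zero coset is written as 0 times itself, so that homogeneity in the second
    factor makes the pure tensor vanish.\<close>
  also have "free_pair_basis (1, coset r) = free_pair_basis (1, 0 \<odot>\<^bsub>PQ\<^esub> coset 0)"
    using coset_hom(3)[of 0 0 0] by (simp add: coset_eq_0[OF rI])
  also have "teq \<dots> (\<lambda>z. 0 * free_pair_basis (1, coset 0) z)"
    by (rule teq_smult_right[of 1 0 "coset 0" "coset 0"]) (simp_all add: coset_carrier)
  finally show ?thesis by (simp add: teq_def)
qed

lemma tensor_of_rel_ideal: "p \<in> rel_ideal \<Longrightarrow> tensor_of p \<in> PT"
proof -
  assume "p \<in> rel_ideal"
  then obtain c1 c2 c3 c4 c5 where
    p: "p = c1 * rel1 cvar + c2 * rel2 cvar + c3 * rel3 cvar + c4 * rel4 cvar + c5 * rel5 cvar"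
    unfolding rel_ideal_def by blast
  have "tensor_of (c * r) \<in> PT" if "r \<in> CM_relations" for c r
    unfolding tensor_of_mult
    by (rule ideal.I_l_closed[OF ideal_PT tensor_of_relation[OF that] tensor_of_carrier])
  then show ?thesis
    unfolding p tensor_of_add by (intro PT_add) (simp_all add: CM_relations_eq)
qed

section \<open>Evaluation of tensors on the Calogero-Moser pairs\<close>

definition coset_rep :: "nat cpoly set \<Rightarrow> nat cpoly" where
  "coset_rep U = (SOME q. q \<in> U)"

definition poly_of_tensor :: "(nat cpoly \<times> nat cpoly set \<Rightarrow> complex) \<Rightarrow> nat cpoly" where
  "poly_of_tensor f = (\<Sum>u | f u \<noteq> 0. cconst (f u) * (fst u * coset_rep (snd u)))"

definition eval_pair :: "matrix_pair \<Rightarrow> nat cpoly \<times> nat cpoly set \<Rightarrow> complex" where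
  "eval_pair z u = cpoly_eval (cm_traces z) (fst u) * cpoly_eval (cm_traces z) (coset_rep (snd u))"

definition eval_tensor :: "(nat cpoly \<times> nat cpoly set \<Rightarrow> complex) \<Rightarrow> matrix_pair \<Rightarrow> complex" where
  "eval_tensor f = (\<lambda>z\<in>CM_bar. pairing f (eval_pair z))"

lemma coset_rep:
  assumes "cpoly_vars q \<subseteq> {3..9}"
  obtains i where "i \<in> CM_ideal" "coset_rep (coset q) = i + q"
proof -
  have "0 \<in> CM_ideal" by (simp add: CM_ideal_eq rel_ideal_intros)
  then have "q \<in> coset q" by (force simp: in_coset)
  then have "coset_rep (coset q) \<in> coset q" unfolding coset_rep_def by (rule someI)
  then show thesis using that by (auto simp: in_coset)
qed

lemma cpoly_vars_coset_rep: "U \<in> carrier PQ \<Longrightarrow> cpoly_vars (coset_rep U) \<subseteq> {3..9}"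
proof -
  assume "U \<in> carrier PQ"
  then obtain q where q: "cpoly_vars q \<subseteq> {3..9}" "U = coset q" by (auto simp: carrier_PQ)
  obtain i where "i \<in> CM_ideal" "coset_rep U = i + q" using coset_rep[OF q(1)] q(2) by metis
  with q(1) show ?thesis by (simp add: CM_ideal_eq cpoly_vars_add)
qed

lemma coset_coset_rep: "U \<in> carrier PQ \<Longrightarrow> coset (coset_rep U) = U"
proof -
  assume "U \<in> carrier PQ"
  then obtain q where q: "cpoly_vars q \<subseteq> {3..9}" "U = coset q" by (auto simp: carrier_PQ)
  obtain i where i: "i \<in> CM_ideal" "coset_rep U = i + q" using coset_rep[OF q(1)] q(2) by metis
  interpret cring PB by (rule cring_poly_alg)
  interpret ideal CM_ideal PB by (rule ideal_CM_ideal)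
  have "i + q \<in> CM_ideal +>\<^bsub>PB\<^esub> q" using i by (auto simp: a_r_coset_def')
  then have "coset (coset_rep U) = coset q"
    unfolding i(2) coset_def by (rule a_repr_independence'[symmetric]) (use q in simp)
  then show ?thesis by (simp only: q(2))
qed

text \<open>The arbitrary choice in \<open>coset_rep\<close> is invisible here: representatives
  differ by elements of \<open>CM_ideal\<close>, which vanish at the traces.\<close>

lemma eval_pair_coset:
  assumes "z \<in> CM_bar" "cpoly_vars q \<subseteq> {3..9}"
  shows "eval_pair z (x, coset q) = cpoly_eval (cm_traces z) (x * q)"
proof -
  obtain i where i: "i \<in> CM_ideal" "coset_rep (coset q) = i + q" using assms(2) by (rule coset_rep)
  then have "cpoly_eval (cm_traces z) i = 0"
    using cpoly_eval_rel_ideal[OF _ satisfies_relations_cm_traces[OF assms(1)]] by (simp add: CM_ideal_eq)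
  then show ?thesis by (simp add: eval_pair_def i(2))
qed

lemma cpoly_eval_sum: "cpoly_eval x (sum g S) = (\<Sum>i\<in>S. cpoly_eval x (g i))"
  by (induction S rule: infinite_finite_induct) simp_all

lemma eval_tensor_eq: "eval_tensor f = restrict_traces (poly_of_tensor f)"
  by (simp add: eval_tensor_def restrict_traces_def poly_of_tensor_def pairing_def eval_pair_def cpoly_eval_sum)

lemma PF_carrierD:
  assumes "f \<in> carrier PF"
  shows "finite {u. f u \<noteq> 0}" "f u \<noteq> 0 \<Longrightarrow> cpoly_vars (fst u) \<subseteq> {1, 2} \<and> snd u \<in> carrier PQ"
proof -
  show "finite {u. f u \<noteq> 0}" using assms by simp
  have "{u. f u \<noteq> 0} \<subseteq> {p. cpoly_vars p \<subseteq> {1, 2}} \<times> carrier PQ"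
    using assms by simp
  moreover assume "f u \<noteq> 0"
  ultimately have "u \<in> {p. cpoly_vars p \<subseteq> {1, 2}} \<times> carrier PQ" by blast
  then show "cpoly_vars (fst u) \<subseteq> {1, 2} \<and> snd u \<in> carrier PQ"
    by (simp only: mem_Times_iff mem_Collect_eq)
qed

lemma eval_pair_mult:
  assumes z: "z \<in> CM_bar" and u: "snd u \<in> carrier PQ" "snd v \<in> carrier PQ"
  shows "eval_pair z (pair_mult PA PQ u v) = eval_pair z u * eval_pair z v"
proof -
  obtain p q where p: "cpoly_vars p \<subseteq> {3..9}" "snd u = coset p"
    and q: "cpoly_vars q \<subseteq> {3..9}" "snd v = coset q"
    using u by (auto simp: carrier_PQ)
  have "pair_mult PA PQ u v = (fst u * fst v, coset (p * q))"
    by (simp add: pair_mult_def p q coset_hom)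
  moreover have "u = (fst u, coset p)" "v = (fst v, coset q)"
    using p q by (metis prod.collapse)+
  ultimately show ?thesis
    using eval_pair_coset[OF z cpoly_vars_mult[OF p(1) q(1)], of "fst u * fst v"]
      eval_pair_coset[OF z p(1), of "fst u"] eval_pair_coset[OF z q(1), of "fst v"]
    by simp
qed

lemma eval_tensor_hom: "eval_tensor \<in> ring_hom PF CM_coord"
proof (rule ring_hom_memI)
  fix f show "eval_tensor f \<in> carrier CM_coord"
    unfolding eval_tensor_eq by (rule restrict_traces_carrier)
next
  fix f g assume f: "f \<in> carrier PF" and g: "g \<in> carrier PF"
  have "pairing (f \<otimes>\<^bsub>PF\<^esub> g) (eval_pair z) = pairing f (eval_pair z) * pairing g (eval_pair z)"
    if z: "z \<in> CM_bar" for z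
  proof -
    have "pairing (f \<otimes>\<^bsub>PF\<^esub> g) (eval_pair z)
        = pairing f (\<lambda>u. pairing g (\<lambda>v. eval_pair z (pair_mult PA PQ u v)))"
      by (rule pairing_free_pair_mult[OF PF_carrierD(1)[OF f] PF_carrierD(1)[OF g]])
    also have "\<dots> = pairing f (\<lambda>u. pairing g (\<lambda>v. eval_pair z v * eval_pair z u))"
      using PF_carrierD(2)[OF f] PF_carrierD(2)[OF g]
      by (intro pairing_cong) (simp add: eval_pair_mult[OF z] mult.commute)
    also have "\<dots> = pairing f (\<lambda>u. eval_pair z u * pairing g (eval_pair z))"
      by (intro pairing_cong) (subst pairing_mult_right, rule mult.commute)
    finally show ?thesis by (simp add: pairing_mult_right)
  qed
  then show "eval_tensor (f \<otimes>\<^bsub>PF\<^esub> g) = eval_tensor f \<otimes>\<^bsub>CM_coord\<^esub> eval_tensor g"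
    by (auto simp: eval_tensor_def)
  show "eval_tensor (f \<oplus>\<^bsub>PF\<^esub> g) = eval_tensor f \<oplus>\<^bsub>CM_coord\<^esub> eval_tensor g"
    using pairing_add[OF PF_carrierD(1)[OF f] PF_carrierD(1)[OF g]] by (auto simp: eval_tensor_def)
next
  have "eval_pair z (1, coset 1) = 1" if "z \<in> CM_bar" for z
    by (subst eval_pair_coset[OF that]) simp_all
  then show "eval_tensor \<one>\<^bsub>PF\<^esub> = \<one>\<^bsub>CM_coord\<^esub>"
    by (auto simp: eval_tensor_def coset_one)
qed

text \<open>Expand \<open>f\<close> in basis elements; each is congruent to \<open>tensor_of\<close>
  of the product of its components by \<open>tensor_of_product\<close>.\<close>

lemma teq_tensor_of_poly_of_tensor:
  assumes f: "f \<in> carrier PF"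
  shows "teq f (tensor_of (poly_of_tensor f))"
proof -
  have "teq (\<lambda>z. \<Sum>u\<in>S. f u * free_pair_basis u z)
      (tensor_of (\<Sum>u\<in>S. cconst (f u) * (fst u * coset_rep (snd u))))"
    if "finite S" "S \<subseteq> {u. f u \<noteq> 0}" for S
    using that
  proof (induction S)
    case empty
    show ?case by (simp add: tensor_of_0 teq_refl)
  next
    case (insert u S)
    have u: "cpoly_vars (fst u) \<subseteq> {1, 2}" "snd u \<in> carrier PQ"
      using PF_carrierD(2)[OF f, of u] insert.prems by auto
    have "teq (tensor_of (fst u * coset_rep (snd u))) (free_pair_basis u)"
      using tensor_of_product[OF u(1) cpoly_vars_coset_rep[OF u(2)]] by (simp add: coset_coset_rep[OF u(2)])
    from teq_add[OF teq_scale[OF teq_sym[OF this], of "f u"] insert.IH] insert.prems insert.hyps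
    show ?case by (simp add: tensor_of_add tensor_of_scale)
  qed
  from this[OF PF_carrierD(1)[OF f] order_refl]
  have "teq (\<lambda>z. pairing f (\<lambda>u. free_pair_basis u z)) (tensor_of (poly_of_tensor f))"
    by (simp add: pairing_def poly_of_tensor_def)
  moreover have "(\<lambda>z. pairing f (\<lambda>u. free_pair_basis u z)) = f"
    by (rule ext) (rule eq_pairing_basis[OF PF_carrierD(1)[OF f], symmetric])
  ultimately show ?thesis by simp
qed

lemma cpoly_vars_sum: "(\<And>i. i \<in> S \<Longrightarrow> cpoly_vars (g i) \<subseteq> V) \<Longrightarrow> cpoly_vars (sum g S) \<subseteq> V"
  by (induction S rule: infinite_finite_induct) (simp_all add: cpoly_vars_add)

text \<open>Injectivity comes down to \<open>vanishing_in_rel_ideal\<close>: the polynomial of a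
  tensor in the kernel vanishes on \<open>CM_bar\<close>, hence lies in \<open>rel_ideal\<close>,
  which \<open>tensor_of\<close> sends into \<open>PT\<close>; and the tensor is congruent to that
  image.\<close>

lemma a_kernel_eval_tensor: "a_kernel PF CM_coord eval_tensor = PT"
proof
  interpret F: cring PF by (rule cring_PF)
  interpret C: cring CM_coord by (rule cring_CM_coord)
  interpret h: ring_hom_ring PF CM_coord eval_tensor
    by (rule ring_hom_ringI2[OF F.ring_axioms C.ring_axioms eval_tensor_hom])
  show "PT \<subseteq> a_kernel PF CM_coord eval_tensor"
    unfolding tensor_ideal_def
  proof (rule F.genideal_minimal[OF h.kernel_is_ideal])
    show "bilinear_relations PA PQ \<subseteq> a_kernel PF CM_coord eval_tensor"
    proof
      fix f assume f: "f \<in> bilinear_relations PA PQ"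
      have "pairing f (eval_pair z) = 0" if z: "z \<in> CM_bar" for z
      proof -
        have fin_diff: "finite {u. free_pair_basis a u - free_pair_basis b u \<noteq> 0}" for a b
          by (rule finite_subset[of _ "{a, b}"]) (auto simp: free_pair_basis_def)
        have fin_scale: "finite {u. c * free_pair_basis a u \<noteq> 0}" for c a
          by (rule finite_subset[of _ "{a}"]) (auto simp: free_pair_basis_def)
        have p3: "pairing (\<lambda>u. free_pair_basis a u - free_pair_basis b u - free_pair_basis c u) (eval_pair z)
            = eval_pair z a - eval_pair z b - eval_pair z c" for a b c
          by (simp only: pairing_diff[OF fin_diff finite_basis] pairing_diff[OF finite_basis finite_basis] pairing_basis)
        have p2: "pairing (\<lambda>u. free_pair_basis a u - c * free_pair_basis b u) (eval_pair z)
            = eval_pair z a - c * eval_pair z b" for a b c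
          by (simp only: pairing_diff[OF finite_basis fin_scale] pairing_scale pairing_basis)
        note e = eval_pair_coset[OF z]
        show ?thesis
          using f unfolding bilinear_relations_def
          by (auto simp: p2 p3 carrier_PQ coset_hom e cpoly_vars_add cpoly_vars_mult distrib_left distrib_right)
      qed
      moreover have "f \<in> carrier PF" using f bilinear_relations_carrier by blast
      ultimately show "f \<in> a_kernel PF CM_coord eval_tensor"
        unfolding a_kernel_def' by (auto simp: eval_tensor_def simp del: free_pair_alg_simps(1))
    qed
  qed
  show "a_kernel PF CM_coord eval_tensor \<subseteq> PT"
  proof
    fix f assume "f \<in> a_kernel PF CM_coord eval_tensor"
    then have f: "f \<in> carrier PF" and zero: "eval_tensor f = \<zero>\<^bsub>CM_coord\<^esub>"
      unfolding a_kernel_def' by blast+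
    have "cpoly_vars (poly_of_tensor f) \<subseteq> {1..9}"
      unfolding poly_of_tensor_def
    proof (intro cpoly_vars_sum cpoly_vars_mult)
      fix u assume "u \<in> {u. f u \<noteq> 0}"
      then have "cpoly_vars (fst u) \<subseteq> {1, 2}" "cpoly_vars (coset_rep (snd u)) \<subseteq> {3..9}"
        using PF_carrierD(2)[OF f, of u] cpoly_vars_coset_rep by auto
      then show "cpoly_vars (fst u) \<subseteq> {1..9}" "cpoly_vars (coset_rep (snd u)) \<subseteq> {1..9}" by force+
    qed simp
    moreover have "cpoly_eval (cm_traces z) (poly_of_tensor f) = 0" if "z \<in> CM_bar" for z
      using fun_cong[OF zero, of z] that by (simp add: eval_tensor_eq restrict_traces_def)
    ultimately have "tensor_of (poly_of_tensor f) \<in> PT"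
      by (intro tensor_of_rel_ideal vanishing_in_rel_ideal)
    then have "teq (tensor_of (poly_of_tensor f)) (\<lambda>z. 0)" by (simp add: teq_def)
    with teq_tensor_of_poly_of_tensor[OF f] have "teq f (\<lambda>z. 0)" by (rule teq_trans)
    then show "f \<in> PT" by (simp add: teq_def)
  qed
qed

lemma eval_tensor_surj: "eval_tensor ` carrier PF = carrier CM_coord"
proof
  show "eval_tensor ` carrier PF \<subseteq> carrier CM_coord"
    by (auto simp: eval_tensor_eq)
  show "carrier CM_coord \<subseteq> eval_tensor ` carrier PF"
  proof
    fix f assume "f \<in> carrier CM_coord"
    then have "f \<in> restrict_traces ` {p. cpoly_vars p \<subseteq> {1..9}}"
      using minimal_generating_family_CM_gen alg_generate_CM_gen[OF order_refl]
      unfolding minimal_generating_family_def by blast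
    then obtain p where vp: "cpoly_vars p \<subseteq> {1..9}" and f: "f = restrict_traces p" by blast
    have "pairing (tensor_of p) (eval_pair z) = cpoly_eval (cm_traces z) p" if z: "z \<in> CM_bar" for z
      using vp
    proof (induction p rule: cpoly_vars_induct)
      case (single m c)
      have "eval_pair z (mono_pair m) = cpoly_eval (cm_traces z) (left_mono m * right_mono m)"
        unfolding mono_pair_def by (rule eval_pair_coset[OF z cpoly_vars_right_mono])
      \<comment> \<open>The index sets \<open>{1, 2}\<close> and \<open>{3..9}\<close> partition
        \<open>{1..9}\<close>, so each variable survives in exactly one of the two parts.\<close>
      also have "left_mono m * right_mono m = mono_eval cvar m"
        unfolding left_mono_def right_mono_def mono_eval_def prod.distrib[symmetric]
      proof (rule prod.cong[OF refl])
        fix i assume "i \<in> Poly_Mapping.keys m"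
        then have "i \<in> {1..9}" using single by blast
        then show "(if i \<in> {1, 2} then cvar i else 1) ^ Poly_Mapping.lookup m i
          * (if i \<in> {3..9} then cvar i else 1) ^ Poly_Mapping.lookup m i
          = (cvar i ^ Poly_Mapping.lookup m i :: nat cpoly)" by auto
      qed
      finally have e: "eval_pair z (mono_pair m) = cpoly_eval (cm_traces z) (mono_eval cvar m)" .
      have "cpoly_eval (cm_traces z) (Poly_Mapping.single m c)
          = c * cpoly_eval (cm_traces z) (mono_eval cvar m)"
        by (subst single_eq_const_mult_mono) simp
      then show ?case
        by (simp add: tensor_of_single pairing_scale e)
    next
      case (add p q)
      then show ?case
        unfolding tensor_of_add
        by (simp add: pairing_add[OF PF_carrierD(1)[OF tensor_of_carrier] PF_carrierD(1)[OF tensor_of_carrier]])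
    qed
    then have "f = eval_tensor (tensor_of p)"
      by (auto simp: f eval_tensor_def restrict_traces_def)
    then show "f \<in> eval_tensor ` carrier PF" using tensor_of_carrier by blast
  qed
qed

text \<open>The form in which the first isomorphism theorem \<open>FactRing_iso_set\<close> supplies
  the map: \<open>eval_tensor\<close> is constant on a coset, and its single value is taken.\<close>

definition tensor_iso :: "(nat cpoly \<times> nat cpoly set \<Rightarrow> complex) set \<Rightarrow> matrix_pair \<Rightarrow> complex" where
  "tensor_iso X = the_elem (eval_tensor ` X)"

lemma tensor_iso_coset:
  assumes "f \<in> carrier PF"
  shows "tensor_iso (PT +>\<^bsub>PF\<^esub> f) = eval_tensor f"
proof -
  interpret F: cring PF by (rule cring_PF)
  interpret C: cring CM_coord by (rule cring_CM_coord)
  interpret h: ring_hom_ring PF CM_coord eval_tensor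
    by (rule ring_hom_ringI2[OF F.ring_axioms C.ring_axioms eval_tensor_hom])
  show ?thesis
    using h.the_elem_simp[OF assms] unfolding tensor_iso_def a_kernel_eval_tensor .
qed

lemma tensor_iso: "tensor_iso \<in> alg_iso (tensor_alg PA PQ) CM_coord"
proof -
  interpret F: cring PF by (rule cring_PF)
  interpret C: cring CM_coord by (rule cring_CM_coord)
  interpret h: ring_hom_ring PF CM_coord eval_tensor
    by (rule ring_hom_ringI2[OF F.ring_axioms C.ring_axioms eval_tensor_hom])
  have "tensor_iso \<in> ring_iso (PF Quot PT) CM_coord"
    using h.FactRing_iso_set[OF eval_tensor_surj] unfolding a_kernel_eval_tensor tensor_iso_def .
  \<comment> \<open>Ring isomorphisms see only the ring operations, which \<open>tensor_alg\<close>
    shares with \<open>PF Quot PT\<close>; the scalars are treated separately below.\<close>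
  then have iso: "tensor_iso \<in> ring_iso (tensor_alg PA PQ) CM_coord"
    unfolding ring_iso_def ring_hom_def tensor_alg_def alg_quot_simps .
  have "tensor_iso (c \<odot>\<^bsub>tensor_alg PA PQ\<^esub> U) = c \<odot>\<^bsub>CM_coord\<^esub> tensor_iso U"
    if U: "U \<in> carrier (tensor_alg PA PQ)" for c U
  proof -
    obtain f where f: "f \<in> carrier PF" "U = PT +>\<^bsub>PF\<^esub> f"
      using U unfolding tensor_alg_def alg_quot_simps
      by (auto simp: FactRing_def A_RCOSETS_def' simp del: free_pair_alg_simps(1))
    have "c \<odot>\<^bsub>tensor_alg PA PQ\<^esub> U = PT +>\<^bsub>PF\<^esub> (c \<odot>\<^bsub>PF\<^esub> f)"
      unfolding tensor_alg_def f(2)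
    proof (rule alg_quot_smult[OF ideal_PT cring_PF _ f(1)])
      show "(\<lambda>z. c * \<one>\<^bsub>PF\<^esub> z) \<in> carrier PF" by (rule PF_scale[OF F.one_closed])
      show "c \<odot>\<^bsub>PF\<^esub> g = (\<lambda>z. c * \<one>\<^bsub>PF\<^esub> z) \<otimes>\<^bsub>PF\<^esub> g" if "g \<in> carrier PF" for g
        unfolding PF_scalar[OF that] by simp
    qed
    moreover have "c \<odot>\<^bsub>PF\<^esub> f \<in> carrier PF" using PF_scale[OF f(1), of c] by simp
    ultimately show ?thesis
      using f(1) unfolding f(2)
      by (simp add: tensor_iso_coset del: free_pair_alg_simps(1)) (auto simp: eval_tensor_def pairing_scale)
  qed
  with iso show ?thesis unfolding alg_iso_def by blast
qed

lemma tensor_iso_pure: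
  assumes "cpoly_vars x \<subseteq> {1, 2}" "cpoly_vars q \<subseteq> {3..9}"
  shows "tensor_iso (pure_tensor PA PQ x (coset q)) = restrict_traces (x * q)"
  unfolding pure_tensor_def
  by (subst tensor_iso_coset[OF PF_basis[OF assms(1) coset_carrier[OF assms(2)]]])
     (auto simp: eval_tensor_def restrict_traces_def eval_pair_coset assms(2))

theorem theorem5p1:
  shows "minimal_generating_family CM_coord {1..9} CM_gen
    \<and> a_kernel (poly_alg {1..9}) CM_coord CM_eval = Idl\<^bsub>poly_alg {1..9}\<^esub> CM_relations
    \<and> (let P = poly_alg {1, 2}; Q = alg_quot (poly_alg {3..9}) CM_ideal
       in \<exists>\<phi> \<in> alg_iso (tensor_alg P Q) CM_coord.
            (\<forall>i\<in>{1, 2}. \<phi> (pure_tensor P Q (cvar i) \<one>\<^bsub>Q\<^esub>) = CM_gen i) \<and>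
            (\<forall>i\<in>{3..9}. \<phi> (pure_tensor P Q \<one>\<^bsub>P\<^esub> (CM_ideal +>\<^bsub>poly_alg {3..9}\<^esub> cvar i)) = CM_gen i))"
proof -
  have "tensor_iso (pure_tensor PA PQ (cvar i) \<one>\<^bsub>PQ\<^esub>) = CM_gen i" if "i \<in> {1, 2}" for i
    unfolding coset_one using that CM_gen_eq[of i] by (subst tensor_iso_pure) auto
  moreover have "tensor_iso (pure_tensor PA PQ \<one>\<^bsub>PA\<^esub> (CM_ideal +>\<^bsub>PB\<^esub> cvar i)) = CM_gen i"
    if "i \<in> {3..9}" for i
    unfolding coset_def[symmetric] using that CM_gen_eq[of i] tensor_iso_pure[of 1 "cvar i"] by auto
  ultimately show ?thesis
    unfolding Let_def
    using minimal_generating_family_CM_gen a_kernel_CM_eval tensor_iso by blast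
qed

end
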